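(* Let $\mathcal{Q}$ and $\mathcal{Q}'$ be commutative quantales. Then $$\mathcal{Q}\simeq\mathcal{Q}'\ \Longleftrightarrow\ \mathsf{Ord}(\mathcal{Q})\simeq\mathsf{Ord}(\mathcal{Q}')\ \Longleftrightarrow\ \mathsf{Mod}(\mathcal{Q})\simeq\mathsf{Mod}(\mathcal{Q}').$$
   Context: $\mathsf{Sup}$ is the category of complete lattices and maps preserving arbitrary suprema. A quantaloid is a $\mathsf{Sup}$-enriched category; it is small when it has a set of objects; a quantale is a one-object quantaloid (a monoid in $\mathsf{Sup}$), so in particular it is unital; it is commutative when its multiplication is. Homomorphisms of quantaloids are $\mathsf{Sup}$-functors. $\mathsf{Mod}(\mathcal{Q})$ is the quantaloid of homomorphisms $\mathcal{Q}^{\mathsf{op}}\to\mathsf{Sup}$ and natural transformations, ordered componentwise. $\mathsf{Idm}(\mathcal{Q})$ is the quantaloid whose objects are the idempotent arrows of $\mathcal{Q}$ (viewed as a one-object quantaloid); an arrow from $e$ to $f$ is a $\mathcal{Q}$-arrow $b$ with $b\circ e=b=f\circ b$; composition and local order are as in $\mathcal{Q}$, and the identity on $e$ is $e$. For a small quantaloid $\mathcal{R}$: an $\mathcal{R}$-category $\mathbb{A}$ is a set $\mathbb{A}_0$ with a type function $t\colon\mathbb{A}_0\to\mathcal{R}_0$ and hom-arrows $\mathbb{A}(a',a)\colon ta\to ta'$ in $\mathcal{R}$ such that $\mathbb{A}(a'',a')\circ\mathbb{A}(a',a)\leq\mathbb{A}(a'',a)$ and $1_{ta}\leq\mathbb{A}(a,a)$.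 A functor $F\colon\mathbb{A}\to\mathbb{B}$ is a map $\mathbb{A}_0\to\mathbb{B}_0$ with $t(Fa)=ta$ and $\mathbb{A}(a',a)\leq\mathbb{B}(Fa',Fa)$; put $F\leq G$ when $1_{ta}\leq\mathbb{B}(Fa,Ga)$ for all $a$. A distributor $\Phi$ from $\mathbb{A}$ to $\mathbb{B}$ is a family of arrows $\Phi(b,a)\colon ta\to tb$ with $\mathbb{B}(b,b')\circ\Phi(b',a)\leq\Phi(b,a)$ and $\Phi(b,a')\circ\mathbb{A}(a',a)\leq\Phi(b,a)$; composition is $(\Psi\otimes\Phi)(c,a)=\bigvee_b\Psi(c,b)\circ\Phi(b,a)$, the identity on $\mathbb{A}$ has elements $\mathbb{A}(a',a)$, and distributors are ordered elementwise. $\mathbb{C}$ is Cauchy complete if for every $\mathbb{A}$ each left adjoint distributor from $\mathbb{A}$ to $\mathbb{C}$ is of the form $\mathbb{C}(-,F-)$ for some functor $F\colon\mathbb{A}\to\mathbb{C}$. $\mathsf{Cat}_{\mathsf{cc}}(\mathcal{R})$ is the locally ordered category of Cauchy complete $\mathcal{R}$-categories and functors (the local order need not be antisymmetric). By definition $\mathsf{Ord}(\mathcal{Q})=\mathsf{Cat}_{\mathsf{cc}}(\mathsf{Idm}(\mathcal{Q}))$. The symbol $\simeq$ denotes equivalence of quantaloids between quantaloids (for one-object quantaloids this amounts to isomorphism of quantales), and biequivalence of locally ordered categories between the categories $\mathsf{Ord}$. *)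

theory Defs
  imports "HOL-Algebra.Complete_Lattice"
begin

section \<open>Locally ordered categories and quantaloids\<close>

text \<open>
  Arrows do not determine their domain and codomain (one and the same element of a quantale is an
  arrow between many different idempotents), so composition and the action of a functor on arrows
  take the objects as arguments: \<open>cmp C X Y Z g f\<close> is the composite of \<open>f : X \<rightarrow> Y\<close> with
  \<open>g : Y \<rightarrow> Z\<close>.  The ordered set of arrows is a \<^typ>\<open>'m gorder\<close>; for quantaloids its
  equality is \<open>(=)\<close>, for merely preordered homs it is the equivalence induced by the preorder.
\<close>

record ('o, 'm) ocat =
  ob :: "'o set"
  hom :: "'o \<Rightarrow> 'o \<Rightarrow> 'm gorder"
  idt :: "'o \<Rightarrow> 'm"
  cmp :: "'o \<Rightarrow> 'o \<Rightarrow> 'o \<Rightarrow> 'm \<Rightarrow> 'm \<Rightarrow> 'm"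

abbreviation arr :: "('o, 'm) ocat \<Rightarrow> 'o \<Rightarrow> 'o \<Rightarrow> 'm set" where
  "arr C X Y \<equiv> carrier (hom C X Y)"

locale locally_ordered_category =
  fixes C :: "('o, 'm) ocat"
  assumes hom_order: "\<lbrakk>X \<in> ob C; Y \<in> ob C\<rbrakk> \<Longrightarrow> weak_partial_order (hom C X Y)"
    and idt_arr: "X \<in> ob C \<Longrightarrow> idt C X \<in> arr C X X"
    and cmp_arr: "\<lbrakk>X \<in> ob C; Y \<in> ob C; Z \<in> ob C; f \<in> arr C X Y; g \<in> arr C Y Z\<rbrakk>
      \<Longrightarrow> cmp C X Y Z g f \<in> arr C X Z"
    and cmp_idt_right: "\<lbrakk>X \<in> ob C; Y \<in> ob C; f \<in> arr C X Y\<rbrakk> \<Longrightarrow> cmp C X X Y f (idt C X) = f"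
    and cmp_idt_left: "\<lbrakk>X \<in> ob C; Y \<in> ob C; f \<in> arr C X Y\<rbrakk> \<Longrightarrow> cmp C X Y Y (idt C Y) f = f"
    and cmp_assoc: "\<lbrakk>W \<in> ob C; X \<in> ob C; Y \<in> ob C; Z \<in> ob C;
        f \<in> arr C W X; g \<in> arr C X Y; h \<in> arr C Y Z\<rbrakk>
      \<Longrightarrow> cmp C W Y Z h (cmp C W X Y g f) = cmp C W X Z (cmp C X Y Z h g) f"
    and cmp_mono: "\<lbrakk>X \<in> ob C; Y \<in> ob C; Z \<in> ob C;
        f \<in> arr C X Y; f' \<in> arr C X Y; g \<in> arr C Y Z; g' \<in> arr C Y Z;
        f \<sqsubseteq>\<^bsub>hom C X Y\<^esub> f'; g \<sqsubseteq>\<^bsub>hom C Y Z\<^esub> g'\<rbrakk>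
      \<Longrightarrow> cmp C X Y Z g f \<sqsubseteq>\<^bsub>hom C X Z\<^esub> cmp C X Y Z g' f'"

definition sup_preserving :: "'a gorder \<Rightarrow> 'b gorder \<Rightarrow> ('a \<Rightarrow> 'b) \<Rightarrow> bool" where
  "sup_preserving L M f \<longleftrightarrow>
     f \<in> carrier L \<rightarrow> carrier M \<and> (\<forall>A. A \<subseteq> carrier L \<longrightarrow> f (\<Squnion>\<^bsub>L\<^esub> A) = \<Squnion>\<^bsub>M\<^esub> (f ` A))"

locale quantaloid = locally_ordered_category Q for Q :: "('o, 'm) ocat" +
  assumes hom_complete: "\<lbrakk>X \<in> ob Q; Y \<in> ob Q\<rbrakk> \<Longrightarrow> complete_lattice (hom Q X Y)"
    and cmp_sup_right: "\<lbrakk>X \<in> ob Q; Y \<in> ob Q; Z \<in> ob Q; g \<in> arr Q Y Z\<rbrakk>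
      \<Longrightarrow> sup_preserving (hom Q X Y) (hom Q X Z) (\<lambda>f. cmp Q X Y Z g f)"
    and cmp_sup_left: "\<lbrakk>X \<in> ob Q; Y \<in> ob Q; Z \<in> ob Q; f \<in> arr Q X Y\<rbrakk>
      \<Longrightarrow> sup_preserving (hom Q Y Z) (hom Q X Z) (\<lambda>g. cmp Q X Y Z g f)"

definition op_ocat :: "('o, 'm) ocat \<Rightarrow> ('o, 'm) ocat" where
  "op_ocat C =
     \<lparr>ob = ob C, hom = (\<lambda>X Y. hom C Y X), idt = idt C, cmp = (\<lambda>X Y Z g f. cmp C Z Y X f g)\<rparr>"


section \<open>Homomorphisms and equivalence of quantaloids\<close>

record ('o, 'm, 'p, 'n) fctr =
  fob :: "'o \<Rightarrow> 'p"
  farr :: "'o \<Rightarrow> 'o \<Rightarrow> 'm \<Rightarrow> 'n"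

definition quantaloid_hom :: "('o, 'm) ocat \<Rightarrow> ('p, 'n) ocat \<Rightarrow> ('o, 'm, 'p, 'n) fctr \<Rightarrow> bool" where
  "quantaloid_hom Q R F \<longleftrightarrow>
     (\<forall>X\<in>ob Q. fob F X \<in> ob R \<and> farr F X X (idt Q X) = idt R (fob F X)) \<and>
     (\<forall>X\<in>ob Q. \<forall>Y\<in>ob Q. sup_preserving (hom Q X Y) (hom R (fob F X) (fob F Y)) (farr F X Y)) \<and>
     (\<forall>X\<in>ob Q. \<forall>Y\<in>ob Q. \<forall>Z\<in>ob Q. \<forall>f\<in>arr Q X Y. \<forall>g\<in>arr Q Y Z.
        farr F X Z (cmp Q X Y Z g f) =
        cmp R (fob F X) (fob F Y) (fob F Z) (farr F Y Z g) (farr F X Y f))"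

definition fctr_id :: "('o, 'm, 'o, 'm) fctr" where
  "fctr_id = \<lparr>fob = (\<lambda>X. X), farr = (\<lambda>X Y f. f)\<rparr>"

definition fctr_comp ::
  "('p, 'n, 'q, 'k) fctr \<Rightarrow> ('o, 'm, 'p, 'n) fctr \<Rightarrow> ('o, 'm, 'q, 'k) fctr" where
  "fctr_comp G F =
     \<lparr>fob = (\<lambda>X. fob G (fob F X)), farr = (\<lambda>X Y f. farr G (fob F X) (fob F Y) (farr F X Y f))\<rparr>"

text \<open>
  The quantaloid of homomorphisms \<open>Q \<rightarrow> R\<close> and natural transformations, ordered componentwise.
  The values of a homomorphism outside \<open>Q\<close> are unconstrained; homomorphisms that differ only there
  are isomorphic objects.
\<close>

definition hom_quantaloid ::
  "('o, 'm) ocat \<Rightarrow> ('p, 'n) ocat \<Rightarrow> (('o, 'm, 'p, 'n) fctr, 'o \<Rightarrow> 'n) ocat" where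
  "hom_quantaloid Q R =
     \<lparr>ob = {F. quantaloid_hom Q R F},
      hom = (\<lambda>F G.
        \<lparr>carrier = {\<alpha> \<in> (\<Pi>\<^sub>E X\<in>ob Q. arr R (fob F X) (fob G X)).
            \<forall>X\<in>ob Q. \<forall>Y\<in>ob Q. \<forall>f\<in>arr Q X Y.
              cmp R (fob F X) (fob F Y) (fob G Y) (\<alpha> Y) (farr F X Y f) =
              cmp R (fob F X) (fob G X) (fob G Y) (farr G X Y f) (\<alpha> X)},
         eq = (=),
         le = (\<lambda>\<alpha> \<beta>. \<forall>X\<in>ob Q. \<alpha> X \<sqsubseteq>\<^bsub>hom R (fob F X) (fob G X)\<^esub> \<beta> X)\<rparr>),
      idt = (\<lambda>F. \<lambda>X\<in>ob Q. idt R (fob F X)),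
      cmp = (\<lambda>F G H \<beta> \<alpha>. \<lambda>X\<in>ob Q. cmp R (fob F X) (fob G X) (fob H X) (\<beta> X) (\<alpha> X))\<rparr>"

definition isomorphic :: "('o, 'm) ocat \<Rightarrow> 'o \<Rightarrow> 'o \<Rightarrow> bool" where
  "isomorphic C X Y \<longleftrightarrow>
     (\<exists>f\<in>arr C X Y. \<exists>g\<in>arr C Y X. cmp C X Y X g f = idt C X \<and> cmp C Y X Y f g = idt C Y)"

definition quantaloid_equivalent ::
  "('o, 'm) ocat \<Rightarrow> ('p, 'n) ocat \<Rightarrow> bool" (infix \<open>\<simeq>\<^sub>q\<close> 50) where
  "Q \<simeq>\<^sub>q R \<longleftrightarrow>
     (\<exists>F G. quantaloid_hom Q R F \<and> quantaloid_hom R Q G \<and>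
        isomorphic (hom_quantaloid Q Q) fctr_id (fctr_comp G F) \<and>
        isomorphic (hom_quantaloid R R) (fctr_comp F G) fctr_id)"


section \<open>Biequivalence of locally ordered categories\<close>

text \<open>
  All 2-cells are inequalities, so the coherence conditions on homomorphisms (pseudofunctors) and on
  pseudonatural transformations hold automatically.
\<close>

definition pseudofunctor :: "('o, 'm) ocat \<Rightarrow> ('p, 'n) ocat \<Rightarrow> ('o, 'm, 'p, 'n) fctr \<Rightarrow> bool" where
  "pseudofunctor C D F \<longleftrightarrow>
     (\<forall>X\<in>ob C. fob F X \<in> ob D \<and>
        farr F X X (idt C X) .=\<^bsub>hom D (fob F X) (fob F X)\<^esub> idt D (fob F X)) \<and>
     (\<forall>X\<in>ob C. \<forall>Y\<in>ob C. \<forall>f\<in>arr C X Y. farr F X Y f \<in> arr D (fob F X) (fob F Y)) \<and>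
     (\<forall>X\<in>ob C. \<forall>Y\<in>ob C. \<forall>f\<in>arr C X Y. \<forall>g\<in>arr C X Y. f \<sqsubseteq>\<^bsub>hom C X Y\<^esub> g \<longrightarrow>
        farr F X Y f \<sqsubseteq>\<^bsub>hom D (fob F X) (fob F Y)\<^esub> farr F X Y g) \<and>
     (\<forall>X\<in>ob C. \<forall>Y\<in>ob C. \<forall>Z\<in>ob C. \<forall>f\<in>arr C X Y. \<forall>g\<in>arr C Y Z.
        farr F X Z (cmp C X Y Z g f) .=\<^bsub>hom D (fob F X) (fob F Z)\<^esub>
        cmp D (fob F X) (fob F Y) (fob F Z) (farr F Y Z g) (farr F X Y f))"

definition equivalence_arr :: "('o, 'm) ocat \<Rightarrow> 'o \<Rightarrow> 'o \<Rightarrow> 'm \<Rightarrow> bool" where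
  "equivalence_arr C X Y f \<longleftrightarrow>
     f \<in> arr C X Y \<and>
     (\<exists>g\<in>arr C Y X. cmp C X Y X g f .=\<^bsub>hom C X X\<^esub> idt C X \<and>
                    cmp C Y X Y f g .=\<^bsub>hom C Y Y\<^esub> idt C Y)"

definition pseudonat_equivalent ::
  "('o, 'm) ocat \<Rightarrow> ('p, 'n) ocat \<Rightarrow> ('o, 'm, 'p, 'n) fctr \<Rightarrow> ('o, 'm, 'p, 'n) fctr \<Rightarrow> bool" where
  "pseudonat_equivalent C D F G \<longleftrightarrow>
     (\<exists>\<alpha>. (\<forall>X\<in>ob C. equivalence_arr D (fob F X) (fob G X) (\<alpha> X)) \<and>
          (\<forall>X\<in>ob C. \<forall>Y\<in>ob C. \<forall>f\<in>arr C X Y.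
             cmp D (fob F X) (fob F Y) (fob G Y) (\<alpha> Y) (farr F X Y f) .=\<^bsub>hom D (fob F X) (fob G Y)\<^esub>
             cmp D (fob F X) (fob G X) (fob G Y) (farr G X Y f) (\<alpha> X)))"

definition biequivalent ::
  "('o, 'm) ocat \<Rightarrow> ('p, 'n) ocat \<Rightarrow> bool" (infix \<open>\<simeq>\<^sub>b\<close> 50) where
  "C \<simeq>\<^sub>b D \<longleftrightarrow>
     (\<exists>F G. pseudofunctor C D F \<and> pseudofunctor D C G \<and>
        pseudonat_equivalent C C fctr_id (fctr_comp G F) \<and>
        pseudonat_equivalent D D (fctr_comp F G) fctr_id)"


section \<open>Small sets\<close>

text \<open>
  The objects of an enriched category and the elements of a complete lattice form a \<^emph>\<open>set\<close>, as opposed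
  to a proper class.  Here the class of all things is a type \<^typ>\<open>'u\<close> and \<open>small\<close> singles out those
  subsets of it that count as sets.  Of the closure properties of sets only those below are required;
  in place of power sets only exponents by the quantales at hand are.  With \<^typ>\<open>'u\<close> the class of
  all sets of set theory and \<open>small\<close> meaning ``is not a proper class'' they all hold; on the other
  hand they can be satisfied for any given quantales, see \<open>universe_exists\<close> below.
\<close>

locale universe =
  fixes small :: "'u set \<Rightarrow> bool"
  assumes small_subset: "\<lbrakk>small A; B \<subseteq> A\<rbrakk> \<Longrightarrow> small B"
    and small_image: "small A \<Longrightarrow> small (f ` A)"
    and small_UN: "\<lbrakk>small I; \<And>i. i \<in> I \<Longrightarrow> small (S i)\<rbrakk> \<Longrightarrow> small (\<Union>i\<in>I. S i)"
    and small_infinite: "\<exists>A. small A \<and> infinite A"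

definition closed_under_exponents :: "('u set \<Rightarrow> bool) \<Rightarrow> 'q itself \<Rightarrow> bool" where
  "closed_under_exponents small (_ :: 'q itself) \<longleftrightarrow>
     (\<forall>A. small A \<longrightarrow>
        (\<exists>code :: ('q \<Rightarrow> 'u) \<Rightarrow> 'u. inj_on code (UNIV \<rightarrow> A) \<and> small (code ` (UNIV \<rightarrow> A))))"

lemma closed_under_exponents_list:
  fixes i :: "'q \<Rightarrow> 'a"
  assumes "inj i"
  shows "closed_under_exponents (\<lambda>A :: ('a list \<Rightarrow> bool) set. True) TYPE('q)"
proof -
  define code :: "('q \<Rightarrow> 'a list \<Rightarrow> bool) \<Rightarrow> 'a list \<Rightarrow> bool" where
    "code F = (\<lambda>l. F (inv i (hd l)) (tl l))" for F
  have "code F (i q # l) = F q l" for F q l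
    using assms by (simp add: code_def)
  then have "inj code"
    by (intro injI ext) metis
  then show ?thesis
    unfolding closed_under_exponents_def by (auto intro: inj_on_subset)
qed

lemma universe_exists:
  fixes small :: "(('q + 'r) list \<Rightarrow> bool) set \<Rightarrow> bool"
  assumes "small = (\<lambda>_. True)"
  shows "universe small \<and> closed_under_exponents small TYPE('q) \<and>
    closed_under_exponents small TYPE('r)"
proof -
  have "inj (\<lambda>n. (\<lambda>l. length l = n) :: ('q + 'r) list \<Rightarrow> bool)"
    by (rule injI) (metis Ex_list_of_length)
  then have "infinite (UNIV :: (('q + 'r) list \<Rightarrow> bool) set)"
    by (meson finite_imageD finite_subset infinite_UNIV_nat subset_UNIV)
  then show ?thesis
    unfolding assms universe_def
    by (auto intro: closed_under_exponents_list[of Inl] closed_under_exponents_list[of Inr])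
qed


section \<open>\<open>Sup\<close> and modules\<close>

definition Sup_quantaloid :: "('u set \<Rightarrow> bool) \<Rightarrow> ('u gorder, 'u \<Rightarrow> 'u) ocat" where
  "Sup_quantaloid small =
     \<lparr>ob = {L. complete_lattice L \<and> small (carrier L)},
      hom = (\<lambda>L M.
        \<lparr>carrier = {f \<in> extensional (carrier L). sup_preserving L M f},
         eq = (=),
         le = (\<lambda>f g. \<forall>x\<in>carrier L. f x \<sqsubseteq>\<^bsub>M\<^esub> g x)\<rparr>),
      idt = (\<lambda>L. \<lambda>x\<in>carrier L. x),
      cmp = (\<lambda>L M N g f. compose (carrier L) g f)\<rparr>"

definition Modules ::
  "('u set \<Rightarrow> bool) \<Rightarrow> ('o, 'm) ocat \<Rightarrow> (('o, 'm, 'u gorder, 'u \<Rightarrow> 'u) fctr, 'o \<Rightarrow> 'u \<Rightarrow> 'u) ocat" where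
  "Modules small Q = hom_quantaloid (op_ocat Q) (Sup_quantaloid small)"


section \<open>Categories enriched in a quantaloid\<close>

record ('u, 'o, 'm) ecat =
  elts :: "'u set"
  ty :: "'u \<Rightarrow> 'o"
  ehom :: "'u \<Rightarrow> 'u \<Rightarrow> 'm"

text \<open>As in the literature, \<open>ehom A a' a\<close> is an arrow from \<open>ty A a\<close> to \<open>ty A a'\<close>.\<close>

definition enriched_category ::
  "('u set \<Rightarrow> bool) \<Rightarrow> ('o, 'm) ocat \<Rightarrow> ('u, 'o, 'm) ecat \<Rightarrow> bool" where
  "enriched_category small R A \<longleftrightarrow>
     small (elts A) \<and>
     (\<forall>a\<in>elts A. ty A a \<in> ob R) \<and>
     (\<forall>a\<in>elts A. \<forall>a'\<in>elts A. ehom A a' a \<in> arr R (ty A a) (ty A a')) \<and>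
     (\<forall>a\<in>elts A. \<forall>a'\<in>elts A. \<forall>a''\<in>elts A.
        cmp R (ty A a) (ty A a') (ty A a'') (ehom A a'' a') (ehom A a' a)
          \<sqsubseteq>\<^bsub>hom R (ty A a) (ty A a'')\<^esub> ehom A a'' a) \<and>
     (\<forall>a\<in>elts A. idt R (ty A a) \<sqsubseteq>\<^bsub>hom R (ty A a) (ty A a)\<^esub> ehom A a a)"

definition enriched_functor ::
  "('o, 'm) ocat \<Rightarrow> ('u, 'o, 'm) ecat \<Rightarrow> ('u, 'o, 'm) ecat \<Rightarrow> ('u \<Rightarrow> 'u) \<Rightarrow> bool" where
  "enriched_functor R A B F \<longleftrightarrow>
     F \<in> elts A \<rightarrow>\<^sub>E elts B \<and>
     (\<forall>a\<in>elts A. ty B (F a) = ty A a) \<and>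
     (\<forall>a\<in>elts A. \<forall>a'\<in>elts A.
        ehom A a' a \<sqsubseteq>\<^bsub>hom R (ty A a) (ty A a')\<^esub> ehom B (F a') (F a))"

definition functor_le ::
  "('o, 'm) ocat \<Rightarrow> ('u, 'o, 'm) ecat \<Rightarrow> ('u, 'o, 'm) ecat \<Rightarrow> ('u \<Rightarrow> 'u) \<Rightarrow> ('u \<Rightarrow> 'u) \<Rightarrow> bool" where
  "functor_le R A B F G \<longleftrightarrow>
     (\<forall>a\<in>elts A. idt R (ty A a) \<sqsubseteq>\<^bsub>hom R (ty A a) (ty A a)\<^esub> ehom B (F a) (G a))"

definition distributor ::
  "('o, 'm) ocat \<Rightarrow> ('u, 'o, 'm) ecat \<Rightarrow> ('u, 'o, 'm) ecat \<Rightarrow> ('u \<Rightarrow> 'u \<Rightarrow> 'm) \<Rightarrow> bool" where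
  "distributor R A B \<Phi> \<longleftrightarrow>
     (\<forall>a\<in>elts A. \<forall>b\<in>elts B. \<Phi> b a \<in> arr R (ty A a) (ty B b)) \<and>
     (\<forall>a\<in>elts A. \<forall>b\<in>elts B. \<forall>b'\<in>elts B.
        cmp R (ty A a) (ty B b') (ty B b) (ehom B b b') (\<Phi> b' a)
          \<sqsubseteq>\<^bsub>hom R (ty A a) (ty B b)\<^esub> \<Phi> b a) \<and>
     (\<forall>a\<in>elts A. \<forall>a'\<in>elts A. \<forall>b\<in>elts B.
        cmp R (ty A a) (ty A a') (ty B b) (\<Phi> b a') (ehom A a' a)
          \<sqsubseteq>\<^bsub>hom R (ty A a) (ty B b)\<^esub> \<Phi> b a)"

definition distributor_comp ::
  "('o, 'm) ocat \<Rightarrow> ('u, 'o, 'm) ecat \<Rightarrow> ('u, 'o, 'm) ecat \<Rightarrow> ('u, 'o, 'm) ecat \<Rightarrow>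
     ('u \<Rightarrow> 'u \<Rightarrow> 'm) \<Rightarrow> ('u \<Rightarrow> 'u \<Rightarrow> 'm) \<Rightarrow> 'u \<Rightarrow> 'u \<Rightarrow> 'm" where
  "distributor_comp R A B C \<Psi> \<Phi> = (\<lambda>c a.
     \<Squnion>\<^bsub>hom R (ty A a) (ty C c)\<^esub>
       ((\<lambda>b. cmp R (ty A a) (ty B b) (ty C c) (\<Psi> c b) (\<Phi> b a)) ` elts B))"

definition distributor_le ::
  "('o, 'm) ocat \<Rightarrow> ('u, 'o, 'm) ecat \<Rightarrow> ('u, 'o, 'm) ecat \<Rightarrow>
     ('u \<Rightarrow> 'u \<Rightarrow> 'm) \<Rightarrow> ('u \<Rightarrow> 'u \<Rightarrow> 'm) \<Rightarrow> bool" where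
  "distributor_le R A B \<Phi> \<Phi>' \<longleftrightarrow>
     (\<forall>a\<in>elts A. \<forall>b\<in>elts B. \<Phi> b a \<sqsubseteq>\<^bsub>hom R (ty A a) (ty B b)\<^esub> \<Phi>' b a)"

definition left_adjoint_distributor ::
  "('o, 'm) ocat \<Rightarrow> ('u, 'o, 'm) ecat \<Rightarrow> ('u, 'o, 'm) ecat \<Rightarrow> ('u \<Rightarrow> 'u \<Rightarrow> 'm) \<Rightarrow> bool" where
  "left_adjoint_distributor R A B \<Phi> \<longleftrightarrow>
     distributor R A B \<Phi> \<and>
     (\<exists>\<Psi>. distributor R B A \<Psi> \<and>
        distributor_le R A A (ehom A) (distributor_comp R A B A \<Psi> \<Phi>) \<and>
        distributor_le R B B (distributor_comp R B A B \<Phi> \<Psi>) (ehom B))"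

definition Cauchy_complete ::
  "('u set \<Rightarrow> bool) \<Rightarrow> ('o, 'm) ocat \<Rightarrow> ('u, 'o, 'm) ecat \<Rightarrow> bool" where
  "Cauchy_complete small R C \<longleftrightarrow>
     (\<forall>A \<Phi>. enriched_category small R A \<and> left_adjoint_distributor R A C \<Phi> \<longrightarrow>
        (\<exists>F. enriched_functor R A C F \<and> (\<forall>a\<in>elts A. \<forall>c\<in>elts C. \<Phi> c a = ehom C c (F a))))"

definition Cat_cc ::
  "('u set \<Rightarrow> bool) \<Rightarrow> ('o, 'm) ocat \<Rightarrow> (('u, 'o, 'm) ecat, 'u \<Rightarrow> 'u) ocat" where
  "Cat_cc small R =
     \<lparr>ob = {C. enriched_category small R C \<and> Cauchy_complete small R C},
      hom = (\<lambda>A B.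
        \<lparr>carrier = {F. enriched_functor R A B F},
         eq = (\<lambda>F G. functor_le R A B F G \<and> functor_le R A B G F),
         le = functor_le R A B\<rparr>),
      idt = (\<lambda>A. \<lambda>a\<in>elts A. a),
      cmp = (\<lambda>A B C G F. compose (elts A) G F)\<rparr>"


section \<open>Quantales\<close>

class quantale = Complete_Lattices.complete_lattice + monoid_mult +
  assumes Sup_mult_distrib: "Sup A * x = Sup ((\<lambda>a. a * x) ` A)"
    and mult_Sup_distrib: "x * Sup A = Sup ((\<lambda>a. x * a) ` A)"

class comm_quantale = quantale + ab_semigroup_mult

definition one_object_quantaloid :: "'q::quantale itself \<Rightarrow> (unit, 'q) ocat" where
  "one_object_quantaloid _ =
     \<lparr>ob = UNIV,
      hom = (\<lambda>_ _. \<lparr>carrier = UNIV, eq = (=), le = (\<le>)\<rparr>),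
      idt = (\<lambda>_. 1),
      cmp = (\<lambda>_ _ _ b a. b * a)\<rparr>"

definition Idm :: "'q::quantale itself \<Rightarrow> ('q, 'q) ocat" where
  "Idm _ =
     \<lparr>ob = {e. e * e = e},
      hom = (\<lambda>e f. \<lparr>carrier = {b. b * e = b \<and> f * b = b}, eq = (=), le = (\<le>)\<rparr>),
      idt = (\<lambda>e. e),
      cmp = (\<lambda>_ _ _ b a. b * a)\<rparr>"

lemma (in partial_order) complete_lattice_if_lubs:
  assumes lub: "\<And>A. A \<subseteq> carrier L \<Longrightarrow> \<exists>s. is_lub L s A"
  shows "Complete_Lattice.complete_lattice L"
proof (rule complete_latticeI)
  fix A assume A: "A \<subseteq> carrier L"
  then show "\<exists>s. is_lub L s A" by (rule lub)
  obtain s where s: "is_lub L s (Lower L A)" using lub[of "Lower L A"] by auto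
  have "greatest L s (Lower L A)"
    unfolding greatest_def
    using s A by (auto simp: least_def Upper_def Lower_def)
  then show "\<exists>i. is_glb L i A" ..
qed

lemma (in partial_order) sup_eqI:
  assumes "is_lub L s A"
  shows "\<Squnion>\<^bsub>L\<^esub> A = s"
  unfolding sup_def using assms least_unique by (metis someI)

lemma complete_lattice_suborder:
  fixes K :: "'a::Complete_Lattices.complete_lattice set"
  defines "L \<equiv> \<lparr>carrier = K, eq = (=), le = (\<le>)\<rparr>"
  assumes K: "\<And>A. A \<subseteq> K \<Longrightarrow> Sup A \<in> K"
  shows "Complete_Lattice.complete_lattice L"
    and "A \<subseteq> K \<Longrightarrow> \<Squnion>\<^bsub>L\<^esub> A = Sup A"
proof -
  interpret partial_order L
    unfolding L_def by standard auto
  have lub: "is_lub L (Sup A) A" if "A \<subseteq> K" for A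
    using that K unfolding least_def Upper_def L_def by (auto intro: Sup_upper Sup_least)
  show "Complete_Lattice.complete_lattice L"
    using lub by (intro complete_lattice_if_lubs) (auto simp: L_def)
  show "\<Squnion>\<^bsub>L\<^esub> A = Sup A" if "A \<subseteq> K"
    using lub[OF that] by (rule sup_eqI)
qed

lemma quantaloid_suborder:
  fixes Obs :: "'o set" and K :: "'o \<Rightarrow> 'o \<Rightarrow> 'q::quantale set" and i :: "'o \<Rightarrow> 'q"
  defines "Q \<equiv> \<lparr>ob = Obs, hom = (\<lambda>X Y. \<lparr>carrier = K X Y, eq = (=), le = (\<le>)\<rparr>),
    idt = i, cmp = (\<lambda>_ _ _ b a. b * a)\<rparr>"
  assumes K: "\<And>X Y A. A \<subseteq> K X Y \<Longrightarrow> Sup A \<in> K X Y"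
    and "\<And>X. X \<in> Obs \<Longrightarrow> i X \<in> K X X"
    and "\<And>X Y Z a b. a \<in> K X Y \<Longrightarrow> b \<in> K Y Z \<Longrightarrow> b * a \<in> K X Z"
    and "\<And>X Y a. a \<in> K X Y \<Longrightarrow> i Y * a = a \<and> a * i X = a"
  shows "quantaloid Q"
proof -
  have mono: "b * a \<le> b' * a'" if "a \<le> a'" "b \<le> b'" for a a' b b' :: 'q
  proof -
    have "b * a' = sup (b * a) (b * a')" 
      using mult_Sup_distrib[of b "{a, a'}"] that by (simp add: Lattices.sup_absorb2)
    moreover have "b' * a' = sup (b * a') (b' * a')"
      using Sup_mult_distrib[of "{b, b'}" a'] that by (simp add: Lattices.sup_absorb2)
    ultimately show ?thesis by (metis Lattices.sup_ge1 order_trans)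
  qed
  have cl: "Complete_Lattice.complete_lattice (hom Q X Y)" for X Y
    unfolding Q_def by (simp add: complete_lattice_suborder K)
  then have "weak_partial_order (hom Q X Y)" for X Y
    by (meson complete_lattice.axioms(1) partial_order.axioms(1))
  moreover have S: "\<Squnion>\<^bsub>hom Q X Y\<^esub> A = Sup A" if "A \<subseteq> K X Y" for A X Y
    using that by (simp add: Q_def complete_lattice_suborder K)
  have "sup_preserving (hom Q X Y) (hom Q X Z) (\<lambda>a. b * a)" if "b \<in> K Y Z" for X Y Z b
  proof -
    have "(\<lambda>a. b * a) ` A \<subseteq> K X Z" if "A \<subseteq> K X Y" for A
      using assms(4) \<open>b \<in> K Y Z\<close> that by auto
    then show ?thesis
      unfolding sup_preserving_def using assms(4) that S
      by (auto simp: Q_def mult_Sup_distrib Pi_iff)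
  qed
  moreover have "sup_preserving (hom Q Y Z) (hom Q X Z) (\<lambda>b. b * a)" if "a \<in> K X Y" for X Y Z a
  proof -
    have "(\<lambda>b. b * a) ` A \<subseteq> K X Z" if "A \<subseteq> K Y Z" for A
      using assms(4) \<open>a \<in> K X Y\<close> that by auto
    then show ?thesis
      unfolding sup_preserving_def using assms(4) that S
      by (auto simp: Q_def Sup_mult_distrib Pi_iff)
  qed
  ultimately show ?thesis
    using assms(3-5) cl mono
    by (intro quantaloid.intro locally_ordered_category.intro quantaloid_axioms.intro)
      (simp_all add: Q_def mult.assoc)
qed

lemma quantaloid_one_object: "quantaloid (one_object_quantaloid TYPE('q::quantale))"
  unfolding one_object_quantaloid_def by (rule quantaloid_suborder) auto

lemma quantaloid_Idm: "quantaloid (Idm TYPE('q::quantale))"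
  unfolding Idm_def
proof (rule quantaloid_suborder)
  show "Sup A \<in> {b. b * e = b \<and> f * b = b}" if "A \<subseteq> {b. b * e = b \<and> f * b = b}" for A e and f::'q
    using that by (auto simp: Sup_mult_distrib mult_Sup_distrib subset_iff cong: image_cong)
qed (auto simp: mult.assoc, metis mult.assoc)


definition Ord ::
  "('u set \<Rightarrow> bool) \<Rightarrow> 'q::quantale itself \<Rightarrow> (('u, 'q, 'q) ecat, 'u \<Rightarrow> 'u) ocat" where
  "Ord small Q = Cat_cc small (Idm Q)"

definition Mod ::
  "('u set \<Rightarrow> bool) \<Rightarrow> 'q::quantale itself \<Rightarrow>
     ((unit, 'q, 'u gorder, 'u \<Rightarrow> 'u) fctr, unit \<Rightarrow> 'u \<Rightarrow> 'u) ocat" where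
  "Mod small Q = Modules small (one_object_quantaloid Q)"

end

theory Submission
  imports Defs
begin

text \<open>
  Each of the three equivalences holds if and only if \<open>Q\<close> and \<open>Q'\<close> are isomorphic quantales.  An
  isomorphism clearly induces the other equivalences, by relabelling; for one-object quantaloids the
  converse is immediate, because an invertible element of a commutative quantale conjugates
  trivially.  The content lies in recovering \<open>Q\<close> from \<open>Mod(Q)\<close> and from \<open>Ord(Q)\<close>, and both times
  \<open>Q\<close> is found as a centre.

  \<^emph>\<open>Modules.\<close>  Since \<open>Q\<close> is commutative, the action of \<open>q\<close> on a module is a module morphism, natural
  in the module.  A module morphism out of the regular module \<open>Q\<close> is determined by the image of
  \<open>1\<close>, which is arbitrary; hence every family of endomorphisms that commutes with the morphisms out
  of \<open>Q\<close> is the action of one scalar (\<open>regular_module_detects_scalars\<close>).  So \<open>Q\<close> is the ordered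
  monoid of natural endomorphisms of the identity of \<open>Mod(Q)\<close>, which an equivalence preserves.

  \<^emph>\<open>Ordered sheaves.\<close>  Scalars do not act on an \<open>Idm(Q)\<close>-category by functors, but each acts by the
  distributor \<open>q \<cdot> A(b,a)\<close>, and the same argument identifies \<open>Q\<close> with the centre of the quantaloid
  of distributors between Cauchy complete categories (\<open>unit_element_detects_scalars\<close>).  What remains
  is to see that a biequivalence \<open>Ord(Q) \<simeq> Ord(Q')\<close>, which is given on functors only, induces an
  equivalence on distributors.  A distributor from \<open>A\<close> to \<open>B\<close> is presented by a cospan of functors
  \<open>f : A \<rightarrow> X \<leftarrow> B : g\<close>, by the formula \<open>\<Phi>(b,a) = X(g b, f a)\<close>.  The point is that the order of the
  presented distributors and their composition can be expressed by means of functors and their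
  order alone:
  \<^item> The functors \<open>G\<close> such that \<open>u \<circ> G \<le> v \<circ> G\<close> implies \<open>u \<le> v\<close>, the lax epimorphisms, are exactly
    those with dense image (\<open>lax_epi_dense\<close> is the essential half).  The fully faithful functors
    are therefore those that factor through a lax epimorphism only if it has a retraction
    (\<open>full_faithful_embedding\<close>, \<open>embedding_full_faithful\<close>).
  \<^item> The distributor of \<open>(X,f,g)\<close> lies below that of \<open>(Y,u,v)\<close> if and only if there are functors
    \<open>k : X \<rightarrow> E\<close> and \<open>h : Y \<rightarrow> E\<close> with \<open>h\<close> fully faithful such that \<open>k \<circ> f \<le> h \<circ> u\<close> and
    \<open>h \<circ> v \<le> k \<circ> g\<close> (\<open>cospan_le_iff\<close>).
  \<^item> The composite of \<open>(X,f,g)\<close> with \<open>(Y,u,v)\<close> is the least among the cospans \<open>(E, k \<circ> f, h \<circ> v)\<close>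
    with \<open>h \<circ> u \<le> k \<circ> g\<close> (\<open>cospan_composite_exists\<close>, \<open>cospan_composite_least\<close>).

  All these statements need suitable small Cauchy complete categories \<open>E\<close>.  The category of all
  presheaves on a category is Cauchy complete but in general too large.  Inside it, the Cauchy closure of a
  small set \<open>S\<close> of presheaves is small: an element of the closure is determined by its type and by
  a partial function \<open>Q \<times> Q \<rightharpoonup> S\<close> (\<open>tiny_closure\<close>), and the universe is closed under exponents by
  \<open>Q\<close>.  This gives the construction \<open>realise_distributor\<close>, from which every \<open>E\<close> is obtained.
\<close>

section \<open>Multiplication and suprema in a quantale\<close>

lemma quantale_mult_mono:
  fixes a b c d :: "'q::quantale"
  assumes "a \<le> b" "c \<le> d"
  shows "a * c \<le> b * d"
proof -
  have "a * c \<le> a * d"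
    using mult_Sup_distrib[of a "{c, d}"] assms(2) 
    by (simp add: Lattices.sup_absorb2) (metis Lattices.sup_ge1)
  also have "a * d \<le> b * d"
    using Sup_mult_distrib[of "{a, b}" d] assms(1)
    by (simp add: Lattices.sup_absorb2) (metis Lattices.sup_ge1)
  finally show ?thesis .
qed

lemma SUP_mult: "(SUP i\<in>I. f i) * (x::'q::quantale) = (SUP i\<in>I. f i * x)"
  by (simp add: Sup_mult_distrib image_image)

lemma mult_SUP: "(x::'q::quantale) * (SUP i\<in>I. f i) = (SUP i\<in>I. x * f i)"
  by (simp add: mult_Sup_distrib image_image)

lemma SUP_mult_le:
  fixes x y :: "'q::quantale"
  assumes "\<And>i. i \<in> I \<Longrightarrow> f i * x \<le> y"
  shows "(SUP i\<in>I. f i) * x \<le> y"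
  unfolding SUP_mult using assms by (rule SUP_least)

lemma mult_SUP_le:
  fixes x y :: "'q::quantale"
  assumes "\<And>i. i \<in> I \<Longrightarrow> x * f i \<le> y"
  shows "x * (SUP i\<in>I. f i) \<le> y"
  unfolding mult_SUP using assms by (rule SUP_least)

lemma mult_SUP_mult_mono:
  fixes x :: "'q::quantale"
  assumes "\<And>i. i \<in> I \<Longrightarrow> x * f i \<le> f' i"
  shows "x * (SUP i\<in>I. f i * g i) \<le> (SUP i\<in>I. f' i * g i)"
  unfolding mult_SUP mult.assoc[symmetric]
  using assms by (intro SUP_subset_mono quantale_mult_mono) auto

lemma SUP_mult_mult_mono:
  fixes x :: "'q::quantale"
  assumes "\<And>i. i \<in> I \<Longrightarrow> g i * x \<le> g' i"
  shows "(SUP i\<in>I. f i * g i) * x \<le> (SUP i\<in>I. f i * g' i)"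
  unfolding SUP_mult mult.assoc
  using assms by (intro SUP_subset_mono quantale_mult_mono) auto

section \<open>Categories over the idempotents of a quantale\<close>

text \<open>
  Categories enriched in \<open>Idm(Q)\<close> without a bound on the size and with elements of any type, so
  that presheaves can be elements.  All homs of \<open>Idm(Q)\<close> are sub-sup-lattices of \<open>Q\<close>; an arrow is
  recorded as an element of \<open>Q\<close> together with equations that say between which idempotents it lives.
\<close>

locale idem_category =
  fixes A :: "('x, 'q::quantale, 'q) ecat"
  assumes ty_idem: "a \<in> elts A \<Longrightarrow> ty A a * ty A a = ty A a"
    and hom_ty: "\<lbrakk>a \<in> elts A; b \<in> elts A\<rbrakk> \<Longrightarrow> ehom A b a * ty A a = ehom A b a"
    and ty_hom: "\<lbrakk>a \<in> elts A; b \<in> elts A\<rbrakk> \<Longrightarrow> ty A b * ehom A b a = ehom A b a"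
    and hom_hom: "\<lbrakk>a \<in> elts A; b \<in> elts A; c \<in> elts A\<rbrakk>
      \<Longrightarrow> ehom A c b * ehom A b a \<le> ehom A c a"
    and ty_le_hom: "a \<in> elts A \<Longrightarrow> ty A a \<le> ehom A a a"
begin

lemma le_hom_trans:
  assumes "a \<in> elts A" "b \<in> elts A" "c \<in> elts A" "x \<le> ehom A c b" "y \<le> ehom A b a"
  shows "x * y \<le> ehom A c a"
  using quantale_mult_mono[OF assms(4,5)] hom_hom[OF assms(1-3)] by (rule order_trans)

lemma full: "S \<subseteq> elts A \<Longrightarrow> idem_category (A\<lparr>elts := S\<rparr>)"
  by unfold_locales (auto simp: ty_idem hom_ty ty_hom hom_hom ty_le_hom subset_iff)

end

definition presheaf :: "('x, 'q::quantale, 'q) ecat \<Rightarrow> 'q \<Rightarrow> ('x \<Rightarrow> 'q) \<Rightarrow> bool" where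
  "presheaf A e \<phi> \<longleftrightarrow> e * e = e \<and>
     (\<forall>a\<in>elts A. ty A a * \<phi> a = \<phi> a \<and> \<phi> a * e = \<phi> a) \<and>
     (\<forall>a\<in>elts A. \<forall>b\<in>elts A. ehom A b a * \<phi> a \<le> \<phi> b)"

definition copresheaf :: "('x, 'q::quantale, 'q) ecat \<Rightarrow> 'q \<Rightarrow> ('x \<Rightarrow> 'q) \<Rightarrow> bool" where
  "copresheaf A e \<psi> \<longleftrightarrow> e * e = e \<and>
     (\<forall>a\<in>elts A. e * \<psi> a = \<psi> a \<and> \<psi> a * ty A a = \<psi> a) \<and>
     (\<forall>a\<in>elts A. \<forall>b\<in>elts A. \<psi> b * ehom A b a \<le> \<psi> a)"

text \<open>
  A left adjoint distributor from the one-element category on \<open>e\<close> to \<open>A\<close>, with its right adjoint.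
\<close>

definition adjoint_presheaf ::
  "('x, 'q::quantale, 'q) ecat \<Rightarrow> 'q \<Rightarrow> ('x \<Rightarrow> 'q) \<Rightarrow> ('x \<Rightarrow> 'q) \<Rightarrow> bool" where
  "adjoint_presheaf A e \<phi> \<psi> \<longleftrightarrow> presheaf A e \<phi> \<and> copresheaf A e \<psi> \<and>
     e \<le> (SUP a\<in>elts A. \<psi> a * \<phi> a) \<and> (\<forall>a\<in>elts A. \<forall>b\<in>elts A. \<phi> b * \<psi> a \<le> ehom A b a)"

text \<open>
  A left adjoint distributor is one element by element, so it suffices that those out of
  one-element categories are representable; see \<open>Cauchy_complete_Idm_iff\<close>.
\<close>

definition cauchy :: "('x, 'q::quantale, 'q) ecat \<Rightarrow> bool" where
  "cauchy C \<longleftrightarrow> (\<forall>e \<phi> \<psi>. adjoint_presheaf C e \<phi> \<psi> \<longrightarrow>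
     (\<exists>c\<in>elts C. ty C c = e \<and> (\<forall>x\<in>elts C. \<phi> x = ehom C x c)))"

section \<open>Presheaf categories and Cauchy closure\<close>

text \<open>
  The elements \<open>y\<close> of \<open>M\<close> for which \<open>M(-,y)\<close>, restricted to \<open>S\<close>, is left adjoint to \<open>M(y,-)\<close>:
  the closure of \<open>S\<close> under Cauchy limits.
\<close>

definition closure :: "('x, 'q::quantale, 'q) ecat \<Rightarrow> 'x set \<Rightarrow> 'x set" where
  "closure M S = {y \<in> elts M. ty M y \<le> (SUP i\<in>S. ehom M y i * ehom M i y)}"

lemma (in idem_category) subset_closure:
  assumes "S \<subseteq> elts A" shows "S \<subseteq> closure A S"
proof
  fix s assume s: "s \<in> S"
  then have e: "s \<in> elts A" using assms by auto
  have "ty A s = ty A s * ty A s" using e by (simp add: ty_idem)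
  also have "\<dots> \<le> ehom A s s * ehom A s s" 
    by (intro quantale_mult_mono ty_le_hom e)
  also have "\<dots> \<le> (SUP i\<in>S. ehom A s i * ehom A i s)"
    using s by (rule SUP_upper)
  finally show "s \<in> closure A S" using e by (simp add: closure_def)
qed

lemma (in idem_category) hom_via_closure:
  assumes S: "S \<subseteq> elts A" and t: "t \<in> closure A S" and b: "b \<in> elts A" and c: "c \<in> elts A"
    and x: "x * ty A t = x" "x \<le> ehom A c t" and y: "y \<le> ehom A t b"
  shows "x * y \<le> (SUP i\<in>S. ehom A c i * ehom A i b)"
proof -
  have t': "t \<in> elts A" "ty A t \<le> (SUP i\<in>S. ehom A t i * ehom A i t)"
    using t by (auto simp: closure_def)
  have "x * y = x * ty A t * y" by (simp add: x)
  also have "\<dots> \<le> x * (SUP i\<in>S. ehom A t i * ehom A i t) * y"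
    by (intro quantale_mult_mono t' order_refl)
  also have "\<dots> = (SUP i\<in>S. (x * ehom A t i) * (ehom A i t * y))"
    by (simp add: SUP_mult mult_SUP mult.assoc)
  also have "\<dots> \<le> (SUP i\<in>S. ehom A c i * ehom A i b)"
  proof (rule SUP_subset_mono[OF order_refl])
    fix i show "x * ehom A t i * (ehom A i t * y) \<le> ehom A c i * ehom A i b" if "i \<in> S"
      using S that t' b c x y by (intro quantale_mult_mono le_hom_trans[where b = t]) auto
  qed
  finally show ?thesis .
qed

text \<open>
  The composite of an adjoint pair with the adjoint pair of distributors given by the inclusion of
  a full subcategory.
\<close>

lemma adjoint_presheaf_extend:
  assumes M: "idem_category M" and T: "T \<subseteq> elts M"
    and adj: "adjoint_presheaf (M\<lparr>elts := T\<rparr>) e \<phi> \<psi>"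
  defines "\<phi>' \<equiv> \<lambda>m. SUP i\<in>T. ehom M m i * \<phi> i"
    and "\<psi>' \<equiv> \<lambda>m. SUP i\<in>T. \<psi> i * ehom M i m"
  shows "adjoint_presheaf M e \<phi>' \<psi>'"
    and "\<And>t. t \<in> T \<Longrightarrow> \<phi>' t = \<phi> t" and "\<And>t. t \<in> T \<Longrightarrow> \<psi>' t = \<psi> t"
proof -
  interpret M: idem_category M by (rule M)
  have T': "t \<in> elts M" if "t \<in> T" for t using that T by auto
  have \<phi>: "\<And>i. i \<in> T \<Longrightarrow> ty M i * \<phi> i = \<phi> i" "\<And>i. i \<in> T \<Longrightarrow> \<phi> i * e = \<phi> i"
      "\<And>i j. i \<in> T \<Longrightarrow> j \<in> T \<Longrightarrow> ehom M j i * \<phi> i \<le> \<phi> j"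
    and \<psi>: "\<And>i. i \<in> T \<Longrightarrow> e * \<psi> i = \<psi> i" "\<And>i. i \<in> T \<Longrightarrow> \<psi> i * ty M i = \<psi> i"
      "\<And>i j. i \<in> T \<Longrightarrow> j \<in> T \<Longrightarrow> \<psi> j * ehom M j i \<le> \<psi> i"
    and e: "e * e = e" "e \<le> (SUP a\<in>T. \<psi> a * \<phi> a)"
    and \<phi>\<psi>: "\<And>i j. i \<in> T \<Longrightarrow> j \<in> T \<Longrightarrow> \<phi> j * \<psi> i \<le> ehom M j i"
    using adj by (auto simp: adjoint_presheaf_def presheaf_def copresheaf_def)
  show \<phi>': "\<phi>' t = \<phi> t" if t: "t \<in> T" for t
  proof (rule antisym)
    show "\<phi>' t \<le> \<phi> t" unfolding \<phi>'_def using t \<phi>(3) by (auto intro: SUP_least)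
    have "\<phi> t = ty M t * \<phi> t" using t \<phi>(1) by simp
    also have "\<dots> \<le> ehom M t t * \<phi> t" by (intro quantale_mult_mono M.ty_le_hom T' t order_refl)
    also have "\<dots> \<le> \<phi>' t" unfolding \<phi>'_def using t by (rule SUP_upper)
    finally show "\<phi> t \<le> \<phi>' t" .
  qed
  show \<psi>': "\<psi>' t = \<psi> t" if t: "t \<in> T" for t
  proof (rule antisym)
    show "\<psi>' t \<le> \<psi> t" unfolding \<psi>'_def using t \<psi>(3) by (auto intro: SUP_least)
    have "\<psi> t = \<psi> t * ty M t" using t \<psi>(2) by simp
    also have "\<dots> \<le> \<psi> t * ehom M t t" by (intro quantale_mult_mono M.ty_le_hom T' t order_refl)
    also have "\<dots> \<le> \<psi>' t" unfolding \<psi>'_def using t by (rule SUP_upper)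
    finally show "\<psi> t \<le> \<psi>' t" .
  qed
  have "presheaf M e \<phi>'"
    unfolding presheaf_def
  proof (intro conjI ballI e)
    fix a b assume a: "a \<in> elts M" and b: "b \<in> elts M"
    show "ty M a * \<phi>' a = \<phi>' a"
      by (simp add: \<phi>'_def mult_SUP mult.assoc[symmetric] M.ty_hom a T' cong: SUP_cong)
    show "\<phi>' a * e = \<phi>' a"
      by (simp add: \<phi>'_def SUP_mult mult.assoc \<phi>(2) a T' cong: SUP_cong)
    show "ehom M b a * \<phi>' a \<le> \<phi>' b"
      unfolding \<phi>'_def using a b T' by (intro mult_SUP_mult_mono M.hom_hom)
  qed
  moreover have "copresheaf M e \<psi>'"
    unfolding copresheaf_def
  proof (intro conjI ballI e)
    fix a b assume a: "a \<in> elts M" and b: "b \<in> elts M"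
    show "e * \<psi>' a = \<psi>' a"
      by (simp add: \<psi>'_def mult_SUP mult.assoc[symmetric] \<psi>(1) a T' cong: SUP_cong)
    show "\<psi>' a * ty M a = \<psi>' a"
      by (simp add: \<psi>'_def SUP_mult mult.assoc M.hom_ty a T' cong: SUP_cong)
    show "\<psi>' b * ehom M b a \<le> \<psi>' a"
      unfolding \<psi>'_def using a b T' by (intro SUP_mult_mult_mono M.hom_hom)
  qed
  moreover have "e \<le> (SUP a\<in>elts M. \<psi>' a * \<phi>' a)"
  proof -
    have "(SUP a\<in>T. \<psi> a * \<phi> a) = (SUP a\<in>T. \<psi>' a * \<phi>' a)"
      by (simp add: \<phi>' \<psi>' cong: SUP_cong)
    also have "\<dots> \<le> (SUP a\<in>elts M. \<psi>' a * \<phi>' a)" using T by (rule SUP_subset_mono) simp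
    finally show ?thesis using e(2) by simp
  qed
  moreover have "\<phi>' b * \<psi>' a \<le> ehom M b a" if a: "a \<in> elts M" and b: "b \<in> elts M" for a b
    unfolding \<phi>'_def \<psi>'_def
  proof (intro SUP_mult_le mult_SUP_le)
    fix i j assume i: "i \<in> T" and j: "j \<in> T"
    have "ehom M b i * (\<phi> i * \<psi> j * ehom M j a) \<le> ehom M b a"
      by (intro M.le_hom_trans[where b = i] M.le_hom_trans[where b = j] \<phi>\<psi> order_refl T' a b i j)
    then show "ehom M b i * \<phi> i * (\<psi> j * ehom M j a) \<le> ehom M b a" by (simp add: mult.assoc)
  qed
  ultimately show "adjoint_presheaf M e \<phi>' \<psi>'"
    by (simp add: adjoint_presheaf_def)
qed

text \<open>
  Extend an adjoint presheaf on the closure to \<open>M\<close>, where it is represented by some \<open>x\<close>.  Its unit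
  exhibits \<open>x\<close> as a Cauchy limit of elements of the closure, and each of those is one of elements of \<open>S\<close>.
\<close>

lemma cauchy_closure:
  assumes M: "idem_category M" and c: "cauchy M" and S: "S \<subseteq> elts M"
  shows "cauchy (M\<lparr>elts := closure M S\<rparr>)"
  unfolding cauchy_def
proof (intro allI impI)
  fix e \<phi> \<psi> assume adj: "adjoint_presheaf (M\<lparr>elts := closure M S\<rparr>) e \<phi> \<psi>"
  interpret M: idem_category M by (rule M)
  define T where "T = closure M S"
  have T: "T \<subseteq> elts M" by (auto simp: T_def closure_def)
  then have T': "t \<in> elts M" if "t \<in> T" for t using that by auto
  define \<phi>' \<psi>' where "\<phi>' = (\<lambda>m. SUP i\<in>T. ehom M m i * \<phi> i)"
    and "\<psi>' = (\<lambda>m. SUP i\<in>T. \<psi> i * ehom M i m)"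
  note adj' = adjoint_presheaf_extend[OF M T adj[folded T_def]]
  have ext: "adjoint_presheaf M e \<phi>' \<psi>'"
      "\<And>t. t \<in> T \<Longrightarrow> \<phi>' t = \<phi> t" "\<And>t. t \<in> T \<Longrightarrow> \<psi>' t = \<psi> t"
    unfolding \<phi>'_def \<psi>'_def using adj' by simp_all
  obtain x where x: "x \<in> elts M" "ty M x = e" "\<And>m. m \<in> elts M \<Longrightarrow> \<phi>' m = ehom M m x"
    using ext(1) c unfolding cauchy_def by blast
  have \<psi>x: "\<psi> t \<le> ehom M x t" if t: "t \<in> T" for t
  proof -
    have "e * \<psi>' t = \<psi>' t"
      using ext(1) T'[OF t] by (simp add: adjoint_presheaf_def copresheaf_def)
    then have "\<psi> t = e * \<psi>' t" using ext(3)[OF t] by simp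
    also have "\<dots> \<le> \<phi>' x * \<psi>' t"
      using M.ty_le_hom[OF x(1)] x by (intro quantale_mult_mono) auto
    also have "\<dots> \<le> ehom M x t" using ext(1) T t x(1) by (auto simp: adjoint_presheaf_def)
    finally show ?thesis .
  qed
  have "e \<le> (SUP t\<in>T. \<psi> t * \<phi> t)"
    using adj by (simp add: adjoint_presheaf_def T_def)
  also have "\<dots> \<le> (SUP i\<in>S. ehom M x i * ehom M i x)"
  proof (rule SUP_least)
    fix t assume t: "t \<in> T"
    have "\<psi> t * ty M t = \<psi> t" "\<phi> t \<le> ehom M t x"
      using adj t ext(2)[OF t] x(3) T' by (auto simp: adjoint_presheaf_def copresheaf_def T_def)
    then show "\<psi> t * \<phi> t \<le> (SUP i\<in>S. ehom M x i * ehom M i x)"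
      using M.hom_via_closure[OF S] t \<psi>x[OF t] x(1) unfolding T_def by blast
  qed
  finally have "x \<in> closure M S" using x by (simp add: closure_def)
  then show "\<exists>c\<in>elts (M\<lparr>elts := closure M S\<rparr>). ty (M\<lparr>elts := closure M S\<rparr>) c = e \<and>
      (\<forall>x\<in>elts (M\<lparr>elts := closure M S\<rparr>). \<phi> x = ehom (M\<lparr>elts := closure M S\<rparr>) x c)"
    using x ext(2) T' by (auto simp: T_def)
qed

text \<open>
  The largest \<open>x : fst p \<rightarrow> fst p'\<close> with \<open>snd p' d * x \<le> snd p d\<close>, that is, the right lifting of one
  presheaf through the other.
\<close>

definition presheaf_hom ::
  "('x, 'q::quantale, 'q) ecat \<Rightarrow> 'q \<times> ('x \<Rightarrow> 'q) \<Rightarrow> 'q \<times> ('x \<Rightarrow> 'q) \<Rightarrow> 'q" where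
  "presheaf_hom D p' p = Sup {x. x * fst p = x \<and> fst p' * x = x \<and>
     (\<forall>d\<in>elts D. snd p' d * x \<le> snd p d)}"

text \<open>
  Presheaves are taken to be extensional so that isomorphic ones are equal, which keeps the closure
  of a small set small.
\<close>

definition presheaf_category ::
  "('x, 'q::quantale, 'q) ecat \<Rightarrow> ('q \<times> ('x \<Rightarrow> 'q), 'q, 'q) ecat" where
  "presheaf_category D =
     \<lparr>elts = {(e, \<phi>). presheaf D e \<phi> \<and> \<phi> \<in> extensional (elts D)},
      ty = fst, ehom = presheaf_hom D\<rparr>"

lemma le_presheaf_hom_iff:
  assumes "x * fst p = x" "fst p' * x = x"
  shows "x \<le> presheaf_hom D p' p \<longleftrightarrow> (\<forall>d\<in>elts D. snd p' d * x \<le> snd p d)"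
proof
  assume x: "x \<le> presheaf_hom D p' p"
  show "\<forall>d\<in>elts D. snd p' d * x \<le> snd p d"
  proof
    fix d assume d: "d \<in> elts D"
    have "snd p' d * x \<le> snd p' d * presheaf_hom D p' p" 
      using x by (intro quantale_mult_mono) auto
    also have "\<dots> \<le> snd p d"
      unfolding presheaf_hom_def mult_Sup_distrib using d by (auto intro: SUP_least)
    finally show "snd p' d * x \<le> snd p d" .
  qed
next
  assume "\<forall>d\<in>elts D. snd p' d * x \<le> snd p d"
  then show "x \<le> presheaf_hom D p' p"
    unfolding presheaf_hom_def using assms by (intro Sup_upper) auto
qed

lemma presheaf_hom_types:
  "presheaf_hom D p' p * fst p = presheaf_hom D p' p"
  "fst p' * presheaf_hom D p' p = presheaf_hom D p' p"
proof -
  define X where "X = {x. x * fst p = x \<and> fst p' * x = x \<and> (\<forall>d\<in>elts D. snd p' d * x \<le> snd p d)}"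
  have "(\<lambda>x. x * fst p) ` X = X" "(*) (fst p') ` X = X" by (auto simp: X_def image_iff)
  then show "presheaf_hom D p' p * fst p = presheaf_hom D p' p"
    "fst p' * presheaf_hom D p' p = presheaf_hom D p' p"
    unfolding presheaf_hom_def X_def[symmetric] by (simp_all add: Sup_mult_distrib mult_Sup_distrib)
qed

lemma presheaf_hom_apply: "d \<in> elts D \<Longrightarrow> snd p' d * presheaf_hom D p' p \<le> snd p d"
  using le_presheaf_hom_iff[of "presheaf_hom D p' p" p p' D] presheaf_hom_types by blast

lemma idem_category_presheaf_category: "idem_category (presheaf_category D)"
proof
  fix p p' p'' assume *: "p \<in> elts (presheaf_category D)"
    "p' \<in> elts (presheaf_category D)" "p'' \<in> elts (presheaf_category D)"
  show "ehom (presheaf_category D) p'' p' * ehom (presheaf_category D) p' p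
    \<le> ehom (presheaf_category D) p'' p"
    unfolding presheaf_category_def ecat.simps
  proof (subst le_presheaf_hom_iff, goal_cases)
    case 3
    show ?case
    proof
      fix d assume d: "d \<in> elts D"
      have "snd p'' d * presheaf_hom D p'' p' * presheaf_hom D p' p \<le> snd p' d * presheaf_hom D p' p"
        by (intro quantale_mult_mono presheaf_hom_apply d order_refl)
      also have "\<dots> \<le> snd p d" using d by (rule presheaf_hom_apply)
      finally show "snd p'' d * (presheaf_hom D p'' p' * presheaf_hom D p' p) \<le> snd p d"
        by (simp add: mult.assoc)
    qed
  qed (simp add: presheaf_hom_types mult.assoc, simp add: presheaf_hom_types mult.assoc[symmetric])
next
  fix p assume "p \<in> elts (presheaf_category D)"
  then show "ty (presheaf_category D) p \<le> ehom (presheaf_category D) p p"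
    by (auto simp: presheaf_category_def le_presheaf_hom_iff presheaf_def)
qed (auto simp: presheaf_category_def presheaf_def presheaf_hom_types)

definition yoneda :: "('x, 'q::quantale, 'q) ecat \<Rightarrow> 'x \<Rightarrow> 'q \<times> ('x \<Rightarrow> 'q)" where
  "yoneda D d = (ty D d, \<lambda>x\<in>elts D. ehom D x d)"

context idem_category
begin

lemma yoneda_elts: "d \<in> elts A \<Longrightarrow> yoneda A d \<in> elts (presheaf_category A)"
  by (auto simp: presheaf_category_def yoneda_def presheaf_def ty_idem hom_ty ty_hom hom_hom)

lemma presheaf_hom_yoneda:
  assumes d: "d \<in> elts A" and p: "p \<in> elts (presheaf_category A)"
  shows "presheaf_hom A (yoneda A d) p = snd p d"
proof (rule antisym)
  have "presheaf_hom A (yoneda A d) p = ty A d * presheaf_hom A (yoneda A d) p"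
    using presheaf_hom_types(2)[where D = A and p' = "yoneda A d" and p = p] by (simp add: yoneda_def)
  also have "\<dots> \<le> ehom A d d * presheaf_hom A (yoneda A d) p"
    by (intro quantale_mult_mono ty_le_hom d order_refl)
  also have "\<dots> \<le> snd p d"
    using presheaf_hom_apply[OF d, of "yoneda A d" p] d by (simp add: yoneda_def)
  finally show "presheaf_hom A (yoneda A d) p \<le> snd p d" .
  show "snd p d \<le> presheaf_hom A (yoneda A d) p"
    using p d by (subst le_presheaf_hom_iff) (auto simp: presheaf_category_def presheaf_def yoneda_def)
qed

text \<open>
  An adjoint presheaf \<open>\<phi>\<close> on the presheaf category is represented by its restriction \<open>\<pi>\<close> along the
  Yoneda embedding.  By the Yoneda lemma \<open>\<phi> p \<le> [p,\<pi>]\<close>.  For the converse, an arrow \<open>x \<le> [p,\<pi>]\<close>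
  satisfies \<open>x \<cdot> \<psi> k \<le> [p,k]\<close> for every \<open>k\<close>, so that \<open>x \<le> \<Squnion>\<^sub>k x \<cdot> \<psi> k \<cdot> \<phi> k \<le> \<phi> p\<close>.
\<close>

lemma cauchy_presheaf_category: "cauchy (presheaf_category A)"
  unfolding cauchy_def
proof (intro allI impI)
  fix e \<phi> \<psi> assume adj: "adjoint_presheaf (presheaf_category A) e \<phi> \<psi>"
  let ?P = "presheaf_category A"
  have simps: "ty ?P = fst" "ehom ?P = presheaf_hom A" by (simp_all add: presheaf_category_def)
  have \<phi>: "\<And>i. i \<in> elts ?P \<Longrightarrow> fst i * \<phi> i = \<phi> i" "\<And>i. i \<in> elts ?P \<Longrightarrow> \<phi> i * e = \<phi> i"
      "\<And>i j. i \<in> elts ?P \<Longrightarrow> j \<in> elts ?P \<Longrightarrow> presheaf_hom A j i * \<phi> i \<le> \<phi> j"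
    and \<psi>: "\<And>i. i \<in> elts ?P \<Longrightarrow> e * \<psi> i = \<psi> i" "\<And>i. i \<in> elts ?P \<Longrightarrow> \<psi> i * fst i = \<psi> i"
    and e: "e * e = e" "e \<le> (SUP a\<in>elts ?P. \<psi> a * \<phi> a)"
    and \<phi>\<psi>: "\<And>i j. i \<in> elts ?P \<Longrightarrow> j \<in> elts ?P \<Longrightarrow> \<phi> j * \<psi> i \<le> presheaf_hom A j i"
    using adj unfolding adjoint_presheaf_def presheaf_def copresheaf_def simps by auto
  define \<pi> where "\<pi> = (e, \<lambda>d\<in>elts A. \<phi> (yoneda A d))"
  have "ehom A b a * \<phi> (yoneda A a) \<le> \<phi> (yoneda A b)"
    if a: "a \<in> elts A" and b: "b \<in> elts A" for a b
    using \<phi>(3)[of "yoneda A a" "yoneda A b"] presheaf_hom_yoneda[OF b yoneda_elts[OF a]] b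
    by (simp add: yoneda_elts[OF a] yoneda_elts[OF b]) (simp add: yoneda_def)
  then have \<pi>: "\<pi> \<in> elts ?P"
    using \<phi>(1,2)[OF yoneda_elts] e(1)
    by (auto simp: presheaf_category_def \<pi>_def presheaf_def) (simp add: yoneda_def)
  moreover have "\<phi> p = presheaf_hom A p \<pi>" if p: "p \<in> elts ?P" for p
  proof (rule antisym)
    have "snd p d * \<phi> p \<le> \<phi> (yoneda A d)" if d: "d \<in> elts A" for d
      using \<phi>(3)[OF p yoneda_elts[OF d]] presheaf_hom_yoneda[OF d p] by simp
    then show "\<phi> p \<le> presheaf_hom A p \<pi>"
      using p \<phi>(1,2) by (subst le_presheaf_hom_iff) (auto simp: \<pi>_def)
    define x where "x = presheaf_hom A p \<pi>"
    have x: "x * e = x" "fst p * x = x" "\<And>d. d \<in> elts A \<Longrightarrow> snd p d * x \<le> \<phi> (yoneda A d)"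
      using presheaf_hom_types[where D = A and p' = p and p = \<pi>] presheaf_hom_apply[where D = A and p' = p and p = \<pi>]
      by (auto simp: x_def \<pi>_def)
    have "x = x * e" by (simp add: x)
    also have "\<dots> \<le> x * (SUP a\<in>elts ?P. \<psi> a * \<phi> a)"
      using e by (intro quantale_mult_mono) auto
    also have "\<dots> \<le> \<phi> p"
    proof (rule mult_SUP_le)
      fix k assume k: "k \<in> elts ?P"
      have "snd p d * (x * \<psi> k) \<le> snd k d" if d: "d \<in> elts A" for d
      proof -
        have "snd p d * (x * \<psi> k) \<le> \<phi> (yoneda A d) * \<psi> k"
          unfolding mult.assoc[symmetric] using x d by (intro quantale_mult_mono) auto
        also have "\<dots> \<le> snd k d"
          using \<phi>\<psi>[OF k yoneda_elts[OF d]] presheaf_hom_yoneda[OF d k] by simp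
        finally show ?thesis .
      qed
      then have "x * \<psi> k \<le> presheaf_hom A p k"
        using \<psi>(2)[OF k] x(2) by (subst le_presheaf_hom_iff) (auto simp: mult.assoc, simp add: mult.assoc[symmetric])
      then have "x * \<psi> k * \<phi> k \<le> presheaf_hom A p k * \<phi> k" by (intro quantale_mult_mono) auto
      also have "\<dots> \<le> \<phi> p" using k p by (rule \<phi>(3))
      finally show "x * (\<psi> k * \<phi> k) \<le> \<phi> p" by (simp add: mult.assoc)
    qed
    finally show "presheaf_hom A p \<pi> \<le> \<phi> p" by (simp add: x_def)
  qed
  ultimately show "\<exists>c\<in>elts ?P. ty ?P c = e \<and> (\<forall>x\<in>elts ?P. \<phi> x = ehom ?P x c)"
    by (intro bexI[of _ \<pi>]) (auto simp: simps \<pi>_def)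
qed

end

lemma presheaf_category_skeletal:
  assumes p: "p \<in> elts (presheaf_category D)" and p': "p' \<in> elts (presheaf_category D)"
    and "fst p = fst p'" "fst p \<le> presheaf_hom D p p'" "fst p \<le> presheaf_hom D p' p"
  shows "p = p'"
proof -
  have "snd p d \<le> snd p' d" "snd p' d \<le> snd p d" if d: "d \<in> elts D" for d
  proof -
    have "fst p * fst p = fst p" "snd p d * fst p = snd p d" "snd p' d * fst p = snd p' d"
      using p p' d assms(3) by (auto simp: presheaf_category_def presheaf_def)
    then show "snd p d \<le> snd p' d" "snd p' d \<le> snd p d"
      using assms(3-5) d le_presheaf_hom_iff[of "fst p" p p' D] le_presheaf_hom_iff[of "fst p" p' p D]
      by auto
  qed
  then have "snd p = snd p'"
    using p p' by (intro extensionalityI[of _ "elts D"]) (auto simp: presheaf_category_def intro: antisym)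
  then show ?thesis using assms(3) by (simp add: prod_eq_iff)
qed

section \<open>Small realisations of distributors\<close>

context universe
begin

text \<open>
  Smallness for sets of any type: at most as many elements as some small set.
\<close>

definition tiny :: "'x set \<Rightarrow> bool" where
  "tiny S \<longleftrightarrow> (\<exists>J f. small J \<and> S \<subseteq> (f :: 'u \<Rightarrow> 'x) ` J)"

lemma tiny_image: "tiny S \<Longrightarrow> tiny (g ` S)"
  unfolding tiny_def by (metis image_comp image_mono)

lemma tiny_subset: "tiny S \<Longrightarrow> T \<subseteq> S \<Longrightarrow> tiny T"
  unfolding tiny_def by (meson subset_trans)

lemma tiny_small: "small A \<Longrightarrow> tiny A"
  unfolding tiny_def by (metis image_ident order_refl)

lemma tiny_inj:
  assumes "tiny T" "inj_on g S" "g ` S \<subseteq> T"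
  shows "tiny S"
  using tiny_image[OF tiny_subset[OF assms(1,3)], of "inv_into S g"] assms(2)
  by (simp add: inv_into_image_cancel)

lemma small_singleton: "small {x}"
proof -
  obtain A where A: "small A" "infinite A" using small_infinite by blast
  then have "A \<noteq> {}" by auto
  then show ?thesis using small_image[OF A(1), of "\<lambda>_. x"] by (simp add: image_constant_conv)
qed

lemma tiny_singleton: "tiny {x}"
  using tiny_image[OF tiny_small[OF small_singleton], of "\<lambda>_. x"] by simp

text \<open>
  An infinite type admits an injective pairing, so the disjoint union of a small family of small
  sets is again a small set.
\<close>

lemma tiny_UN:
  assumes "tiny I" "\<And>i. i \<in> I \<Longrightarrow> tiny (S i)"
  shows "tiny (\<Union>i\<in>I. S i)"
proof -
  have "infinite (UNIV :: 'u set)"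
    using small_infinite by (metis finite_subset subset_UNIV)
  then have "\<exists>f. bij_betw f ((UNIV :: 'u set) \<times> (UNIV :: 'u set)) (UNIV :: 'u set)"
    by (intro iffD2[OF card_of_ordIso] card_of_Times_same_infinite)
  then obtain pr :: "'u \<times> 'u \<Rightarrow> 'u" where pr: "inj pr"
    unfolding bij_betw_def by auto
  obtain J f where J: "small J" "I \<subseteq> (f :: 'u \<Rightarrow> _) ` J" using assms(1) unfolding tiny_def by blast
  have "\<exists>K g. small K \<and> (i \<in> I \<longrightarrow> S i \<subseteq> (g :: 'u \<Rightarrow> _) ` K)" for i
    using assms(2)[of i] small_singleton unfolding tiny_def by (cases "i \<in> I") blast+
  then obtain K g where K: "\<And>i. small (K i)" "\<And>i. i \<in> I \<Longrightarrow> S i \<subseteq> (g i :: 'u \<Rightarrow> _) ` K i"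
    by metis
  define L where "L = (\<Union>j\<in>J. (\<lambda>k. pr (j, k)) ` K (f j))"
  have "small L" unfolding L_def using J K by (intro small_UN small_image)
  moreover have "(\<Union>i\<in>I. S i) \<subseteq> (\<lambda>u. case inv pr u of (j, k) \<Rightarrow> g (f j) k) ` L"
  proof
    fix s assume "s \<in> (\<Union>i\<in>I. S i)"
    then obtain i where i: "i \<in> I" "s \<in> S i" by blast
    then obtain j where j: "j \<in> J" "i = f j" using J by blast
    obtain k where k: "k \<in> K i" "s = g i k" using i K by blast
    have "s = (\<lambda>u. case inv pr u of (j, k) \<Rightarrow> g (f j) k) (pr (j, k))"
      using pr j k by simp
    then show "s \<in> (\<lambda>u. case inv pr u of (j, k) \<Rightarrow> g (f j) k) ` L"
      using j k unfolding L_def by blast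
  qed
  ultimately show ?thesis unfolding tiny_def by blast
qed

lemma tiny_Times: 
  assumes "tiny A" "tiny B" shows "tiny (A \<times> B)"
proof -
  have "A \<times> B = (\<Union>a\<in>A. Pair a ` B)" by blast
  then show ?thesis using assms by (simp only:) (intro tiny_UN tiny_image)
qed

lemma tiny_bool: "tiny (UNIV :: bool set)"
proof -
  obtain A where A: "small A" "infinite A" using small_infinite by blast
  then obtain a where "a \<in> A" by fastforce
  moreover obtain b where "b \<in> A" "b \<noteq> a"
    using A by (metis finite.emptyI finite.insertI finite_subset insertI1 subsetI)
  ultimately have "(UNIV :: bool set) \<subseteq> (\<lambda>x. x = a) ` A"
    by (auto simp: image_iff UNIV_bool)
  then show ?thesis using A unfolding tiny_def by blast
qed

lemma tiny_Un:
  assumes "tiny A" "tiny B" shows "tiny (A \<union> B)"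
proof -
  have "A \<union> B = (\<Union>b. if b then A else B)" by (auto split: if_splits)
  then show ?thesis using assms by (simp only:) (intro tiny_UN tiny_bool, simp)
qed

lemma tiny_funs:
  fixes S :: "'x set"
  assumes ce: "closed_under_exponents small TYPE('q)" and S: "tiny S"
  shows "tiny {s :: 'q \<Rightarrow> 'x. \<forall>p. s p \<in> S}"
proof -
  obtain J f where J: "small J" "S \<subseteq> (f :: 'u \<Rightarrow> _) ` J" using S unfolding tiny_def by blast
  obtain code :: "('q \<Rightarrow> 'u) \<Rightarrow> 'u" where code: "inj_on code (UNIV \<rightarrow> J)" "small (code ` (UNIV \<rightarrow> J))"
    using ce J unfolding closed_under_exponents_def by blast
  have "{s. \<forall>p. s p \<in> S} \<subseteq> (\<lambda>u. f \<circ> inv_into (UNIV \<rightarrow> J) code u) ` code ` (UNIV \<rightarrow> J)"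
  proof
    fix s :: "'q \<Rightarrow> 'x" assume "s \<in> {s. \<forall>p. s p \<in> S}"
    then have "\<forall>p. \<exists>j. j \<in> J \<and> s p = f j" using J by blast
    then obtain t where t: "\<And>p. t p \<in> J" "\<And>p. s p = f (t p)" by metis
    then have "t \<in> UNIV \<rightarrow> J" by auto
    then have "inv_into (UNIV \<rightarrow> J) code (code t) = t" "code t \<in> code ` (UNIV \<rightarrow> J)"
      using code(1) by auto
    moreover have "s = f \<circ> t" using t(2) by auto
    ultimately show "s \<in> (\<lambda>u. f \<circ> inv_into (UNIV \<rightarrow> J) code u) ` code ` (UNIV \<rightarrow> J)"
      by (metis image_eqI)
  qed
  then show ?thesis using code(2) unfolding tiny_def by blast
qed

lemma tiny_exponent:
  assumes ce: "closed_under_exponents small TYPE('q)"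
  shows "tiny (UNIV :: 'q set)"
proof (rule tiny_inj)
  show "tiny {s :: 'q \<Rightarrow> bool. \<forall>p. s p \<in> UNIV}" by (rule tiny_funs[OF ce tiny_bool])
  show "inj (\<lambda>(q::'q) p. p = q)" by (rule injI) metis
qed simp

text \<open>
  The element \<open>y\<close> is determined by its type and by a choice, for all \<open>p\<close> and \<open>r\<close>, of an element \<open>i\<close> of
  \<open>S\<close> with \<open>M(y,i) = p\<close> and \<open>M(i,y) = r\<close>, as far as there is one: the inequality that puts \<open>y\<close> into
  the closure only depends on which pairs \<open>(p,r)\<close> occur, and if \<open>y'\<close> has the same choices, then the
  same supremum is below \<open>M(y,y')\<close> and below \<open>M(y',y)\<close>.
\<close>

lemma tiny_closure:
  fixes M :: "('x, 'q::quantale, 'q) ecat"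
  assumes ce: "closed_under_exponents small TYPE('q)" and M: "idem_category M"
    and S: "tiny S" "S \<subseteq> elts M"
    and skeletal: "\<And>y y'. y \<in> elts M \<Longrightarrow> y' \<in> elts M \<Longrightarrow> ty M y = ty M y' \<Longrightarrow>
      ty M y \<le> ehom M y y' \<Longrightarrow> ty M y \<le> ehom M y' y \<Longrightarrow> y = y'"
  shows "tiny (closure M S)"
proof -
  interpret M: idem_category M by (rule M)
  \<comment> \<open>\<open>rep y\<close> is the partial choice function that encodes \<open>y\<close>.\<close>
  define via where "via y p r i \<longleftrightarrow> i \<in> S \<and> ehom M y i = p \<and> ehom M i y = r" for y p r i
  define rep where "rep y = (\<lambda>p r. if \<exists>i. via y p r i then Some (SOME i. via y p r i) else None)" for y
  have repD: "via y p r i" if "rep y p r = Some i" for y p r i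
  proof -
    have "\<exists>i. via y p r i" "i = (SOME i. via y p r i)"
      using that unfolding rep_def by (auto split: if_splits)
    then show ?thesis by (metis someI_ex)
  qed
  have repI: "\<exists>j. rep y (ehom M y i) (ehom M i y) = Some j" if "i \<in> S" for y i
    using that by (auto simp: rep_def via_def)
  have le: "ty M y \<le> ehom M y y'"
    if y: "y \<in> closure M S" "y' \<in> elts M" "rep y = rep y'" for y y'
  proof -
    have "ty M y \<le> (SUP i\<in>S. ehom M y i * ehom M i y)" using y by (simp add: closure_def)
    also have "\<dots> \<le> ehom M y y'"
    proof (rule SUP_least)
      fix i assume i: "i \<in> S"
      obtain j where "via y (ehom M y i) (ehom M i y) j" "via y' (ehom M y i) (ehom M i y) j"
        using repI[OF i, of y] repD y(3) by metis
      then have "ehom M y i * ehom M i y = ehom M y j * ehom M j y'" "j \<in> elts M"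
        using S by (auto simp: via_def)
      then show "ehom M y i * ehom M i y \<le> ehom M y y'"
        using M.hom_hom y by (simp add: closure_def)
    qed
    finally show ?thesis .
  qed
  have sub: "closure M S \<subseteq> elts M" by (auto simp: closure_def)
  show ?thesis
  proof (rule tiny_inj)
    show "inj_on (\<lambda>y. (ty M y, rep y)) (closure M S)"
    proof (rule inj_onI)
      fix y y' assume y: "y \<in> closure M S" "y' \<in> closure M S" "(ty M y, rep y) = (ty M y', rep y')"
      then have "ty M y \<le> ehom M y y'" "ty M y' \<le> ehom M y' y"
        using le[of y y'] le[of y' y] sub by auto
      then show "y = y'"
        using skeletal[of y y'] y sub by auto
    qed
    have "tiny (insert None (Some ` S))"
      using tiny_Un[OF tiny_singleton tiny_image[OF S(1)], of None Some] by simp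
    then show "tiny ((UNIV :: 'q set) \<times> {s :: 'q \<Rightarrow> 'q \<Rightarrow> _. \<forall>p. s p \<in> {t. \<forall>r. t r \<in> insert None (Some ` S)}})"
      by (intro tiny_Times tiny_exponent tiny_funs ce)
    have "rep y p r \<in> insert None (Some ` S)" for y p r
      using repD[of y p r] by (cases "rep y p r") (auto simp: via_def)
    then show "(\<lambda>y. (ty M y, rep y)) ` closure M S \<subseteq>
      UNIV \<times> {s. \<forall>p. s p \<in> {t. \<forall>r. t r \<in> insert None (Some ` S)}}"
      by (intro image_subsetI SigmaI CollectI allI) simp_all
  qed
qed

text \<open>
  Cauchy completeness quantifies only over the elements of the category itself, so it can be carried
  along a bijection onto a subset of \<open>'u\<close>.
\<close>

lemma small_copy:
  fixes M :: "('x, 'q::quantale, 'q) ecat"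
  assumes M: "idem_category M" and c: "cauchy M" and t: "tiny (elts M)"
  obtains E :: "('u, 'q, 'q) ecat" and cd where "small (elts E)" "idem_category E" "cauchy E"
    "\<And>m. m \<in> elts M \<Longrightarrow> cd m \<in> elts E \<and> ty E (cd m) = ty M m"
    "\<And>m n. m \<in> elts M \<Longrightarrow> n \<in> elts M \<Longrightarrow> ehom E (cd m) (cd n) = ehom M m n"
proof -
  interpret M: idem_category M by (rule M)
  obtain J dec where J: "small J" "elts M \<subseteq> (dec :: 'u \<Rightarrow> _) ` J" using t unfolding tiny_def by blast
  define cd where "cd = inv_into J dec"
  have cd: "cd m \<in> J" "dec (cd m) = m" if "m \<in> elts M" for m
    using that J(2) unfolding cd_def by (auto intro: inv_into_into f_inv_into_f)
  define E where "E = \<lparr>elts = cd ` elts M, ty = ty M \<circ> dec, ehom = (\<lambda>x y. ehom M (dec x) (dec y))\<rparr>"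
  have sm: "small (elts E)" using cd by (auto simp: E_def intro!: small_subset[OF J(1)])
  have ic: "idem_category E"
    by unfold_locales (auto simp: E_def cd M.ty_idem M.hom_ty M.ty_hom M.hom_hom M.ty_le_hom)
  have "cauchy E"
    unfolding cauchy_def
  proof (intro allI impI)
    fix e \<phi> \<psi> assume "adjoint_presheaf E e \<phi> \<psi>"
    then have "adjoint_presheaf M e (\<phi> \<circ> cd) (\<psi> \<circ> cd)"
      by (simp add: adjoint_presheaf_def presheaf_def copresheaf_def E_def cd image_image)
    then obtain x where x: "x \<in> elts M" "ty M x = e" "\<forall>m\<in>elts M. (\<phi> \<circ> cd) m = ehom M m x"
      using c unfolding cauchy_def by blast
    then show "\<exists>c\<in>elts E. ty E c = e \<and> (\<forall>x\<in>elts E. \<phi> x = ehom E x c)"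
      by (intro bexI[of _ "cd x"]) (auto simp: E_def cd)
  qed
  then show ?thesis using that[of E cd] sm ic by (auto simp: E_def cd)
qed

text \<open>
  The closure, in the presheaves on \<open>D\<close>, of the representables and the presheaves \<open>\<Theta>(-,x)\<close>.  It
  contains \<open>D\<close> as a full subcategory by the Yoneda embedding \<open>h\<close>, and the functor \<open>k\<close> sends \<open>x\<close> to
  \<open>\<Theta>(-,x)\<close>.
\<close>

lemma realise_distributor:
  fixes D :: "('x, 'q::quantale, 'q) ecat" and X :: "('y, 'q, 'q) ecat"
  assumes ce: "closed_under_exponents small TYPE('q)"
    and D: "idem_category D" "tiny (elts D)" and X: "tiny (elts X)"
    and \<Theta>: "\<And>x. x \<in> elts X \<Longrightarrow> presheaf D (ty X x) (\<lambda>d. \<Theta> d x)"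
    and X_ty: "\<And>x y. x \<in> elts X \<Longrightarrow> y \<in> elts X \<Longrightarrow> ehom X y x * ty X x = ehom X y x"
      "\<And>x y. x \<in> elts X \<Longrightarrow> y \<in> elts X \<Longrightarrow> ty X y * ehom X y x = ehom X y x"
    and \<Theta>X: "\<And>d x y. d \<in> elts D \<Longrightarrow> x \<in> elts X \<Longrightarrow> y \<in> elts X \<Longrightarrow> \<Theta> d y * ehom X y x \<le> \<Theta> d x"
  obtains E :: "('u, 'q, 'q) ecat" and h k where "small (elts E)" "idem_category E" "cauchy E"
    "\<And>d. d \<in> elts D \<Longrightarrow> h d \<in> elts E \<and> ty E (h d) = ty D d"
    "\<And>d d'. d \<in> elts D \<Longrightarrow> d' \<in> elts D \<Longrightarrow> ehom E (h d) (h d') = ehom D d d'"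
    "\<And>x. x \<in> elts X \<Longrightarrow> k x \<in> elts E \<and> ty E (k x) = ty X x"
    "\<And>x y. x \<in> elts X \<Longrightarrow> y \<in> elts X \<Longrightarrow> ehom X x y \<le> ehom E (k x) (k y)"
    "\<And>d x. d \<in> elts D \<Longrightarrow> x \<in> elts X \<Longrightarrow> ehom E (h d) (k x) = \<Theta> d x"
    "\<And>d x. d \<in> elts D \<Longrightarrow> x \<in> elts X \<Longrightarrow> ty X x = ty D d \<Longrightarrow>
      (\<And>d'. d' \<in> elts D \<Longrightarrow> \<Theta> d' x \<le> ehom D d' d) \<Longrightarrow> ty X x \<le> ehom E (k x) (h d)"
proof -
  interpret D: idem_category D by (rule D)
  define P where "P = presheaf_category D"
  define \<pi> where "\<pi> x = (ty X x, \<lambda>d\<in>elts D. \<Theta> d x)" for x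
  define I where "I = yoneda D ` elts D \<union> \<pi> ` elts X"
  have simps: "ty P = fst" "ehom P = presheaf_hom D" by (simp_all add: P_def presheaf_category_def)
  have P: "idem_category P" "cauchy P"
    unfolding P_def by (rule idem_category_presheaf_category D.cauchy_presheaf_category)+
  have \<pi>: "\<pi> x \<in> elts P" if "x \<in> elts X" for x
    using \<Theta>[OF that] by (auto simp: \<pi>_def P_def presheaf_category_def presheaf_def)
  have y: "yoneda D d \<in> elts P" if "d \<in> elts D" for d
    using D.yoneda_elts that by (simp add: P_def)
  have I: "I \<subseteq> elts P" using \<pi> y by (auto simp: I_def)
  have "tiny I" unfolding I_def by (intro tiny_Un tiny_image D X)
  moreover have "p = p'" if "p \<in> elts P" "p' \<in> elts P" "ty P p = ty P p'" "ty P p \<le> ehom P p p'"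
      "ty P p \<le> ehom P p' p" for p p'
    using that by (intro presheaf_category_skeletal[of p D p']) (simp_all add: simps P_def[symmetric])
  ultimately have t: "tiny (closure P I)"
    using P(1) I by (intro tiny_closure ce)
  have cl: "closure P I \<subseteq> elts P" "I \<subseteq> closure P I"
    using idem_category.subset_closure[OF P(1) I] by (auto simp: closure_def)
  obtain E :: "('u, 'q, 'q) ecat" and cd where E: "small (elts E)" "idem_category E" "cauchy E"
    "\<And>m. m \<in> closure P I \<Longrightarrow> cd m \<in> elts E \<and> ty E (cd m) = ty P m"
    "\<And>m n. m \<in> closure P I \<Longrightarrow> n \<in> closure P I \<Longrightarrow> ehom E (cd m) (cd n) = ehom P m n"
    using small_copy[OF idem_category.full[OF P(1) cl(1)] cauchy_closure[OF P I]] t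
    by (simp) blast
  have mem: "d \<in> elts D \<Longrightarrow> yoneda D d \<in> closure P I" "x \<in> elts X \<Longrightarrow> \<pi> x \<in> closure P I" for d x
    using cl(2) by (auto simp: I_def)
  have hom_y: "presheaf_hom D (yoneda D d) p = snd p d" if "d \<in> elts D" "p \<in> elts P" for d p
    using D.presheaf_hom_yoneda that by (simp add: P_def)
  show ?thesis
  proof (rule that[of E "\<lambda>d. cd (yoneda D d)" "\<lambda>x. cd (\<pi> x)"])
    show "ehom X x z \<le> ehom E (cd (\<pi> x)) (cd (\<pi> z))" if "x \<in> elts X" "z \<in> elts X" for x z
      using that X_ty \<Theta>X by (simp add: E mem simps) (subst le_presheaf_hom_iff; simp add: \<pi>_def)
    show "ty X x \<le> ehom E (cd (\<pi> x)) (cd (yoneda D d))"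
      if *: "d \<in> elts D" "x \<in> elts X" "ty X x = ty D d" "\<And>d'. d' \<in> elts D \<Longrightarrow> \<Theta> d' x \<le> ehom D d' d" for d x
    proof -
      have "\<Theta> d' x * ty D d = \<Theta> d' x" if "d' \<in> elts D" for d'
        using \<Theta>[OF *(2)] *(3) that by (simp add: presheaf_def)
      then show ?thesis using * D.ty_idem
        by (simp add: E mem simps) (subst le_presheaf_hom_iff; simp add: \<pi>_def yoneda_def)
    qed
    show "cd (yoneda D d) \<in> elts E \<and> ty E (cd (yoneda D d)) = ty D d" if "d \<in> elts D" for d
      using E(4)[OF mem(1)[OF that]] by (simp add: simps yoneda_def)
    show "cd (\<pi> x) \<in> elts E \<and> ty E (cd (\<pi> x)) = ty X x" if "x \<in> elts X" for x
      using E(4)[OF mem(2)[OF that]] by (simp add: simps \<pi>_def)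
    show "ehom E (cd (yoneda D d)) (cd (yoneda D d')) = ehom D d d'"
      if "d \<in> elts D" "d' \<in> elts D" for d d'
      using that by (simp add: E mem simps hom_y y) (simp add: yoneda_def)
    show "ehom E (cd (yoneda D d)) (cd (\<pi> x)) = \<Theta> d x"
      if "d \<in> elts D" "x \<in> elts X" for d x
      using that by (simp add: E mem simps hom_y \<pi>) (simp add: \<pi>_def)
  qed (rule E)+
qed

end

section \<open>Lax epimorphisms, embeddings and cospans\<close>

context locally_ordered_category
begin

abbreviation le2 :: "'o \<Rightarrow> 'o \<Rightarrow> 'm \<Rightarrow> 'm \<Rightarrow> bool" where
  "le2 X Y f g \<equiv> f \<sqsubseteq>\<^bsub>hom C X Y\<^esub> g"

definition eqv :: "'o \<Rightarrow> 'o \<Rightarrow> 'm \<Rightarrow> 'm \<Rightarrow> bool" where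
  "eqv X Y f g \<longleftrightarrow> le2 X Y f g \<and> le2 X Y g f"

lemma le2_refl: "X \<in> ob C \<Longrightarrow> Y \<in> ob C \<Longrightarrow> f \<in> arr C X Y \<Longrightarrow> le2 X Y f f"
  using weak_partial_order.le_refl[OF hom_order] .

lemma le2_trans:
  "X \<in> ob C \<Longrightarrow> Y \<in> ob C \<Longrightarrow> f \<in> arr C X Y \<Longrightarrow> g \<in> arr C X Y \<Longrightarrow> h \<in> arr C X Y \<Longrightarrow>
    le2 X Y f g \<Longrightarrow> le2 X Y g h \<Longrightarrow> le2 X Y f h"
  using weak_partial_order.le_trans[OF hom_order] .

lemma eq_iff_eqv:
  assumes "X \<in> ob C" "Y \<in> ob C" "f \<in> arr C X Y" "g \<in> arr C X Y"
  shows "f .=\<^bsub>hom C X Y\<^esub> g \<longleftrightarrow> eqv X Y f g"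
proof -
  interpret weak_partial_order "hom C X Y" using assms hom_order by auto
  show ?thesis unfolding eqv_def using assms
    by (auto intro: weak_le_antisym weak_refl sym)
qed

lemma eqv_refl: "X \<in> ob C \<Longrightarrow> Y \<in> ob C \<Longrightarrow> f \<in> arr C X Y \<Longrightarrow> eqv X Y f f"
  by (simp add: eqv_def le2_refl)

lemma eqv_sym: "eqv X Y f g \<Longrightarrow> eqv X Y g f"
  by (simp add: eqv_def)

lemma eqv_trans:
  "X \<in> ob C \<Longrightarrow> Y \<in> ob C \<Longrightarrow> f \<in> arr C X Y \<Longrightarrow> g \<in> arr C X Y \<Longrightarrow> h \<in> arr C X Y \<Longrightarrow>
    eqv X Y f g \<Longrightarrow> eqv X Y g h \<Longrightarrow> eqv X Y f h"
  unfolding eqv_def using le2_trans by blast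

lemma le2_cong:
  assumes "X \<in> ob C" "Y \<in> ob C" "f \<in> arr C X Y" "f' \<in> arr C X Y" "g \<in> arr C X Y" "g' \<in> arr C X Y"
    "eqv X Y f f'" "eqv X Y g g'"
  shows "le2 X Y f g \<longleftrightarrow> le2 X Y f' g'"
  using assms unfolding eqv_def by (meson le2_trans)

lemma cmp_left_mono:
  "X \<in> ob C \<Longrightarrow> Y \<in> ob C \<Longrightarrow> Z \<in> ob C \<Longrightarrow> f \<in> arr C X Y \<Longrightarrow> g \<in> arr C Y Z \<Longrightarrow> g' \<in> arr C Y Z \<Longrightarrow>
    le2 Y Z g g' \<Longrightarrow> le2 X Z (cmp C X Y Z g f) (cmp C X Y Z g' f)"
  by (rule cmp_mono) (auto intro: le2_refl)

lemma cmp_right_mono: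
  "X \<in> ob C \<Longrightarrow> Y \<in> ob C \<Longrightarrow> Z \<in> ob C \<Longrightarrow> f \<in> arr C X Y \<Longrightarrow> f' \<in> arr C X Y \<Longrightarrow> g \<in> arr C Y Z \<Longrightarrow>
    le2 X Y f f' \<Longrightarrow> le2 X Z (cmp C X Y Z g f) (cmp C X Y Z g f')"
  by (rule cmp_mono) (auto intro: le2_refl)

lemma cmp_left_eqv:
  "X \<in> ob C \<Longrightarrow> Y \<in> ob C \<Longrightarrow> Z \<in> ob C \<Longrightarrow> f \<in> arr C X Y \<Longrightarrow> g \<in> arr C Y Z \<Longrightarrow> g' \<in> arr C Y Z \<Longrightarrow>
    eqv Y Z g g' \<Longrightarrow> eqv X Z (cmp C X Y Z g f) (cmp C X Y Z g' f)"
  unfolding eqv_def by (simp add: cmp_left_mono)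

lemma cmp_right_eqv:
  "X \<in> ob C \<Longrightarrow> Y \<in> ob C \<Longrightarrow> Z \<in> ob C \<Longrightarrow> f \<in> arr C X Y \<Longrightarrow> f' \<in> arr C X Y \<Longrightarrow> g \<in> arr C Y Z \<Longrightarrow>
    eqv X Y f f' \<Longrightarrow> eqv X Z (cmp C X Y Z g f) (cmp C X Y Z g f')"
  unfolding eqv_def by (simp add: cmp_right_mono)

definition retraction :: "'o \<Rightarrow> 'o \<Rightarrow> 'm \<Rightarrow> 'm \<Rightarrow> bool" where
  "retraction X Y r s \<longleftrightarrow> s \<in> arr C X Y \<and> r \<in> arr C Y X \<and> eqv X X (cmp C X Y X r s) (idt C X)"

lemma retraction_cmp:
  assumes "retraction Y Z r s" "X \<in> ob C" "Y \<in> ob C" "Z \<in> ob C" "f \<in> arr C X Y"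
  shows "eqv X Y (cmp C X Z Y r (cmp C X Y Z s f)) f"
proof -
  have "eqv X Y (cmp C X Y Y (cmp C Y Z Y r s) f) (cmp C X Y Y (idt C Y) f)"
    using assms by (intro cmp_left_eqv) (auto simp: retraction_def cmp_arr idt_arr)
  then show ?thesis using assms by (simp add: cmp_idt_left cmp_assoc retraction_def)
qed

lemma cmp_retraction:
  assumes "retraction X Y r s" "X \<in> ob C" "Y \<in> ob C" "Z \<in> ob C" "f \<in> arr C X Z"
  shows "eqv X Z (cmp C X Y Z (cmp C Y X Z f r) s) f"
proof -
  have "eqv X Z (cmp C X X Z f (cmp C X Y X r s)) (cmp C X X Z f (idt C X))"
    using assms by (intro cmp_right_eqv) (auto simp: retraction_def cmp_arr idt_arr)
  then show ?thesis using assms by (simp add: cmp_idt_right cmp_assoc retraction_def)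
qed

lemma retraction_le2_cancel_left:
  assumes "retraction Y Z r s" "X \<in> ob C" "Y \<in> ob C" "Z \<in> ob C" "f \<in> arr C X Y" "g \<in> arr C X Y"
    "le2 X Z (cmp C X Y Z s f) (cmp C X Y Z s g)"
  shows "le2 X Y f g"
proof -
  have rs: "r \<in> arr C Z Y" "s \<in> arr C Y Z" using assms by (auto simp: retraction_def)
  have "le2 X Y (cmp C X Z Y r (cmp C X Y Z s f)) (cmp C X Z Y r (cmp C X Y Z s g))"
    using assms rs by (intro cmp_right_mono[where Y = Z] assms(7)) (auto simp: cmp_arr)
  moreover have "cmp C X Z Y r (cmp C X Y Z s f) \<in> arr C X Y" "cmp C X Z Y r (cmp C X Y Z s g) \<in> arr C X Y"
    using assms rs by (auto intro!: cmp_arr)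
  ultimately show ?thesis
    using le2_cong[OF assms(2,3) _ assms(5) _ assms(6) retraction_cmp[OF assms(1-5)]
        retraction_cmp[OF assms(1-4,6)]] by blast
qed

lemma retraction_le2_cancel_right:
  assumes "retraction Y Z r s" "X \<in> ob C" "Y \<in> ob C" "Z \<in> ob C" "f \<in> arr C Y X" "g \<in> arr C Y X"
    "le2 Z X (cmp C Z Y X f r) (cmp C Z Y X g r)"
  shows "le2 Y X f g"
proof -
  have rs: "r \<in> arr C Z Y" "s \<in> arr C Y Z" using assms by (auto simp: retraction_def)
  have "le2 Y X (cmp C Y Z X (cmp C Z Y X f r) s) (cmp C Y Z X (cmp C Z Y X g r) s)"
    using assms rs by (intro cmp_left_mono[where Y = Z] assms(7)) (auto simp: cmp_arr)
  moreover have "cmp C Y Z X (cmp C Z Y X f r) s \<in> arr C Y X" "cmp C Y Z X (cmp C Z Y X g r) s \<in> arr C Y X"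
    using assms rs by (auto intro!: cmp_arr)
  ultimately show ?thesis
    using le2_cong[OF assms(3,2) _ assms(5) _ assms(6) cmp_retraction[OF assms(1,3,4,2,5)]
        cmp_retraction[OF assms(1,3,4,2,6)]] by blast
qed

lemma equivalence_arr_iff:
  assumes "X \<in> ob C" "Y \<in> ob C"
  shows "equivalence_arr C X Y s \<longleftrightarrow> (\<exists>r. retraction X Y r s \<and> retraction Y X s r)"
  using assms unfolding equivalence_arr_def retraction_def
  by (auto simp: eq_iff_eqv cmp_arr idt_arr)

definition lax_epi :: "'o \<Rightarrow> 'o \<Rightarrow> 'm \<Rightarrow> bool" where
  "lax_epi X Y G \<longleftrightarrow> G \<in> arr C X Y \<and> (\<forall>Z\<in>ob C. \<forall>u\<in>arr C Y Z. \<forall>v\<in>arr C Y Z.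
     le2 X Z (cmp C X Y Z u G) (cmp C X Y Z v G) \<longrightarrow> le2 Y Z u v)"

text \<open>
  In \<open>Ord(Q)\<close> the lax epimorphisms are the functors with dense image, so that this is full
  faithfulness, expressed without reference to enriched homs: the image factorisation of \<open>h\<close> is
  trivial.
\<close>

definition embedding :: "'o \<Rightarrow> 'o \<Rightarrow> 'm \<Rightarrow> bool" where
  "embedding A B h \<longleftrightarrow> h \<in> arr C A B \<and> (\<forall>Y\<in>ob C. \<forall>G\<in>arr C A Y. \<forall>m\<in>arr C Y B.
     lax_epi A Y G \<and> eqv A B (cmp C A Y B m G) h \<longrightarrow> (\<exists>r. retraction A Y r G))"

definition cospan :: "'o \<Rightarrow> 'o \<Rightarrow> 'o \<times> 'm \<times> 'm \<Rightarrow> bool" where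
  "cospan A B = (\<lambda>(X, f, g). X \<in> ob C \<and> f \<in> arr C A X \<and> g \<in> arr C B X)"

text \<open>
  A cospan \<open>(X,f,g)\<close> stands for the distributor \<open>X(g-,f-)\<close>.  From \<open>k \<circ> f \<le> h \<circ> u\<close> and \<open>h \<circ> v \<le> k \<circ> g\<close>
  follows \<open>X(g-,f-) \<le> E(h v-, h u-)\<close>, and the embedding \<open>h\<close> takes this back to \<open>Y(v-,u-)\<close>.
\<close>

definition cospan_le :: "'o \<Rightarrow> 'o \<Rightarrow> 'o \<times> 'm \<times> 'm \<Rightarrow> 'o \<times> 'm \<times> 'm \<Rightarrow> bool" where
  "cospan_le A B = (\<lambda>(X, f, g) (Y, u, v). \<exists>E\<in>ob C. \<exists>k\<in>arr C X E. \<exists>h. embedding Y E h \<and>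
     le2 A E (cmp C A X E k f) (cmp C A Y E h u) \<and>
     le2 B E (cmp C B Y E h v) (cmp C B X E k g))"

end

section \<open>Invariance under weak equivalence\<close>

text \<open>
  A pseudofunctor that is an equivalence of preorders on homs and essentially surjective.  Compared
  with a biequivalence this has the advantage of being a condition on a single pseudofunctor.
\<close>

locale weak_equivalence =
  C: locally_ordered_category C + D: locally_ordered_category D
  for C :: "('o, 'm) ocat" and D :: "('p, 'n) ocat" +
  fixes F :: "('o, 'm, 'p, 'n) fctr"
  assumes F_ob: "X \<in> ob C \<Longrightarrow> fob F X \<in> ob D"
    and F_arr: "\<lbrakk>X \<in> ob C; Y \<in> ob C; f \<in> arr C X Y\<rbrakk> \<Longrightarrow> farr F X Y f \<in> arr D (fob F X) (fob F Y)"
    and F_le2_iff: "\<lbrakk>X \<in> ob C; Y \<in> ob C; f \<in> arr C X Y; g \<in> arr C X Y\<rbrakk>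
      \<Longrightarrow> D.le2 (fob F X) (fob F Y) (farr F X Y f) (farr F X Y g) \<longleftrightarrow> C.le2 X Y f g"
    and F_idt: "X \<in> ob C \<Longrightarrow> D.eqv (fob F X) (fob F X) (farr F X X (idt C X)) (idt D (fob F X))"
    and F_cmp: "\<lbrakk>X \<in> ob C; Y \<in> ob C; Z \<in> ob C; f \<in> arr C X Y; g \<in> arr C Y Z\<rbrakk>
      \<Longrightarrow> D.eqv (fob F X) (fob F Z) (farr F X Z (cmp C X Y Z g f))
            (cmp D (fob F X) (fob F Y) (fob F Z) (farr F Y Z g) (farr F X Y f))"
    and F_full: "\<lbrakk>X \<in> ob C; Y \<in> ob C; h \<in> arr D (fob F X) (fob F Y)\<rbrakk>
      \<Longrightarrow> \<exists>f\<in>arr C X Y. D.eqv (fob F X) (fob F Y) h (farr F X Y f)"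
    and F_surj: "B \<in> ob D \<Longrightarrow> \<exists>X\<in>ob C. \<exists>e e'. D.retraction B (fob F X) e' e \<and> D.retraction (fob F X) B e e'"
begin

lemma F_eqv_iff: "\<lbrakk>X \<in> ob C; Y \<in> ob C; f \<in> arr C X Y; g \<in> arr C X Y\<rbrakk>
      \<Longrightarrow> D.eqv (fob F X) (fob F Y) (farr F X Y f) (farr F X Y g) \<longleftrightarrow> C.eqv X Y f g"
  by (simp add: C.eqv_def D.eqv_def F_le2_iff)

lemma F_cmp_le2_iff:
  assumes "X \<in> ob C" "Y \<in> ob C" "Y' \<in> ob C" "Z \<in> ob C"
    "f \<in> arr C X Y" "g \<in> arr C Y Z" "f' \<in> arr C X Y'" "g' \<in> arr C Y' Z"
  shows "D.le2 (fob F X) (fob F Z)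
       (cmp D (fob F X) (fob F Y) (fob F Z) (farr F Y Z g) (farr F X Y f))
       (cmp D (fob F X) (fob F Y') (fob F Z) (farr F Y' Z g') (farr F X Y' f')) \<longleftrightarrow>
     C.le2 X Z (cmp C X Y Z g f) (cmp C X Y' Z g' f')"
proof -
  have "D.le2 (fob F X) (fob F Z)
       (cmp D (fob F X) (fob F Y) (fob F Z) (farr F Y Z g) (farr F X Y f))
       (cmp D (fob F X) (fob F Y') (fob F Z) (farr F Y' Z g') (farr F X Y' f')) \<longleftrightarrow>
     D.le2 (fob F X) (fob F Z) (farr F X Z (cmp C X Y Z g f)) (farr F X Z (cmp C X Y' Z g' f'))"
    using assms
    by (intro D.le2_cong D.eqv_sym[OF F_cmp] D.cmp_arr F_ob F_arr C.cmp_arr)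
  then show ?thesis using assms by (simp add: F_le2_iff C.cmp_arr)
qed

lemma F_retraction_iff:
  assumes "X \<in> ob C" "Y \<in> ob C" "r \<in> arr C Y X" "s \<in> arr C X Y"
  shows "D.retraction (fob F X) (fob F Y) (farr F Y X r) (farr F X Y s) \<longleftrightarrow> C.retraction X Y r s"
proof -
  have "D.eqv (fob F X) (fob F X) (cmp D (fob F X) (fob F Y) (fob F X) (farr F Y X r) (farr F X Y s)) (idt D (fob F X)) \<longleftrightarrow>
     D.eqv (fob F X) (fob F X) (farr F X X (cmp C X Y X r s)) (farr F X X (idt C X))"
    using assms F_cmp[of X Y X s r] F_idt[of X] F_ob F_arr C.cmp_arr D.cmp_arr C.idt_arr D.idt_arr
    by (meson D.eqv_sym D.eqv_trans)
  then show ?thesis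
    using assms by (simp add: C.retraction_def D.retraction_def F_eqv_iff F_arr C.cmp_arr C.idt_arr)
qed

end

context locally_ordered_category
begin

lemma lax_epi_cmp_equivalence:
  assumes X: "X \<in> ob C" and Y: "Y \<in> ob C" and Z: "Z \<in> ob C"
    and G: "lax_epi X Y G" and e: "retraction Z Y s r"
    and G': "G' \<in> arr C X Z" "eqv X Z (cmp C X Y Z s G) G'"
  shows "lax_epi X Z G'"
  unfolding lax_epi_def
proof (intro conjI ballI impI G'(1))
  have G: "G \<in> arr C X Y" "\<forall>W\<in>ob C. \<forall>u\<in>arr C Y W. \<forall>v\<in>arr C Y W.
      le2 X W (cmp C X Y W u G) (cmp C X Y W v G) \<longrightarrow> le2 Y W u v"
    and s: "s \<in> arr C Y Z" "r \<in> arr C Z Y"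
    using G e by (auto simp: lax_epi_def retraction_def)
  have sG: "cmp C X Y Z s G \<in> arr C X Z" by (rule cmp_arr[OF X Y Z G(1) s(1)])
  fix W u v assume W: "W \<in> ob C" and uv: "u \<in> arr C Z W" "v \<in> arr C Z W"
    and le: "le2 X W (cmp C X Z W u G') (cmp C X Z W v G')"
  have us: "cmp C Y Z W u s \<in> arr C Y W" "cmp C Y Z W v s \<in> arr C Y W"
    using Y Z W s uv by (auto intro: cmp_arr)
  have "le2 X W (cmp C X Z W u (cmp C X Y Z s G)) (cmp C X Z W v (cmp C X Y Z s G))"
    using le2_cong[OF X W cmp_arr[OF X Z W sG uv(1)] cmp_arr[OF X Z W G'(1) uv(1)]
        cmp_arr[OF X Z W sG uv(2)] cmp_arr[OF X Z W G'(1) uv(2)]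
        cmp_right_eqv[OF X Z W sG G'(1) uv(1) G'(2)] cmp_right_eqv[OF X Z W sG G'(1) uv(2) G'(2)]] le by simp
  then have "le2 X W (cmp C X Y W (cmp C Y Z W u s) G) (cmp C X Y W (cmp C Y Z W v s) G)"
    using cmp_assoc[OF X Y Z W G(1) s(1)] uv by simp
  then have "le2 Y W (cmp C Y Z W u s) (cmp C Y Z W v s)" using G(2) W us by blast
  then show "le2 Z W u v" by (rule retraction_le2_cancel_right[OF e W Z Y uv])
qed

lemma embedding_cmp_equivalence:
  assumes A: "A \<in> ob C" and B: "B \<in> ob C" and B': "B' \<in> ob C"
    and h: "embedding A B h" and e: "retraction B B' e' e"
    and h': "h' \<in> arr C A B'" "eqv A B' (cmp C A B B' e h) h'"
  shows "embedding A B' h'"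
  unfolding embedding_def
proof (intro conjI ballI impI h'(1))
  have h_arr: "h \<in> arr C A B" and e_arr: "e \<in> arr C B B'" "e' \<in> arr C B' B"
    using h e by (auto simp: embedding_def retraction_def)
  fix Y G m assume Y: "Y \<in> ob C" and G: "G \<in> arr C A Y" and m: "m \<in> arr C Y B'"
    and *: "lax_epi A Y G \<and> eqv A B' (cmp C A Y B' m G) h'"
  have mG: "cmp C A Y B' m G \<in> arr C A B'" and eh: "cmp C A B B' e h \<in> arr C A B'"
    and em: "cmp C Y B' B e' m \<in> arr C Y B"
    using cmp_arr A B B' Y G m e_arr h_arr by auto
  have "eqv A B' (cmp C A Y B' m G) (cmp C A B B' e h)"
    using eqv_trans[OF A B' mG h'(1) eh] eqv_sym[OF h'(2)] * by blast
  then have "eqv A B (cmp C A B' B e' (cmp C A Y B' m G)) (cmp C A B' B e' (cmp C A B B' e h))"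
    by (rule cmp_right_eqv[OF A B' B mG eh e_arr(2)])
  then have "eqv A B (cmp C A Y B (cmp C Y B' B e' m) G) h"
    using eqv_trans[OF A B cmp_arr[OF A B' B mG e_arr(2)] cmp_arr[OF A B' B eh e_arr(2)] h_arr _
        retraction_cmp[OF e A B B' h_arr]] cmp_assoc[OF A Y B' B G m e_arr(2)] by simp
  then show "\<exists>r. retraction A Y r G"
    using h * Y G em unfolding embedding_def by blast
qed

end

context weak_equivalence
begin

text \<open>
  Up to the equivalence \<open>e : Z \<rightarrow> F W\<close>, the arrow \<open>u : F X \<rightarrow> Z\<close> is the image of \<open>u0 : X \<rightarrow> W\<close>.
\<close>

definition lifts :: "'p \<Rightarrow> 'o \<Rightarrow> 'n \<Rightarrow> 'o \<Rightarrow> 'n \<Rightarrow> 'm \<Rightarrow> bool" where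
  "lifts Z W e X u u0 \<longleftrightarrow> u \<in> arr D (fob F X) Z \<and> u0 \<in> arr C X W \<and>
     D.eqv (fob F X) (fob F W) (cmp D (fob F X) Z (fob F W) e u) (farr F X W u0)"

lemma lifts_exist:
  assumes Z: "Z \<in> ob D"
  obtains W e e' where "W \<in> ob C" "D.retraction Z (fob F W) e' e" "D.retraction (fob F W) Z e e'"
    "\<And>X u. X \<in> ob C \<Longrightarrow> u \<in> arr D (fob F X) Z \<Longrightarrow> \<exists>u0. lifts Z W e X u u0"
proof -
  obtain W e e' where W: "W \<in> ob C" "D.retraction Z (fob F W) e' e" "D.retraction (fob F W) Z e e'"
    using F_surj[OF Z] by blast
  then have e: "e \<in> arr D Z (fob F W)" by (simp add: D.retraction_def)
  have "\<exists>u0. lifts Z W e X u u0" if X: "X \<in> ob C" and u: "u \<in> arr D (fob F X) Z" for X u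
    using F_full[OF X W(1) D.cmp_arr[OF F_ob[OF X] Z F_ob[OF W(1)] u e]] u unfolding lifts_def by blast
  then show ?thesis using that W by blast
qed

lemma lifts_cmp:
  assumes Z: "Z \<in> ob D" and W: "W \<in> ob C" and e: "e \<in> arr D Z (fob F W)" and X: "X \<in> ob C"
    and u: "lifts Z W e X u u0" and A: "A \<in> ob C" and f: "f \<in> arr C A X"
  shows "lifts Z W e A (cmp D (fob F A) (fob F X) Z u (farr F A X f)) (cmp C A X W u0 f)"
proof -
  note ob = F_ob[OF A] F_ob[OF X] Z F_ob[OF W]
  have u: "u \<in> arr D (fob F X) Z" "u0 \<in> arr C X W"
      "D.eqv (fob F X) (fob F W) (cmp D (fob F X) Z (fob F W) e u) (farr F X W u0)"
    using u by (auto simp: lifts_def)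
  note Ff = F_arr[OF A X f] and Fu0 = F_arr[OF X W u(2)]
  have eu: "cmp D (fob F X) Z (fob F W) e u \<in> arr D (fob F X) (fob F W)"
    by (rule D.cmp_arr[OF ob(2-4) u(1) e])
  have u0f: "cmp C A X W u0 f \<in> arr C A W" by (rule C.cmp_arr[OF A X W f u(2)])
  have "D.eqv (fob F A) (fob F W) (cmp D (fob F A) (fob F X) (fob F W) (cmp D (fob F X) Z (fob F W) e u) (farr F A X f))
      (cmp D (fob F A) (fob F X) (fob F W) (farr F X W u0) (farr F A X f))"
    by (rule D.cmp_left_eqv[OF ob(1,2,4) Ff eu Fu0 u(3)])
  then have "D.eqv (fob F A) (fob F W) (cmp D (fob F A) (fob F X) (fob F W) (cmp D (fob F X) Z (fob F W) e u) (farr F A X f))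
      (farr F A W (cmp C A X W u0 f))"
    by (rule D.eqv_trans[OF ob(1,4) D.cmp_arr[OF ob(1,2,4) Ff eu] D.cmp_arr[OF ob(1,2,4) Ff Fu0]
          F_arr[OF A W u0f] _ D.eqv_sym[OF F_cmp[OF A X W f u(2)]]])
  then show ?thesis
    using D.cmp_assoc[OF ob Ff u(1) e] D.cmp_arr[OF ob(1,2,3) Ff u(1)] u0f by (simp add: lifts_def)
qed

lemma lifts_le2_iff:
  assumes Z: "Z \<in> ob D" and W: "W \<in> ob C" and e: "D.retraction Z (fob F W) e' e" and X: "X \<in> ob C"
    and u: "lifts Z W e X u u0" and v: "lifts Z W e X v v0"
  shows "D.le2 (fob F X) Z u v \<longleftrightarrow> C.le2 X W u0 v0"
proof -
  note ob = F_ob[OF X] Z F_ob[OF W]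
  have e': "e \<in> arr D Z (fob F W)" using e by (simp add: D.retraction_def)
  have uv: "u \<in> arr D (fob F X) Z" "v \<in> arr D (fob F X) Z" "u0 \<in> arr C X W" "v0 \<in> arr C X W"
    using u v by (auto simp: lifts_def)
  have "D.le2 (fob F X) Z u v \<longleftrightarrow>
      D.le2 (fob F X) (fob F W) (cmp D (fob F X) Z (fob F W) e u) (cmp D (fob F X) Z (fob F W) e v)"
    using D.retraction_le2_cancel_left[OF e ob uv(1,2)] D.cmp_right_mono[OF ob uv(1,2) e'] by blast
  also have "\<dots> \<longleftrightarrow> D.le2 (fob F X) (fob F W) (farr F X W u0) (farr F X W v0)"
    using u v D.cmp_arr[OF ob _ e'] F_arr[OF X W]
    by (intro D.le2_cong[OF ob(1,3)]) (auto simp: lifts_def)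
  finally show ?thesis using F_le2_iff[OF X W uv(3,4)] by simp
qed

text \<open>
  The notions of lax epimorphism, embedding and order of cospans only mention arrows and their order,
  so they are invariant.  When they quantify over arrows from an object \<open>F X\<close> into an arbitrary object
  \<open>Z\<close> of \<open>D\<close>, the quantifier is transferred by replacing these arrows by their lifts.
\<close>

lemma F_lax_epi_iff:
  assumes X: "X \<in> ob C" and Y: "Y \<in> ob C" and G: "G \<in> arr C X Y"
  shows "D.lax_epi (fob F X) (fob F Y) (farr F X Y G) \<longleftrightarrow> C.lax_epi X Y G"
proof
  assume *: "D.lax_epi (fob F X) (fob F Y) (farr F X Y G)"
  show "C.lax_epi X Y G"
    unfolding C.lax_epi_def
  proof (intro conjI ballI impI G)
    fix Z u v assume Z: "Z \<in> ob C" and uv: "u \<in> arr C Y Z" "v \<in> arr C Y Z"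
      and "C.le2 X Z (cmp C X Y Z u G) (cmp C X Y Z v G)"
    then have "D.le2 (fob F Y) (fob F Z) (farr F Y Z u) (farr F Y Z v)"
      using * F_cmp_le2_iff[OF X Y Y Z G uv(1) G uv(2)] F_ob[OF Z] F_arr[OF Y Z]
      unfolding D.lax_epi_def by blast
    then show "C.le2 Y Z u v" using F_le2_iff Y Z uv by blast
  qed
next
  assume *: "C.lax_epi X Y G"
  show "D.lax_epi (fob F X) (fob F Y) (farr F X Y G)"
    unfolding D.lax_epi_def
  proof (intro conjI ballI impI F_arr X Y G)
    fix Z u v assume Z: "Z \<in> ob D" and uv: "u \<in> arr D (fob F Y) Z" "v \<in> arr D (fob F Y) Z"
      and le: "D.le2 (fob F X) Z (cmp D (fob F X) (fob F Y) Z u (farr F X Y G))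
         (cmp D (fob F X) (fob F Y) Z v (farr F X Y G))"
    obtain W e e' where W: "W \<in> ob C" and e: "D.retraction Z (fob F W) e' e"
      and lift: "\<And>X u. X \<in> ob C \<Longrightarrow> u \<in> arr D (fob F X) Z \<Longrightarrow> \<exists>u0. lifts Z W e X u u0"
      using lifts_exist[OF Z] by metis
    have e': "e \<in> arr D Z (fob F W)" using e by (simp add: D.retraction_def)
    obtain u0 v0 where u0: "lifts Z W e Y u u0" and v0: "lifts Z W e Y v v0"
      using lift[OF Y] uv by meson
    have "C.le2 X W (cmp C X Y W u0 G) (cmp C X Y W v0 G)"
      using lifts_le2_iff[OF Z W e X lifts_cmp[OF Z W e' Y u0 X G] lifts_cmp[OF Z W e' Y v0 X G]] le by simp
    then have "C.le2 Y W u0 v0"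
      using * W u0 v0 unfolding C.lax_epi_def lifts_def by blast
    then show "D.le2 (fob F Y) Z u v" using lifts_le2_iff[OF Z W e Y u0 v0] by simp
  qed
qed

lemma F_embedding_iff:
  assumes A: "A \<in> ob C" and B: "B \<in> ob C" and h: "h \<in> arr C A B"
  shows "D.embedding (fob F A) (fob F B) (farr F A B h) \<longleftrightarrow> C.embedding A B h"
proof
  note obA = F_ob[OF A] and obB = F_ob[OF B] and Fh = F_arr[OF A B h]
  {
    assume *: "D.embedding (fob F A) (fob F B) (farr F A B h)"
    show "C.embedding A B h"
      unfolding C.embedding_def
    proof (intro conjI ballI impI h)
      fix Y G m assume Y: "Y \<in> ob C" and G: "G \<in> arr C A Y" and m: "m \<in> arr C Y B"
        and Gm: "C.lax_epi A Y G \<and> C.eqv A B (cmp C A Y B m G) h"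
      note obY = F_ob[OF Y] and FG = F_arr[OF A Y G] and Fm = F_arr[OF Y B m]
      have mG: "cmp C A Y B m G \<in> arr C A B" by (rule C.cmp_arr[OF A Y B G m])
      have "D.eqv (fob F A) (fob F B)
          (cmp D (fob F A) (fob F Y) (fob F B) (farr F Y B m) (farr F A Y G)) (farr F A B h)"
        using D.eqv_trans[OF obA obB D.cmp_arr[OF obA obY obB FG Fm] F_arr[OF A B mG] Fh
            D.eqv_sym[OF F_cmp[OF A Y B G m]]] F_eqv_iff[OF A B mG h] Gm by blast
      moreover have "D.lax_epi (fob F A) (fob F Y) (farr F A Y G)" using Gm F_lax_epi_iff[OF A Y G] by simp
      ultimately obtain r where r: "D.retraction (fob F A) (fob F Y) r (farr F A Y G)"
        using * obY FG Fm unfolding D.embedding_def by meson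
      then have r': "r \<in> arr D (fob F Y) (fob F A)" by (simp add: D.retraction_def)
      obtain r0 where r0: "r0 \<in> arr C Y A" "D.eqv (fob F Y) (fob F A) r (farr F Y A r0)"
        using F_full[OF Y A r'] by blast
      note Fr0 = F_arr[OF Y A r0(1)]
      have "D.eqv (fob F A) (fob F A) (cmp D (fob F A) (fob F Y) (fob F A) (farr F Y A r0) (farr F A Y G))
          (idt D (fob F A))"
        by (rule D.eqv_trans[OF obA obA D.cmp_arr[OF obA obY obA FG Fr0] D.cmp_arr[OF obA obY obA FG r']
              D.idt_arr[OF obA] D.cmp_left_eqv[OF obA obY obA FG Fr0 r' D.eqv_sym[OF r0(2)]]])
          (use r in \<open>simp add: D.retraction_def\<close>)
      then have "D.retraction (fob F A) (fob F Y) (farr F Y A r0) (farr F A Y G)"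
        using FG Fr0 by (simp add: D.retraction_def)
      then show "\<exists>r. C.retraction A Y r G" using F_retraction_iff A Y G r0 by blast
    qed
  next
    assume *: "C.embedding A B h"
    show "D.embedding (fob F A) (fob F B) (farr F A B h)"
      unfolding D.embedding_def
    proof (intro conjI ballI impI Fh)
      fix Y G m assume Y: "Y \<in> ob D" and G: "G \<in> arr D (fob F A) Y" and m: "m \<in> arr D Y (fob F B)"
        and Gm: "D.lax_epi (fob F A) Y G \<and> D.eqv (fob F A) (fob F B) (cmp D (fob F A) Y (fob F B) m G) (farr F A B h)"
      obtain W e e' where W: "W \<in> ob C" "D.retraction Y (fob F W) e' e" "D.retraction (fob F W) Y e e'"
        and lift: "\<And>X u. X \<in> ob C \<Longrightarrow> u \<in> arr D (fob F X) Y \<Longrightarrow> \<exists>u0. lifts Y W e X u u0"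
        using lifts_exist[OF Y] by metis
      then have e: "e \<in> arr D Y (fob F W)" "e' \<in> arr D (fob F W) Y" by (auto simp: D.retraction_def)
      note obW = F_ob[OF W(1)]
      let ?eG = "cmp D (fob F A) Y (fob F W) e G" and ?me = "cmp D (fob F W) Y (fob F B) m e'"
      let ?c = "cmp D (fob F A) (fob F W) (fob F B)"
      have eG: "?eG \<in> arr D (fob F A) (fob F W)" by (rule D.cmp_arr[OF obA Y obW G e(1)])
      have me: "?me \<in> arr D (fob F W) (fob F B)" by (rule D.cmp_arr[OF obW Y obB e(2) m])
      have mG: "cmp D (fob F A) Y (fob F B) m G \<in> arr D (fob F A) (fob F B)" by (rule D.cmp_arr[OF obA Y obB G m])
      obtain G0 where G0: "G0 \<in> arr C A W" "D.eqv (fob F A) (fob F W) ?eG (farr F A W G0)"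
        using lift[OF A G] unfolding lifts_def by blast
      obtain m0 where m0: "m0 \<in> arr C W B" "D.eqv (fob F W) (fob F B) ?me (farr F W B m0)"
        using F_full[OF W(1) B me] by blast
      note FG0 = F_arr[OF A W(1) G0(1)] and Fm0 = F_arr[OF W(1) B m0(1)]
      have m0G0: "cmp C A W B m0 G0 \<in> arr C A B" by (rule C.cmp_arr[OF A W(1) B G0(1) m0(1)])
      have "D.lax_epi (fob F A) (fob F W) (farr F A W G0)"
        using D.lax_epi_cmp_equivalence[OF obA Y obW _ W(3) FG0 G0(2)] Gm by blast
      then have "C.lax_epi A W G0" using F_lax_epi_iff A W(1) G0(1) by blast
      moreover have "C.eqv A B (cmp C A W B m0 G0) h"
      proof -
        note tr = D.eqv_trans[OF obA obB]
        note arr = D.cmp_arr[OF obA obW obB]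
        have 1: "D.eqv (fob F A) (fob F B) (farr F A B (cmp C A W B m0 G0)) (?c (farr F W B m0) (farr F A W G0))"
          by (rule F_cmp[OF A W(1) B G0(1) m0(1)])
        have 2: "D.eqv (fob F A) (fob F B) (?c (farr F W B m0) (farr F A W G0)) (?c ?me (farr F A W G0))"
          by (rule D.cmp_left_eqv[OF obA obW obB FG0 Fm0 me D.eqv_sym[OF m0(2)]])
        have 3: "D.eqv (fob F A) (fob F B) (?c ?me (farr F A W G0)) (?c ?me ?eG)"
          by (rule D.cmp_right_eqv[OF obA obW obB FG0 eG me D.eqv_sym[OF G0(2)]])
        have 4: "D.eqv (fob F A) (fob F B) (?c ?me ?eG) (cmp D (fob F A) Y (fob F B) m G)"
          using D.cmp_right_eqv[OF obA Y obB D.cmp_arr[OF obA obW Y eG e(2)] G m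
              D.retraction_cmp[OF W(2) obA Y obW G]] D.cmp_assoc[OF obA obW Y obB eG e(2) m] by simp
        \<comment> \<open>Inserting \<open>Y \<simeq> F W\<close> turns \<open>m \<circ> G\<close> into the image of \<open>m0 \<circ> G0\<close>.\<close>
        have "D.eqv (fob F A) (fob F B) (farr F A B (cmp C A W B m0 G0)) (farr F A B h)"
          using Gm by (intro tr[OF F_arr[OF A B m0G0] _ Fh 1 tr[OF _ _ Fh 2 tr[OF _ _ Fh 3 tr[OF _ mG Fh 4]]]]
              arr FG0 Fm0 eG me) auto
        then show ?thesis using F_eqv_iff[OF A B m0G0 h] by simp
      qed
      ultimately obtain r where r: "C.retraction A W r G0"
        using * W(1) G0(1) m0(1) unfolding C.embedding_def by blast
      then have r': "r \<in> arr C W A" by (simp add: C.retraction_def)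
      note Fr = F_arr[OF W(1) A r']
      have Dr: "D.retraction (fob F A) (fob F W) (farr F W A r) (farr F A W G0)"
        using F_retraction_iff[OF A W(1) r' G0(1)] r by simp
      have "D.eqv (fob F A) (fob F A) (cmp D (fob F A) (fob F W) (fob F A) (farr F W A r) ?eG) (idt D (fob F A))"
        by (rule D.eqv_trans[OF obA obA D.cmp_arr[OF obA obW obA eG Fr] D.cmp_arr[OF obA obW obA FG0 Fr]
              D.idt_arr[OF obA] D.cmp_right_eqv[OF obA obW obA eG FG0 Fr G0(2)]])
          (use Dr in \<open>simp add: D.retraction_def\<close>)
      then have "D.retraction (fob F A) Y (cmp D Y (fob F W) (fob F A) (farr F W A r) e) G"
        using D.cmp_arr[OF Y obW obA e(1) Fr] G D.cmp_assoc[OF obA Y obW obA G e(1) Fr]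
        by (simp add: D.retraction_def)
      then show "\<exists>r. D.retraction (fob F A) Y r G" ..
    qed
  }
qed

lemma F_cospan_le_iff:
  assumes A: "A \<in> ob C" and B: "B \<in> ob C" and X: "X \<in> ob C" "f \<in> arr C A X" "g \<in> arr C B X"
    and Y: "Y \<in> ob C" "u \<in> arr C A Y" "v \<in> arr C B Y"
  shows "D.cospan_le (fob F A) (fob F B) (fob F X, farr F A X f, farr F B X g)
      (fob F Y, farr F A Y u, farr F B Y v) \<longleftrightarrow> C.cospan_le A B (X, f, g) (Y, u, v)"
proof
  assume "C.cospan_le A B (X, f, g) (Y, u, v)"
  then obtain E k h where E: "E \<in> ob C" "k \<in> arr C X E" "C.embedding Y E h"
      and le: "C.le2 A E (cmp C A X E k f) (cmp C A Y E h u)" "C.le2 B E (cmp C B Y E h v) (cmp C B X E k g)"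
    unfolding C.cospan_le_def by auto
  have h: "h \<in> arr C Y E" using E by (simp add: C.embedding_def)
  have "D.embedding (fob F Y) (fob F E) (farr F Y E h)" using F_embedding_iff Y E h by blast
  moreover have "D.le2 (fob F A) (fob F E) (cmp D (fob F A) (fob F X) (fob F E) (farr F X E k) (farr F A X f))
      (cmp D (fob F A) (fob F Y) (fob F E) (farr F Y E h) (farr F A Y u))"
    using F_cmp_le2_iff le A X Y E h by blast
  moreover have "D.le2 (fob F B) (fob F E) (cmp D (fob F B) (fob F Y) (fob F E) (farr F Y E h) (farr F B Y v))
      (cmp D (fob F B) (fob F X) (fob F E) (farr F X E k) (farr F B X g))"
    using F_cmp_le2_iff le B X Y E h by blast
  ultimately show "D.cospan_le (fob F A) (fob F B) (fob F X, farr F A X f, farr F B X g)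
      (fob F Y, farr F A Y u, farr F B Y v)"
    unfolding D.cospan_le_def using F_ob F_arr E X by blast
next
  assume "D.cospan_le (fob F A) (fob F B) (fob F X, farr F A X f, farr F B X g)
      (fob F Y, farr F A Y u, farr F B Y v)"
  then obtain E k h where E: "E \<in> ob D" and k: "k \<in> arr D (fob F X) E" and emb: "D.embedding (fob F Y) E h"
      and le: "D.le2 (fob F A) E (cmp D (fob F A) (fob F X) E k (farr F A X f)) (cmp D (fob F A) (fob F Y) E h (farr F A Y u))"
        "D.le2 (fob F B) E (cmp D (fob F B) (fob F Y) E h (farr F B Y v)) (cmp D (fob F B) (fob F X) E k (farr F B X g))"
    unfolding D.cospan_le_def by auto
  have h: "h \<in> arr D (fob F Y) E" using emb by (simp add: D.embedding_def)
  obtain W e e' where W: "W \<in> ob C" and e: "D.retraction E (fob F W) e' e"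
    and lift: "\<And>X u. X \<in> ob C \<Longrightarrow> u \<in> arr D (fob F X) E \<Longrightarrow> \<exists>u0. lifts E W e X u u0"
    using lifts_exist[OF E] by metis
  have e': "e \<in> arr D E (fob F W)" using e by (simp add: D.retraction_def)
  obtain k0 h0 where k0: "lifts E W e X k k0" and h0: "lifts E W e Y h h0"
    using lift[OF X(1) k] lift[OF Y(1) h] by blast
  have "C.le2 A W (cmp C A X W k0 f) (cmp C A Y W h0 u)"
    using lifts_le2_iff[OF E W e A lifts_cmp[OF E W e' X(1) k0 A X(2)] lifts_cmp[OF E W e' Y(1) h0 A Y(2)]] le by simp
  moreover have "C.le2 B W (cmp C B Y W h0 v) (cmp C B X W k0 g)"
    using lifts_le2_iff[OF E W e B lifts_cmp[OF E W e' Y(1) h0 B Y(3)] lifts_cmp[OF E W e' X(1) k0 B X(3)]] le by simp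
  moreover have "C.embedding Y W h0"
    using D.embedding_cmp_equivalence[OF F_ob[OF Y(1)] E F_ob[OF W] emb e] F_embedding_iff[OF Y(1) W]
      F_arr[OF Y(1) W] h0 unfolding lifts_def by blast
  ultimately show "C.cospan_le A B (X, f, g) (Y, u, v)"
    unfolding C.cospan_le_def using W k0 by (auto simp: lifts_def)
qed

end

context locally_ordered_category
begin

text \<open>
  Reflection of the order by a composite \<open>G \<circ> F\<close>, from its equivalence with the identity.  Here \<open>f'\<close>
  and \<open>g'\<close> are the images of \<open>f\<close> and \<open>g\<close>, while \<open>s\<close> and \<open>t\<close> are components of the equivalence.
\<close>

lemma le2_reflect_unit:
  assumes ob: "X \<in> ob C" "Y \<in> ob C" "X' \<in> ob C" "Y' \<in> ob C"
    and arr: "f \<in> arr C X Y" "g \<in> arr C X Y" "f' \<in> arr C X' Y'" "g' \<in> arr C X' Y'" "t \<in> arr C X X'"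
    and r: "retraction Y Y' r s"
    and f: "eqv X Y' (cmp C X Y Y' s f) (cmp C X X' Y' f' t)"
    and g: "eqv X Y' (cmp C X Y Y' s g) (cmp C X X' Y' g' t)"
    and le: "le2 X' Y' f' g'"
  shows "le2 X Y f g"
proof -
  have s: "s \<in> arr C Y Y'" using r by (simp add: retraction_def)
  have "le2 X Y' (cmp C X X' Y' f' t) (cmp C X X' Y' g' t)"
    using ob arr le by (intro cmp_left_mono)
  then have "le2 X Y' (cmp C X Y Y' s f) (cmp C X Y Y' s g)"
    using le2_cong[OF _ _ _ _ _ _ f g] ob arr s by (simp add: cmp_arr)
  then show ?thesis using retraction_le2_cancel_left[OF r] ob arr by blast
qed

lemma le2_reflect_counit:
  assumes ob: "X \<in> ob C" "Y \<in> ob C" "X' \<in> ob C" "Y' \<in> ob C"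
    and arr: "f \<in> arr C X Y" "g \<in> arr C X Y" "f' \<in> arr C X' Y'" "g' \<in> arr C X' Y'" "t \<in> arr C Y' Y"
    and r: "retraction X X' s r"
    and f: "eqv X' Y (cmp C X' Y' Y t f') (cmp C X' X Y f s)"
    and g: "eqv X' Y (cmp C X' Y' Y t g') (cmp C X' X Y g s)"
    and le: "le2 X' Y' f' g'"
  shows "le2 X Y f g"
proof -
  have s: "s \<in> arr C X' X" using r by (simp add: retraction_def)
  have "le2 X' Y (cmp C X' Y' Y t f') (cmp C X' Y' Y t g')"
    using ob arr le by (intro cmp_right_mono)
  then have "le2 X' Y (cmp C X' X Y f s) (cmp C X' X Y g s)"
    using le2_cong[OF _ _ _ _ _ _ f g] ob arr s by (simp add: cmp_arr)
  then show ?thesis using retraction_le2_cancel_right[OF r] ob arr by blast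
qed

end

lemma pseudofunctorD:
  assumes C: "locally_ordered_category C" and D: "locally_ordered_category D" and F: "pseudofunctor C D F"
  shows "\<And>X. X \<in> ob C \<Longrightarrow> fob F X \<in> ob D"
    and "\<And>X Y f. X \<in> ob C \<Longrightarrow> Y \<in> ob C \<Longrightarrow> f \<in> arr C X Y \<Longrightarrow> farr F X Y f \<in> arr D (fob F X) (fob F Y)"
    and "\<And>X Y f g. X \<in> ob C \<Longrightarrow> Y \<in> ob C \<Longrightarrow> f \<in> arr C X Y \<Longrightarrow> g \<in> arr C X Y \<Longrightarrow>
      f \<sqsubseteq>\<^bsub>hom C X Y\<^esub> g \<Longrightarrow> farr F X Y f \<sqsubseteq>\<^bsub>hom D (fob F X) (fob F Y)\<^esub> farr F X Y g"
    and "\<And>X. X \<in> ob C \<Longrightarrow>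
      locally_ordered_category.eqv D (fob F X) (fob F X) (farr F X X (idt C X)) (idt D (fob F X))"
    and "\<And>X Y Z f g. X \<in> ob C \<Longrightarrow> Y \<in> ob C \<Longrightarrow> Z \<in> ob C \<Longrightarrow> f \<in> arr C X Y \<Longrightarrow> g \<in> arr C Y Z \<Longrightarrow>
      locally_ordered_category.eqv D (fob F X) (fob F Z) (farr F X Z (cmp C X Y Z g f))
            (cmp D (fob F X) (fob F Y) (fob F Z) (farr F Y Z g) (farr F X Y f))"
proof -
  interpret C: locally_ordered_category C by (rule C)
  interpret D: locally_ordered_category D by (rule D)
  show F_ob: "fob F X \<in> ob D" if "X \<in> ob C" for X
    using F that by (simp add: pseudofunctor_def)
  show F_arr: "farr F X Y f \<in> arr D (fob F X) (fob F Y)"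
    if "X \<in> ob C" "Y \<in> ob C" "f \<in> arr C X Y" for X Y f
    using F that by (simp add: pseudofunctor_def)
  show "farr F X Y f \<sqsubseteq>\<^bsub>hom D (fob F X) (fob F Y)\<^esub> farr F X Y g"
    if "X \<in> ob C" "Y \<in> ob C" "f \<in> arr C X Y" "g \<in> arr C X Y" "f \<sqsubseteq>\<^bsub>hom C X Y\<^esub> g" for X Y f g
    using F that by (simp add: pseudofunctor_def)
  show "D.eqv (fob F X) (fob F X) (farr F X X (idt C X)) (idt D (fob F X))" if X: "X \<in> ob C" for X
    using F X D.eq_iff_eqv[OF F_ob[OF X] F_ob[OF X] F_arr[OF X X C.idt_arr[OF X]] D.idt_arr[OF F_ob[OF X]]]
    by (simp add: pseudofunctor_def)
  show "D.eqv (fob F X) (fob F Z) (farr F X Z (cmp C X Y Z g f))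
      (cmp D (fob F X) (fob F Y) (fob F Z) (farr F Y Z g) (farr F X Y f))"
    if *: "X \<in> ob C" "Y \<in> ob C" "Z \<in> ob C" "f \<in> arr C X Y" "g \<in> arr C Y Z" for X Y Z f g
  proof (subst D.eq_iff_eqv[symmetric])
    show "farr F X Z (cmp C X Y Z g f) .=\<^bsub>hom D (fob F X) (fob F Z)\<^esub>
        cmp D (fob F X) (fob F Y) (fob F Z) (farr F Y Z g) (farr F X Y f)"
      using F * unfolding pseudofunctor_def by blast
  qed (use * in \<open>auto intro!: F_ob F_arr C.cmp_arr D.cmp_arr\<close>)
qed

text \<open>
  For fullness, an arrow \<open>h : F X \<rightarrow> F Y\<close> is compared with \<open>f = \<eta>\<^sub>Y\<inverse> \<circ> G h \<circ> \<eta>\<^sub>X\<close>: naturality of \<open>\<eta>\<close> gives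
  \<open>G (F f) \<simeq> G h\<close>, and \<open>G\<close> reflects the order.
\<close>

lemma biequivalent_weak_equivalence:
  fixes C :: "('o, 'm) ocat" and D :: "('p, 'n) ocat"
  assumes C: "locally_ordered_category C" and D: "locally_ordered_category D" and bi: "C \<simeq>\<^sub>b D"
  obtains F where "weak_equivalence C D F"
proof -
  interpret C: locally_ordered_category C by (rule C)
  interpret D: locally_ordered_category D by (rule D)
  obtain F G where F: "pseudofunctor C D F" and G: "pseudofunctor D C G"
    and unit: "pseudonat_equivalent C C fctr_id (fctr_comp G F)"
    and counit: "pseudonat_equivalent D D (fctr_comp F G) fctr_id"
    using bi unfolding biequivalent_def by blast
  note Fs = pseudofunctorD[OF C D F] and Gs = pseudofunctorD[OF D C G]
  let ?F = "fob F" and ?G = "fob G"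
  let ?GF = "\<lambda>X Y f. farr G (?F X) (?F Y) (farr F X Y f)"
    and ?FG = "\<lambda>X Y f. farr F (?G X) (?G Y) (farr G X Y f)"
  obtain \<eta> where \<eta>: "\<And>X. X \<in> ob C \<Longrightarrow> equivalence_arr C X (?G (?F X)) (\<eta> X)"
    and "\<And>X Y f. X \<in> ob C \<Longrightarrow> Y \<in> ob C \<Longrightarrow> f \<in> arr C X Y \<Longrightarrow>
       cmp C X Y (?G (?F Y)) (\<eta> Y) f .=\<^bsub>hom C X (?G (?F Y))\<^esub>
       cmp C X (?G (?F X)) (?G (?F Y)) (?GF X Y f) (\<eta> X)"
    using unit unfolding pseudonat_equivalent_def fctr_id_def fctr_comp_def fctr.simps by blast
  then have \<eta>_nat: "\<And>X Y f. X \<in> ob C \<Longrightarrow> Y \<in> ob C \<Longrightarrow> f \<in> arr C X Y \<Longrightarrow>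
       C.eqv X (?G (?F Y)) (cmp C X Y (?G (?F Y)) (\<eta> Y) f) (cmp C X (?G (?F X)) (?G (?F Y)) (?GF X Y f) (\<eta> X))"
    by (subst C.eq_iff_eqv[symmetric]) (auto intro!: C.cmp_arr Fs Gs simp: equivalence_arr_def)
  obtain \<theta> where \<theta>: "\<And>X. X \<in> ob D \<Longrightarrow> equivalence_arr D (?F (?G X)) X (\<theta> X)"
    and "\<And>X Y f. X \<in> ob D \<Longrightarrow> Y \<in> ob D \<Longrightarrow> f \<in> arr D X Y \<Longrightarrow>
       cmp D (?F (?G X)) (?F (?G Y)) Y (\<theta> Y) (?FG X Y f) .=\<^bsub>hom D (?F (?G X)) Y\<^esub>
       cmp D (?F (?G X)) X Y f (\<theta> X)"
    using counit unfolding pseudonat_equivalent_def fctr_id_def fctr_comp_def fctr.simps by blast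
  then have \<theta>_nat: "\<And>X Y f. X \<in> ob D \<Longrightarrow> Y \<in> ob D \<Longrightarrow> f \<in> arr D X Y \<Longrightarrow>
       D.eqv (?F (?G X)) Y (cmp D (?F (?G X)) (?F (?G Y)) Y (\<theta> Y) (?FG X Y f)) (cmp D (?F (?G X)) X Y f (\<theta> X))"
    by (subst D.eq_iff_eqv[symmetric]) (auto intro!: D.cmp_arr Fs Gs simp: equivalence_arr_def)
  have \<eta>_inv: "\<exists>r. C.retraction X (?G (?F X)) r (\<eta> X) \<and> C.retraction (?G (?F X)) X (\<eta> X) r" if "X \<in> ob C" for X
    using \<eta> that C.equivalence_arr_iff Fs(1) Gs(1) by blast
  have \<theta>_inv: "\<exists>r. D.retraction (?F (?G X)) X r (\<theta> X) \<and> D.retraction X (?F (?G X)) (\<theta> X) r" if "X \<in> ob D" for X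
    using \<theta> that D.equivalence_arr_iff Fs(1) Gs(1) by blast
  have \<eta>_arr: "\<eta> X \<in> arr C X (?G (?F X))" if "X \<in> ob C" for X
    using \<eta>[OF that] by (simp add: equivalence_arr_def)
  have \<theta>_arr: "\<theta> X \<in> arr D (?F (?G X)) X" if "X \<in> ob D" for X
    using \<theta>[OF that] by (simp add: equivalence_arr_def)
  have GF_reflect: "C.le2 X Y f g"
    if *: "X \<in> ob C" "Y \<in> ob C" "f \<in> arr C X Y" "g \<in> arr C X Y"
      "C.le2 (?G (?F X)) (?G (?F Y)) (?GF X Y f) (?GF X Y g)" for X Y f g
  proof -
    obtain r where r: "C.retraction Y (?G (?F Y)) r (\<eta> Y)" using \<eta>_inv[OF *(2)] by blast
    show ?thesis
      by (rule C.le2_reflect_unit[OF *(1,2) _ _ *(3,4) _ _ \<eta>_arr[OF *(1)] r \<eta>_nat[OF *(1-3)] \<eta>_nat[OF *(1,2,4)] *(5)])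
        (simp_all add: * Fs(1,2) Gs(1,2))
  qed
  have FG_reflect: "D.le2 X Y f g"
    if *: "X \<in> ob D" "Y \<in> ob D" "f \<in> arr D X Y" "g \<in> arr D X Y"
      "D.le2 (?F (?G X)) (?F (?G Y)) (?FG X Y f) (?FG X Y g)" for X Y f g
  proof -
    obtain r where r: "D.retraction X (?F (?G X)) (\<theta> X) r" using \<theta>_inv[OF *(1)] by blast
    show ?thesis
      by (rule D.le2_reflect_counit[OF *(1,2) _ _ *(3,4) _ _ \<theta>_arr[OF *(2)] r \<theta>_nat[OF *(1-3)] \<theta>_nat[OF *(1,2,4)] *(5)])
        (simp_all add: * Fs(1,2) Gs(1,2))
  qed
  have G_reflect: "D.le2 X Y f g"
    if *: "X \<in> ob D" "Y \<in> ob D" "f \<in> arr D X Y" "g \<in> arr D X Y"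
      "C.le2 (?G X) (?G Y) (farr G X Y f) (farr G X Y g)" for X Y f g
    by (rule FG_reflect[OF *(1-4)] Fs(3)[OF _ _ _ _ *(5)])+ (simp_all add: * Gs(1,2))
  have F_le: "D.le2 (?F X) (?F Y) (farr F X Y f) (farr F X Y g) \<longleftrightarrow> C.le2 X Y f g"
    if *: "X \<in> ob C" "Y \<in> ob C" "f \<in> arr C X Y" "g \<in> arr C X Y" for X Y f g
  proof
    assume "D.le2 (?F X) (?F Y) (farr F X Y f) (farr F X Y g)"
    then have "C.le2 (?G (?F X)) (?G (?F Y)) (?GF X Y f) (?GF X Y g)"
      using Gs(3)[of "?F X" "?F Y"] by (simp add: * Fs(1,2))
    then show "C.le2 X Y f g" using GF_reflect * by blast
  qed (use Fs(3) * in blast)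
  have full: "\<exists>f\<in>arr C X Y. D.eqv (?F X) (?F Y) h (farr F X Y f)"
    if X: "X \<in> ob C" and Y: "Y \<in> ob C" and h: "h \<in> arr D (?F X) (?F Y)" for X Y h
  proof -
    let ?X' = "?G (?F X)" and ?Y' = "?G (?F Y)"
    obtain r where r: "C.retraction Y ?Y' r (\<eta> Y)" "C.retraction ?Y' Y (\<eta> Y) r" using \<eta>_inv[OF Y] by blast
    then have r_arr: "r \<in> arr C ?Y' Y" by (simp add: C.retraction_def)
    obtain rX where rX: "C.retraction ?X' X (\<eta> X) rX" using \<eta>_inv[OF X] by blast
    have ob: "?X' \<in> ob C" "?Y' \<in> ob C" "?F X \<in> ob D" "?F Y \<in> ob D" using X Y Fs(1) Gs(1) by auto
    have Gh: "farr G (?F X) (?F Y) h \<in> arr C ?X' ?Y'" using Gs(2) ob h by blast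
    have Gh\<eta>: "cmp C X ?X' ?Y' (farr G (?F X) (?F Y) h) (\<eta> X) \<in> arr C X ?Y'"
      using X ob Gh \<eta>_arr by (intro C.cmp_arr)
    define f where "f = cmp C X ?Y' Y r (cmp C X ?X' ?Y' (farr G (?F X) (?F Y) h) (\<eta> X))"
    have f: "f \<in> arr C X Y" unfolding f_def by (rule C.cmp_arr[OF X ob(2) Y Gh\<eta> r_arr])
    have GFf: "?GF X Y f \<in> arr C ?X' ?Y'" by (simp add: Fs(1,2) Gs(2) X Y f)
    have "C.eqv X ?Y' (cmp C X Y ?Y' (\<eta> Y) f) (cmp C X ?X' ?Y' (farr G (?F X) (?F Y) h) (\<eta> X))"
      unfolding f_def using C.retraction_cmp[OF r(2) X] ob Y Gh\<eta> by blast
    then have "C.eqv X ?Y' (cmp C X ?X' ?Y' (?GF X Y f) (\<eta> X))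
        (cmp C X ?X' ?Y' (farr G (?F X) (?F Y) h) (\<eta> X))"
      using C.eqv_trans[OF _ _ _ _ _ C.eqv_sym[OF \<eta>_nat[OF X Y f]]] X Y ob \<eta>_arr f GFf Gh\<eta>
      by (simp add: C.cmp_arr)
    then have "C.le2 ?X' ?Y' (?GF X Y f) (farr G (?F X) (?F Y) h)"
      "C.le2 ?X' ?Y' (farr G (?F X) (?F Y) h) (?GF X Y f)"
      using C.retraction_le2_cancel_right[OF rX ob(2,1) X] GFf Gh unfolding C.eqv_def by blast+
    then have "D.eqv (?F X) (?F Y) h (farr F X Y f)"
      unfolding D.eqv_def using G_reflect[OF ob(3,4)] h Fs(2)[OF X Y f] by blast
    then show ?thesis using f by blast
  qed
  have "weak_equivalence C D F"
  proof
    show "\<exists>X\<in>ob C. \<exists>e e'. D.retraction B (?F X) e' e \<and> D.retraction (?F X) B e e'" if B: "B \<in> ob D" for B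
      using \<theta>_inv[OF B] Gs(1)[OF B] by blast
  qed (use Fs F_le full in auto)
  then show ?thesis using that by blast
qed

section \<open>Scalars\<close>

text \<open>
  A locally ordered category on which a commutative quantale acts by central endomorphisms.  The
  examples are distributors and modules.
\<close>

locale scalar_category = locally_ordered_category C
  for C :: "('o, 'm) ocat" +
  fixes sc :: "'q::comm_quantale \<Rightarrow> 'o \<Rightarrow> 'm"
  assumes arr_antisym: "\<lbrakk>X \<in> ob C; Y \<in> ob C; f \<in> arr C X Y; g \<in> arr C X Y; eqv X Y f g\<rbrakk> \<Longrightarrow> f = g"
    and sc_arr: "A \<in> ob C \<Longrightarrow> sc q A \<in> arr C A A"
    and sc_mono: "\<lbrakk>A \<in> ob C; p \<le> q\<rbrakk> \<Longrightarrow> le2 A A (sc p A) (sc q A)"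
    and sc_mult: "A \<in> ob C \<Longrightarrow> sc (p * q) A = cmp C A A A (sc p A) (sc q A)"
    and sc_natural: "\<lbrakk>A \<in> ob C; B \<in> ob C; f \<in> arr C A B\<rbrakk>
      \<Longrightarrow> cmp C A B B (sc q B) f = cmp C A A B f (sc q A)"
begin

text \<open>
  The object \<open>A0\<close> behaves like the regular module: a scalar is determined by its action on \<open>A0\<close>, and a
  family of endomorphisms that commutes with all arrows out of \<open>A0\<close> is the action of a scalar,
  which depends on the component \<open>z\<close> at \<open>A0\<close> only.
\<close>

definition detects_scalars :: "'o \<Rightarrow> bool" where
  "detects_scalars A0 \<longleftrightarrow> A0 \<in> ob C \<and>
     (\<forall>p q. le2 A0 A0 (sc p A0) (sc q A0) \<longrightarrow> p \<le> q) \<and>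
     (\<forall>z\<in>arr C A0 A0. \<exists>q. \<forall>A\<in>ob C. \<forall>z'\<in>arr C A A.
        (\<forall>f\<in>arr C A0 A. cmp C A0 A A z' f = cmp C A0 A0 A f z) \<longrightarrow> z' = sc q A)"

end

text \<open>
  Such a bijection also preserves the unit and suprema, see \<open>quantale_iso_one\<close> and
  \<open>quantale_iso_Sup\<close>.
\<close>

definition quantale_iso :: "('q::quantale \<Rightarrow> 'r::quantale) \<Rightarrow> bool" where
  "quantale_iso \<phi> \<longleftrightarrow> bij \<phi> \<and> (\<forall>a b. \<phi> (a * b) = \<phi> a * \<phi> b) \<and> (\<forall>a b. \<phi> a \<le> \<phi> b \<longleftrightarrow> a \<le> b)"

locale scalar_equivalence =
  C: scalar_category C s + D: scalar_category D t
  for C :: "('o, 'm) ocat" and s :: "'q::comm_quantale \<Rightarrow> 'o \<Rightarrow> 'm"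
    and D :: "('p, 'n) ocat" and t :: "'r::comm_quantale \<Rightarrow> 'p \<Rightarrow> 'n" +
  fixes Fo :: "'o \<Rightarrow> 'p" and Fa :: "'o \<Rightarrow> 'o \<Rightarrow> 'm \<Rightarrow> 'n"
  assumes Fo: "X \<in> ob C \<Longrightarrow> Fo X \<in> ob D"
    and Fa: "\<lbrakk>X \<in> ob C; Y \<in> ob C; f \<in> arr C X Y\<rbrakk> \<Longrightarrow> Fa X Y f \<in> arr D (Fo X) (Fo Y)"
    and Fa_le: "\<lbrakk>X \<in> ob C; Y \<in> ob C; f \<in> arr C X Y; g \<in> arr C X Y\<rbrakk>
      \<Longrightarrow> D.le2 (Fo X) (Fo Y) (Fa X Y f) (Fa X Y g) \<longleftrightarrow> C.le2 X Y f g"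
    and Fa_cmp: "\<lbrakk>X \<in> ob C; Y \<in> ob C; Z \<in> ob C; f \<in> arr C X Y; g \<in> arr C Y Z\<rbrakk>
      \<Longrightarrow> Fa X Z (cmp C X Y Z g f) = cmp D (Fo X) (Fo Y) (Fo Z) (Fa Y Z g) (Fa X Y f)"
    and Fa_full: "\<lbrakk>X \<in> ob C; Y \<in> ob C; h \<in> arr D (Fo X) (Fo Y)\<rbrakk> \<Longrightarrow> \<exists>f\<in>arr C X Y. h = Fa X Y f"
begin

lemma Fa_inj:
  assumes "X \<in> ob C" "Y \<in> ob C" "f \<in> arr C X Y" "g \<in> arr C X Y" "Fa X Y f = Fa X Y g"
  shows "f = g"
  using assms Fa_le[of X Y f g] Fa_le[of X Y g f] D.le2_refl[OF Fo Fo Fa]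
  by (intro C.arr_antisym[of X Y]) (auto simp: C.eqv_def)

definition matches :: "'q \<Rightarrow> 'r \<Rightarrow> bool" where
  "matches q r \<longleftrightarrow> (\<forall>A\<in>ob C. Fa A A (s q A) = t r (Fo A))"

lemma matches_left_total:
  assumes A1: "A1 \<in> ob C" and det: "D.detects_scalars (Fo A1)"
  shows "\<exists>r. matches q r"
proof -
  obtain r where r: "\<And>A z'. A \<in> ob D \<Longrightarrow> z' \<in> arr D A A \<Longrightarrow>
      (\<forall>f\<in>arr D (Fo A1) A. cmp D (Fo A1) A A z' f = cmp D (Fo A1) (Fo A1) A f (Fa A1 A1 (s q A1))) \<Longrightarrow> z' = t r A"
    using det Fa[OF A1 A1 C.sc_arr[OF A1]] unfolding D.detects_scalars_def by meson
  have "Fa A A (s q A) = t r (Fo A)" if A: "A \<in> ob C" for A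
  proof (rule r[OF Fo[OF A] Fa[OF A A C.sc_arr[OF A]]], intro ballI)
    fix h assume "h \<in> arr D (Fo A1) (Fo A)"
    then obtain f where f: "f \<in> arr C A1 A" "h = Fa A1 A f" using Fa_full A A1 by blast
    have "cmp D (Fo A1) (Fo A) (Fo A) (Fa A A (s q A)) h = Fa A1 A (cmp C A1 A A (s q A) f)"
      using Fa_cmp A A1 f C.sc_arr by simp
    also have "\<dots> = cmp D (Fo A1) (Fo A1) (Fo A) h (Fa A1 A1 (s q A1))"
      using Fa_cmp A A1 f C.sc_arr C.sc_natural by simp
    finally show "cmp D (Fo A1) (Fo A) (Fo A) (Fa A A (s q A)) h =
      cmp D (Fo A1) (Fo A1) (Fo A) h (Fa A1 A1 (s q A1))" .
  qed
  then show ?thesis unfolding matches_def by blast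
qed

lemma matches_right_total:
  assumes det: "C.detects_scalars A0"
  shows "\<exists>q. matches q r"
proof -
  have A0: "A0 \<in> ob C" using det by (simp add: C.detects_scalars_def)
  have "\<exists>z. A \<in> ob C \<longrightarrow> z \<in> arr C A A \<and> t r (Fo A) = Fa A A z" for A
    using Fa_full[of A A] D.sc_arr[OF Fo[of A]] by blast
  then obtain z where z: "\<And>A. A \<in> ob C \<Longrightarrow> z A \<in> arr C A A" "\<And>A. A \<in> ob C \<Longrightarrow> t r (Fo A) = Fa A A (z A)"
    by metis
  obtain q where q: "\<And>A z'. A \<in> ob C \<Longrightarrow> z' \<in> arr C A A \<Longrightarrow>
      (\<forall>f\<in>arr C A0 A. cmp C A0 A A z' f = cmp C A0 A0 A f (z A0)) \<Longrightarrow> z' = s q A"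
    using det z(1)[OF A0] unfolding C.detects_scalars_def by meson
  have "z A = s q A" if A: "A \<in> ob C" for A
  proof (rule q[OF A z(1)[OF A]], intro ballI)
    fix f assume f: "f \<in> arr C A0 A"
    have "Fa A0 A (cmp C A0 A A (z A) f) = Fa A0 A (cmp C A0 A0 A f (z A0))"
      using Fa_cmp A A0 f z D.sc_natural[OF Fo[OF A0] Fo[OF A] Fa[OF A0 A f], of r] by simp
    then show "cmp C A0 A A (z A) f = cmp C A0 A0 A f (z A0)"
      by (intro Fa_inj[OF A0 A] C.cmp_arr A A0 f z)
  qed
  then show ?thesis unfolding matches_def using z(2) by metis
qed

text \<open>
  Both \<open>s q\<close> and \<open>t r\<close> are recognised as central families of endomorphisms, and \<open>F\<close> is a bijection
  between the arrows \<open>A \<rightarrow> A\<close> and \<open>F A \<rightarrow> F A\<close>.  Hence each \<open>q\<close> matches exactly one \<open>r\<close> and conversely.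
\<close>

theorem scalars_iso:
  assumes A0: "C.detects_scalars A0" and A1: "A1 \<in> ob C" "D.detects_scalars (Fo A1)"
  shows "\<exists>\<phi> :: 'q \<Rightarrow> 'r. quantale_iso \<phi>"
proof -
  have A0': "A0 \<in> ob C" using A0 by (simp add: C.detects_scalars_def)
  have le: "q \<le> q' \<longleftrightarrow> r \<le> r'" if m: "matches q r" "matches q' r'" for q q' r r'
  proof
    assume "q \<le> q'"
    then have "C.le2 A1 A1 (s q A1) (s q' A1)" by (intro C.sc_mono A1)
    then have "D.le2 (Fo A1) (Fo A1) (t r (Fo A1)) (t r' (Fo A1))"
      using Fa_le[OF A1(1) A1(1)] m A1 C.sc_arr unfolding matches_def by metis
    then show "r \<le> r'" using A1 unfolding D.detects_scalars_def by blast
  next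
    assume "r \<le> r'"
    then have "D.le2 (Fo A0) (Fo A0) (t r (Fo A0)) (t r' (Fo A0))" by (intro D.sc_mono Fo A0')
    then have "C.le2 A0 A0 (s q A0) (s q' A0)"
      using Fa_le[OF A0' A0'] m A0' C.sc_arr unfolding matches_def by metis
    then show "q \<le> q'" using A0 unfolding C.detects_scalars_def by blast
  qed
  have mult: "matches (q * q') (r * r')" if "matches q r" "matches q' r'" for q q' r r'
    using that unfolding matches_def by (simp add: C.sc_mult D.sc_mult Fa_cmp C.sc_arr Fo)
  obtain \<phi> where \<phi>: "\<And>q. matches q (\<phi> q)" using matches_left_total[OF A1] by metis
  obtain \<psi> where \<psi>: "\<And>r. matches (\<psi> r) r" using matches_right_total[OF A0] by metis
  have unique: "matches q r \<Longrightarrow> matches q' r' \<Longrightarrow> q = q' \<longleftrightarrow> r = r'" for q q' r r'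
    using le by (metis order_antisym order_refl)
  have "bij \<phi>"
    using unique[OF \<phi> \<phi>] unique[OF \<phi> \<psi>] unfolding bij_def inj_def surj_def by metis
  moreover have "\<phi> (a * b) = \<phi> a * \<phi> b" for a b
    using unique[OF \<phi>[of "a * b"] mult[OF \<phi>[of a] \<phi>[of b]]] by simp
  ultimately show ?thesis unfolding quantale_iso_def using le[OF \<phi> \<phi>] by blast
qed

end

section \<open>Isomorphisms of quantales\<close>

lemma quantale_iso_inv:
  assumes "quantale_iso \<phi>" shows "quantale_iso (inv \<phi>)"
proof -
  have b: "bij \<phi>" and m: "\<And>a b. \<phi> (a * b) = \<phi> a * \<phi> b" and l: "\<And>a b. \<phi> a \<le> \<phi> b \<longleftrightarrow> a \<le> b"
    using assms by (auto simp: quantale_iso_def)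
  have i: "\<phi> (inv \<phi> x) = x" "inv \<phi> (\<phi> y) = y" for x y
    using b by (simp_all add: bij_is_surj surj_f_inv_f bij_is_inj)
  have "inv \<phi> (a * b) = inv \<phi> a * inv \<phi> b" for a b by (metis i m)
  moreover have "inv \<phi> a \<le> inv \<phi> b \<longleftrightarrow> a \<le> b" for a b by (metis i l)
  ultimately show ?thesis using bij_imp_bij_inv[OF b] by (simp add: quantale_iso_def)
qed

lemma quantale_iso_one:
  assumes "quantale_iso \<phi>" shows "\<phi> 1 = 1"
proof -
  have "\<phi> 1 * \<phi> (inv \<phi> 1) = \<phi> (inv \<phi> 1)" using assms by (metis quantale_iso_def mult_1_left)
  then show ?thesis using assms by (simp add: quantale_iso_def bij_is_surj surj_f_inv_f)
qed

lemma quantale_iso_Sup: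
  assumes "quantale_iso \<phi>" shows "\<phi> (Sup A) = Sup (\<phi> ` A)"
proof (rule antisym)
  have i: "\<phi> (inv \<phi> x) = x" for x
    using assms by (simp add: quantale_iso_def bij_is_surj surj_f_inv_f)
  have l: "\<phi> a \<le> \<phi> b \<longleftrightarrow> a \<le> b" for a b using assms by (simp add: quantale_iso_def)
  have "Sup A \<le> inv \<phi> (Sup (\<phi> ` A))"
    by (rule Sup_least) (metis SUP_upper i l)
  then show "\<phi> (Sup A) \<le> Sup (\<phi> ` A)" by (metis i l)
  show "Sup (\<phi> ` A) \<le> \<phi> (Sup A)" by (rule SUP_least) (simp add: l Sup_upper)
qed

lemma one_object_simps [simp]:
  "ob (one_object_quantaloid T) = UNIV"
  "hom (one_object_quantaloid T) X Y = \<lparr>carrier = UNIV, eq = (=), le = (\<le>)\<rparr>"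
  "idt (one_object_quantaloid T) X = 1"
  "cmp (one_object_quantaloid T) X Y Z b a = b * a"
  by (simp_all add: one_object_quantaloid_def)

lemma sup_UNIV_order: "\<Squnion>\<^bsub>\<lparr>carrier = UNIV, eq = (=), le = (\<le>)\<rparr>\<^esub> A = Sup (A :: 'q::quantale set)"
  by (rule complete_lattice_suborder) auto

lemma one_object_quantaloid_hom_iff:
  fixes F :: "(unit, 'q::quantale, unit, 'r::quantale) fctr"
  shows "quantaloid_hom (one_object_quantaloid TYPE('q)) (one_object_quantaloid TYPE('r)) F \<longleftrightarrow>
    farr F () () 1 = 1 \<and> (\<forall>A. farr F () () (Sup A) = Sup (farr F () () ` A)) \<and>
    (\<forall>a b. farr F () () (b * a) = farr F () () b * farr F () () a)"
  by (auto simp: quantaloid_hom_def sup_preserving_def sup_UNIV_order)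

text \<open>
  A natural isomorphism is an invertible element \<open>u\<close> of the quantale with \<open>u * F x = G x * u\<close>, and
  \<open>u\<close> cancels by commutativity.
\<close>

lemma isomorphic_one_object_endo:
  fixes F :: "(unit, 'q::comm_quantale, unit, 'q) fctr"
  assumes "isomorphic (hom_quantaloid (one_object_quantaloid TYPE('q)) (one_object_quantaloid TYPE('q))) F G"
  shows "farr F () () x = farr G () () x"
proof -
  obtain u v where nat: "\<And>x. u * farr F () () x = farr G () () x * u"
    and inv: "v * u = 1" "u * v = (1::'q)"
    using assms unfolding isomorphic_def hom_quantaloid_def 
    by (auto simp: fun_eq_iff)
  have "farr F () () x = v * (u * farr F () () x)" using inv by (simp add: mult.assoc[symmetric])
  also have "\<dots> = farr G () () x * (u * v)" unfolding nat by (simp add: mult.commute mult.left_commute mult.assoc)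
  finally show ?thesis by (simp add: inv)
qed

lemma one_object_equivalent_iff:
  "one_object_quantaloid TYPE('q::comm_quantale) \<simeq>\<^sub>q one_object_quantaloid TYPE('r::comm_quantale)
    \<longleftrightarrow> (\<exists>\<phi> :: 'q \<Rightarrow> 'r. quantale_iso \<phi>)"
proof
  assume "one_object_quantaloid TYPE('q) \<simeq>\<^sub>q one_object_quantaloid TYPE('r)"
  then obtain F :: "(unit, 'q, unit, 'r) fctr" and G where
    F: "quantaloid_hom (one_object_quantaloid TYPE('q)) (one_object_quantaloid TYPE('r)) F"
    and G: "quantaloid_hom (one_object_quantaloid TYPE('r)) (one_object_quantaloid TYPE('q)) G"
    and iso: "isomorphic (hom_quantaloid (one_object_quantaloid TYPE('q)) (one_object_quantaloid TYPE('q))) fctr_id (fctr_comp G F)"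
     "isomorphic (hom_quantaloid (one_object_quantaloid TYPE('r)) (one_object_quantaloid TYPE('r))) (fctr_comp F G) fctr_id"
    unfolding quantaloid_equivalent_def by blast
  define \<phi> \<gamma> where "\<phi> = farr F () ()" and "\<gamma> = farr G () ()"
  have i: "\<gamma> (\<phi> x) = x" "\<phi> (\<gamma> y) = y" for x y
    using isomorphic_one_object_endo[OF iso(1), of x] isomorphic_one_object_endo[OF iso(2), of y]
    by (simp_all add: \<phi>_def \<gamma>_def fctr_id_def fctr_comp_def)
  have mono: "a \<le> b \<Longrightarrow> \<phi> a \<le> \<phi> b" "c \<le> d \<Longrightarrow> \<gamma> c \<le> \<gamma> d" for a b c d
  proof -
    have *: "\<phi> (Sup {a, b}) = Sup (\<phi> ` {a, b})" "\<gamma> (Sup {c, d}) = Sup (\<gamma> ` {c, d})"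
      using F G unfolding one_object_quantaloid_hom_iff \<phi>_def \<gamma>_def by blast+
    show "a \<le> b \<Longrightarrow> \<phi> a \<le> \<phi> b" using *(1) by (simp add: Lattices.sup_absorb2) (metis Lattices.sup_ge1)
    show "c \<le> d \<Longrightarrow> \<gamma> c \<le> \<gamma> d" using *(2) by (simp add: Lattices.sup_absorb2) (metis Lattices.sup_ge1)
  qed
  have "bij \<phi>" using i by (metis bijI')
  then have "quantale_iso \<phi>"
    using F mono i unfolding quantale_iso_def one_object_quantaloid_hom_iff \<phi>_def[symmetric] by metis
  then show "\<exists>\<phi> :: 'q \<Rightarrow> 'r. quantale_iso \<phi>" by blast
next
  assume "\<exists>\<phi> :: 'q \<Rightarrow> 'r. quantale_iso \<phi>"
  then obtain \<phi> :: "'q \<Rightarrow> 'r" where \<phi>: "quantale_iso \<phi>" ..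
  define F :: "(unit, 'q, unit, 'r) fctr" where "F = \<lparr>fob = id, farr = (\<lambda>_ _. \<phi>)\<rparr>"
  define G :: "(unit, 'r, unit, 'q) fctr" where "G = \<lparr>fob = id, farr = (\<lambda>_ _. inv \<phi>)\<rparr>"
  have i: "inv \<phi> (\<phi> x) = x" "\<phi> (inv \<phi> y) = y" for x y
    using \<phi> by (simp_all add: quantale_iso_def bij_is_surj surj_f_inv_f bij_is_inj)
  have hom: "quantaloid_hom (one_object_quantaloid TYPE('q)) (one_object_quantaloid TYPE('r)) F"
    "quantaloid_hom (one_object_quantaloid TYPE('r)) (one_object_quantaloid TYPE('q)) G"
    using \<phi> quantale_iso_inv[OF \<phi>] quantale_iso_one quantale_iso_Sup
    by (auto simp: one_object_quantaloid_hom_iff F_def G_def quantale_iso_def)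
  have comp: "fctr_comp G F = fctr_id" "fctr_comp F G = fctr_id"
    by (auto simp: fctr_comp_def fctr_id_def F_def G_def i)
  have "isomorphic (hom_quantaloid (one_object_quantaloid T) (one_object_quantaloid T)) fctr_id fctr_id"
    for T :: "'x::quantale itself"
    unfolding isomorphic_def hom_quantaloid_def
    by (auto intro!: exI[of _ "\<lambda>_. 1"])
  then show "one_object_quantaloid TYPE('q) \<simeq>\<^sub>q one_object_quantaloid TYPE('r)"
    unfolding quantaloid_equivalent_def using hom comp by metis
qed

section \<open>The locally ordered category \<open>Ord(Q)\<close>\<close>

lemma Idm_simps [simp]:
  "ob (Idm TYPE('q::quantale)) = {e. e * e = e}"
  "carrier (hom (Idm TYPE('q)) e f) = {b. b * e = b \<and> f * b = b}"
  "le (hom (Idm TYPE('q)) e f) = (\<le>)"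
  "eq (hom (Idm TYPE('q)) e f) = (=)"
  "idt (Idm TYPE('q)) e = e"
  "cmp (Idm TYPE('q)) e f g b a = b * a"
  by (simp_all add: Idm_def)

lemma Idm_sup:
  fixes e f :: "'q::quantale"
  assumes "A \<subseteq> {b. b * e = b \<and> f * b = b}"
  shows "\<Squnion>\<^bsub>hom (Idm TYPE('q)) e f\<^esub> A = Sup A"
  unfolding Idm_def ocat.simps
proof (rule complete_lattice_suborder(2)[OF _ assms])
  show "Sup A \<in> {b. b * e = b \<and> f * b = b}" if "A \<subseteq> {b. b * e = b \<and> f * b = b}" for A
    using that by (auto simp: Sup_mult_distrib mult_Sup_distrib subset_iff cong: image_cong)
qed

lemma enriched_category_Idm_iff:
  "enriched_category small (Idm TYPE('q::quantale)) A \<longleftrightarrow> small (elts A) \<and> idem_category A"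
  unfolding enriched_category_def idem_category_def by auto

lemma functor_Idm_iff:
  "enriched_functor (Idm TYPE('q::quantale)) A B F \<longleftrightarrow> F \<in> extensional (elts A) \<and>
     (\<forall>a\<in>elts A. F a \<in> elts B \<and> ty B (F a) = ty A a) \<and>
     (\<forall>a\<in>elts A. \<forall>b\<in>elts A. ehom A b a \<le> ehom B (F b) (F a))"
  unfolding enriched_functor_def PiE_def by auto

lemma functor_le_Idm_iff:
  "functor_le (Idm TYPE('q::quantale)) A B F G \<longleftrightarrow> (\<forall>a\<in>elts A. ty A a \<le> ehom B (F a) (G a))"
  by (simp add: functor_le_def)

lemma distributor_Idm_iff:
  "distributor (Idm TYPE('q::quantale)) A B \<Phi> \<longleftrightarrow>
     (\<forall>a\<in>elts A. \<forall>b\<in>elts B. \<Phi> b a * ty A a = \<Phi> b a \<and> ty B b * \<Phi> b a = \<Phi> b a) \<and>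
     (\<forall>a\<in>elts A. \<forall>b\<in>elts B. \<forall>c\<in>elts B. ehom B b c * \<Phi> c a \<le> \<Phi> b a) \<and>
     (\<forall>a\<in>elts A. \<forall>c\<in>elts A. \<forall>b\<in>elts B. \<Phi> b c * ehom A c a \<le> \<Phi> b a)"
  by (simp add: distributor_def)

lemma distributor_comp_Idm:
  assumes "distributor (Idm TYPE('q::quantale)) A B \<Phi>" "distributor (Idm TYPE('q)) B C \<Psi>"
    and "a \<in> elts A" "c \<in> elts C"
  shows "distributor_comp (Idm TYPE('q)) A B C \<Psi> \<Phi> c a = (SUP b\<in>elts B. \<Psi> c b * \<Phi> b a)"
  unfolding distributor_comp_def Idm_simps
proof (rule Idm_sup)
  show "(\<lambda>b. \<Psi> c b * \<Phi> b a) ` elts B \<subseteq> {b. b * ty A a = b \<and> ty C c * b = b}"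
    using assms by (auto simp: distributor_Idm_iff mult.assoc) (simp add: mult.assoc[symmetric])
qed

lemma (in universe) Cauchy_complete_Idm_iff:
  fixes C :: "('u, 'q::quantale, 'q) ecat"
  assumes C: "idem_category C"
  shows "Cauchy_complete small (Idm TYPE('q)) C \<longleftrightarrow> cauchy C"
proof
  interpret C: idem_category C by (rule C)
  assume *: "Cauchy_complete small (Idm TYPE('q)) C"
  show "cauchy C"
    unfolding cauchy_def
  proof (intro allI impI)
    fix e \<phi> \<psi> assume adj: "adjoint_presheaf C e \<phi> \<psi>"
    \<comment> \<open>The one-element category on the idempotent \<open>e\<close>.\<close>
    define A :: "('u, 'q, 'q) ecat" where "A = \<lparr>elts = {undefined}, ty = (\<lambda>_. e), ehom = (\<lambda>_ _. e)\<rparr>"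
    have A: "enriched_category small (Idm TYPE('q)) A"
      using adj by (auto simp: enriched_category_Idm_iff A_def small_singleton idem_category_def
          adjoint_presheaf_def presheaf_def)
    have d: "distributor (Idm TYPE('q)) A C (\<lambda>c _. \<phi> c)" "distributor (Idm TYPE('q)) C A (\<lambda>_. \<psi>)"
      using adj unfolding distributor_Idm_iff adjoint_presheaf_def presheaf_def copresheaf_def
      by (auto simp: A_def)
    have "left_adjoint_distributor (Idm TYPE('q)) A C (\<lambda>c _. \<phi> c)"
      unfolding left_adjoint_distributor_def
    proof (intro conjI exI[of _ "\<lambda>_. \<psi>"] d)
      show "distributor_le (Idm TYPE('q)) A A (ehom A)
         (distributor_comp (Idm TYPE('q)) A C A (\<lambda>_. \<psi>) (\<lambda>c _. \<phi> c))"
        using adj by (auto simp: distributor_le_def distributor_comp_Idm[OF d] adjoint_presheaf_def) (simp add: A_def)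
      show "distributor_le (Idm TYPE('q)) C C
         (distributor_comp (Idm TYPE('q)) C A C (\<lambda>c _. \<phi> c) (\<lambda>_. \<psi>)) (ehom C)"
        using adj by (auto simp: distributor_le_def distributor_comp_Idm[OF d(2,1)] adjoint_presheaf_def) (simp add: A_def)
    qed
    then obtain F where F: "enriched_functor (Idm TYPE('q)) A C F" "\<forall>a\<in>elts A. \<forall>c\<in>elts C. \<phi> c = ehom C c (F a)"
      using * A unfolding Cauchy_complete_def by blast
    then show "\<exists>c\<in>elts C. ty C c = e \<and> (\<forall>x\<in>elts C. \<phi> x = ehom C x c)"
      by (intro bexI[of _ "F undefined"]) (auto simp: functor_Idm_iff A_def)
  qed
next
  interpret C: idem_category C by (rule C)
  assume *: "cauchy C"
  show "Cauchy_complete small (Idm TYPE('q)) C"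
    unfolding Cauchy_complete_def
  proof (intro allI impI)
    fix A :: "('u, 'q, 'q) ecat" and \<Phi> 
    assume "enriched_category small (Idm TYPE('q)) A \<and> left_adjoint_distributor (Idm TYPE('q)) A C \<Phi>"
    then obtain \<Psi> where A: "idem_category A"
      and d: "distributor (Idm TYPE('q)) A C \<Phi>" "distributor (Idm TYPE('q)) C A \<Psi>"
      and le: "distributor_le (Idm TYPE('q)) A A (ehom A) (distributor_comp (Idm TYPE('q)) A C A \<Psi> \<Phi>)"
        "distributor_le (Idm TYPE('q)) C C (distributor_comp (Idm TYPE('q)) C A C \<Phi> \<Psi>) (ehom C)"
      by (auto simp: enriched_category_Idm_iff left_adjoint_distributor_def)
    interpret A: idem_category A by (rule A)
    have "adjoint_presheaf C (ty A a) (\<lambda>c. \<Phi> c a) (\<lambda>c. \<Psi> a c)" if a: "a \<in> elts A" for a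
    proof -
      have "ty A a \<le> (SUP c\<in>elts C. \<Psi> a c * \<Phi> c a)"
        using le(1) a A.ty_le_hom[OF a] by (auto simp: distributor_le_def distributor_comp_Idm[OF d] intro: order_trans)
      moreover have "\<Phi> c a * \<Psi> a c' \<le> ehom C c c'" if c: "c \<in> elts C" "c' \<in> elts C" for c c'
      proof -
        have "\<Phi> c a * \<Psi> a c' \<le> (SUP a\<in>elts A. \<Phi> c a * \<Psi> a c')" using a by (rule SUP_upper)
        then show ?thesis
          using le(2) c by (auto simp: distributor_le_def distributor_comp_Idm[OF d(2,1)] intro: order_trans)
      qed
      ultimately show ?thesis
        using d a A.ty_idem[OF a]
        unfolding adjoint_presheaf_def presheaf_def copresheaf_def distributor_Idm_iff by blast
    qed
    then have "\<forall>a\<in>elts A. \<exists>c. c \<in> elts C \<and> ty C c = ty A a \<and> (\<forall>x\<in>elts C. \<Phi> x a = ehom C x c)"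
      using * unfolding cauchy_def by blast
    then obtain F where F: "\<And>a. a \<in> elts A \<Longrightarrow> F a \<in> elts C \<and> ty C (F a) = ty A a"
      "\<And>a x. a \<in> elts A \<Longrightarrow> x \<in> elts C \<Longrightarrow> \<Phi> x a = ehom C x (F a)" by metis
    have "ehom A b a \<le> ehom C (F b) (F a)" if ab: "a \<in> elts A" "b \<in> elts A" for a b
    proof -
      have "ehom A b a = ty C (F b) * ehom A b a" using ab F A.ty_hom by simp
      also have "\<dots> \<le> \<Phi> (F b) b * ehom A b a"
        using ab F C.ty_le_hom[of "F b"] by (intro quantale_mult_mono) auto
      also have "\<dots> \<le> \<Phi> (F b) a" using d(1) ab F unfolding distributor_Idm_iff by blast
      finally show ?thesis using ab F by simp
    qed
    then show "\<exists>F. enriched_functor (Idm TYPE('q)) A C F \<and> (\<forall>a\<in>elts A. \<forall>c\<in>elts C. \<Phi> c a = ehom C c (F a))"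
      using F by (intro exI[of _ "restrict F (elts A)"]) (auto simp: functor_Idm_iff)
  qed
qed

locale small_quantale = universe small
  for small :: "'u set \<Rightarrow> bool" +
  fixes Q :: "'q::comm_quantale itself"
  assumes closed_under_exponents: "closed_under_exponents small Q"
begin

lemma exponents: "closed_under_exponents small TYPE('q)"
  using closed_under_exponents by (simp add: closed_under_exponents_def)

abbreviation K :: "(('u, 'q, 'q) ecat, 'u \<Rightarrow> 'u) ocat" where
  "K \<equiv> Ord small TYPE('q)"

lemma Ord_ob_iff: "A \<in> ob K \<longleftrightarrow> small (elts A) \<and> idem_category A \<and> cauchy A"
  using Cauchy_complete_Idm_iff by (auto simp: Ord_def Cat_cc_def enriched_category_Idm_iff)

lemma Ord_arr_iff: "F \<in> arr K A B \<longleftrightarrow> F \<in> extensional (elts A) \<and>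
     (\<forall>a\<in>elts A. F a \<in> elts B \<and> ty B (F a) = ty A a) \<and>
     (\<forall>a\<in>elts A. \<forall>b\<in>elts A. ehom A b a \<le> ehom B (F b) (F a))"
  by (simp add: Ord_def Cat_cc_def functor_Idm_iff)

lemma Ord_le_iff: "F \<sqsubseteq>\<^bsub>hom K A B\<^esub> G \<longleftrightarrow> (\<forall>a\<in>elts A. ty A a \<le> ehom B (F a) (G a))"
  by (simp add: Ord_def Cat_cc_def functor_le_Idm_iff)

lemma Ord_eq_iff: "F .=\<^bsub>hom K A B\<^esub> G \<longleftrightarrow> F \<sqsubseteq>\<^bsub>hom K A B\<^esub> G \<and> G \<sqsubseteq>\<^bsub>hom K A B\<^esub> F"
  by (simp add: Ord_def Cat_cc_def)

lemma Ord_idt: "idt K A = (\<lambda>a\<in>elts A. a)"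
  by (simp add: Ord_def Cat_cc_def)

lemma Ord_cmp: "cmp K A B C G F = compose (elts A) G F"
  by (simp add: Ord_def Cat_cc_def)

lemma arrD:
  assumes "F \<in> arr K A B"
  shows "\<And>a. a \<in> elts A \<Longrightarrow> F a \<in> elts B" "\<And>a. a \<in> elts A \<Longrightarrow> ty B (F a) = ty A a"
    "\<And>a b. a \<in> elts A \<Longrightarrow> b \<in> elts A \<Longrightarrow> ehom A b a \<le> ehom B (F b) (F a)"
  using assms by (auto simp: Ord_arr_iff)

lemma Ord_ob_idem: "A \<in> ob K \<Longrightarrow> idem_category A"
  by (simp add: Ord_ob_iff)

lemma locally_ordered_Ord: "locally_ordered_category K"
proof (rule locally_ordered_category.intro)
  fix X Y assume X: "X \<in> ob K" and Y: "Y \<in> ob K"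
  interpret X: idem_category X using X by (rule Ord_ob_idem)
  interpret Y: idem_category Y using Y by (rule Ord_ob_idem)
  have refl: "f \<sqsubseteq>\<^bsub>hom K X Y\<^esub> f" if "f \<in> arr K X Y" for f
    using arrD[OF that] Y.ty_le_hom by (auto simp: Ord_le_iff) metis
  have trans: "f \<sqsubseteq>\<^bsub>hom K X Y\<^esub> h" if "f \<in> arr K X Y" "g \<in> arr K X Y" "h \<in> arr K X Y"
    "f \<sqsubseteq>\<^bsub>hom K X Y\<^esub> g" "g \<sqsubseteq>\<^bsub>hom K X Y\<^esub> h" for f g h
    unfolding Ord_le_iff
  proof
    fix x assume x: "x \<in> elts X"
    have "ty X x * ty X x \<le> ehom Y (f x) (h x)"
      using that x arrD by (intro Y.le_hom_trans[where b = "g x"]) (auto simp: Ord_le_iff)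
    then show "ty X x \<le> ehom Y (f x) (h x)" using X.ty_idem x by simp
  qed
  show "weak_partial_order (hom K X Y)"
    by unfold_locales (auto simp: Ord_eq_iff refl intro: trans)
  show "cmp K X X Y f (idt K X) = f" if "f \<in> arr K X Y" for f
    using that by (auto simp: Ord_arr_iff Ord_idt Ord_cmp compose_def extensional_def restrict_def fun_eq_iff)
  show "cmp K X Y Y (idt K Y) f = f" if "f \<in> arr K X Y" for f
    using that by (auto simp: Ord_arr_iff Ord_idt Ord_cmp compose_def extensional_def restrict_def fun_eq_iff)
  fix Z assume Z: "Z \<in> ob K"
  interpret Z: idem_category Z using Z by (rule Ord_ob_idem)
  show cmp_arr: "cmp K X Y Z g f \<in> arr K X Z" if "f \<in> arr K X Y" "g \<in> arr K Y Z" for f g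
    using that by (auto simp: Ord_arr_iff Ord_cmp compose_eq) (meson order_trans)
  show "cmp K X Y Z g f \<sqsubseteq>\<^bsub>hom K X Z\<^esub> cmp K X Y Z g' f'"
    if f: "f \<in> arr K X Y" "f' \<in> arr K X Y" and g: "g \<in> arr K Y Z" "g' \<in> arr K Y Z"
      and le: "f \<sqsubseteq>\<^bsub>hom K X Y\<^esub> f'" "g \<sqsubseteq>\<^bsub>hom K Y Z\<^esub> g'" for f f' g g'
    unfolding Ord_le_iff
  proof
    fix x assume x: "x \<in> elts X"
    note f' = arrD[OF f(1)] arrD[OF f(2)] and g' = arrD[OF g(1)] arrD[OF g(2)]
    have 1: "ty X x \<le> ehom Y (f x) (f' x)" "ty X x \<le> ehom Z (g (f' x)) (g' (f' x))"
      using le x f'(4,5)[of x] by (auto simp: Ord_le_iff)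
    moreover have "ehom Y (f x) (f' x) \<le> ehom Z (g (f x)) (g (f' x))" using g'(3) f' x by blast
    ultimately have "ty X x * ty X x \<le> ehom Z (g (f x)) (g' (f' x))"
      using f' g' x by (intro Z.le_hom_trans[where b = "g (f' x)"]) (auto intro: order_trans)
    then show "ty X x \<le> ehom Z (cmp K X Y Z g f x) (cmp K X Y Z g' f' x)"
      using X.ty_idem x by (simp add: Ord_cmp compose_eq)
  qed
next
  show "idt K X \<in> arr K X X" for X by (auto simp: Ord_arr_iff Ord_idt)
next
  fix W X Y Z f g h assume "f \<in> arr K W X"
  then show "cmp K W Y Z h (cmp K W X Y g f) = cmp K W X Z (cmp K X Y Z h g) f"
    by (auto simp: Ord_cmp compose_def fun_eq_iff Ord_arr_iff)
qed

sublocale K: locally_ordered_category K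
  by (rule locally_ordered_Ord)

lemma cmp_app: "a \<in> elts A \<Longrightarrow> cmp K A B C G F a = G (F a)"
  by (simp add: Ord_cmp compose_eq)

lemma restrict_arr:
  assumes "\<And>a. a \<in> elts A \<Longrightarrow> F a \<in> elts B \<and> ty B (F a) = ty A a"
    "\<And>a b. a \<in> elts A \<Longrightarrow> b \<in> elts A \<Longrightarrow> ehom A b a \<le> ehom B (F b) (F a)"
  shows "restrict F (elts A) \<in> arr K A B"
  using assms by (simp add: Ord_arr_iff)

lemma hom_cong_eqv:
  assumes X: "X \<in> ob K" and A: "A \<in> ob K" and B: "B \<in> ob K"
    and f: "f \<in> arr K A X" "f' \<in> arr K A X" "K.eqv A X f f'"
    and g: "g \<in> arr K B X" "g' \<in> arr K B X" "K.eqv B X g g'"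
    and a: "a \<in> elts A" and b: "b \<in> elts B"
  shows "ehom X (g b) (f a) = ehom X (g' b) (f' a)"
proof -
  interpret X: idem_category X using X by (rule Ord_ob_idem)
  have le: "ehom X (g b) (f a) \<le> ehom X (g' b) (f' a)"
    if f: "f \<in> arr K A X" "f' \<in> arr K A X" "K.le2 A X f f'"
      and g: "g \<in> arr K B X" "g' \<in> arr K B X" "K.le2 B X g' g" for f f' g g'
  proof -
    note fa = arrD[OF f(1)] arrD[OF f(2)] and gb = arrD[OF g(1)] arrD[OF g(2)]
    have "ehom X (g b) (f a) = ty B b * ehom X (g b) (f a) * ty A a"
      using fa gb a b X.hom_ty X.ty_hom by metis
    also have "\<dots> \<le> ehom X (g' b) (f' a)"
      using f(3) g(3) fa gb a b
      by (intro X.le_hom_trans[where b = "f a"] X.le_hom_trans[where b = "g b"]) (auto simp: Ord_le_iff)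
    finally show ?thesis .
  qed
  show ?thesis
    using le[of f f' g g'] le[of f' f g' g] f g by (intro antisym) (auto simp: K.eqv_def)
qed

end

section \<open>Full faithfulness and cospans in \<open>Ord(Q)\<close>\<close>

context small_quantale
begin

lemma realise_in_Ord:
  fixes D X :: "('u, 'q, 'q) ecat"
  assumes D: "D \<in> ob K" and X: "X \<in> ob K" and \<Theta>: "distributor (Idm TYPE('q)) X D \<Theta>"
  obtains E h k where "E \<in> ob K" "h \<in> arr K D E" "k \<in> arr K X E"
    "\<And>d d'. d \<in> elts D \<Longrightarrow> d' \<in> elts D \<Longrightarrow> ehom E (h d) (h d') = ehom D d d'"
    "\<And>d x. d \<in> elts D \<Longrightarrow> x \<in> elts X \<Longrightarrow> ehom E (h d) (k x) = \<Theta> d x"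
    "\<And>d x. d \<in> elts D \<Longrightarrow> x \<in> elts X \<Longrightarrow> ty X x = ty D d \<Longrightarrow>
      (\<And>d'. d' \<in> elts D \<Longrightarrow> \<Theta> d' x \<le> ehom D d' d) \<Longrightarrow> ty X x \<le> ehom E (k x) (h d)"
proof -
  interpret D: idem_category D using D by (rule Ord_ob_idem)
  interpret X: idem_category X using X by (rule Ord_ob_idem)
  have sm: "tiny (elts D)" "tiny (elts X)" using D X by (auto simp: Ord_ob_iff tiny_small)
  have ps: "presheaf D (ty X x) (\<lambda>d. \<Theta> d x)" if "x \<in> elts X" for x
    using \<Theta> that X.ty_idem by (auto simp: distributor_Idm_iff presheaf_def)
  have pX: "\<Theta> d y * ehom X y x \<le> \<Theta> d x" if "d \<in> elts D" "x \<in> elts X" "y \<in> elts X" for d x y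
    using \<Theta> that by (auto simp: distributor_Idm_iff)
  obtain E :: "('u, 'q, 'q) ecat" and h k where E: "small (elts E)" "idem_category E" "cauchy E"
    and h: "\<And>d. d \<in> elts D \<Longrightarrow> h d \<in> elts E \<and> ty E (h d) = ty D d"
    "\<And>d d'. d \<in> elts D \<Longrightarrow> d' \<in> elts D \<Longrightarrow> ehom E (h d) (h d') = ehom D d d'"
    and k: "\<And>x. x \<in> elts X \<Longrightarrow> k x \<in> elts E \<and> ty E (k x) = ty X x"
    "\<And>x y. x \<in> elts X \<Longrightarrow> y \<in> elts X \<Longrightarrow> ehom X x y \<le> ehom E (k x) (k y)"
    and hk: "\<And>d x. d \<in> elts D \<Longrightarrow> x \<in> elts X \<Longrightarrow> ehom E (h d) (k x) = \<Theta> d x"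
    "\<And>d x. d \<in> elts D \<Longrightarrow> x \<in> elts X \<Longrightarrow> ty X x = ty D d \<Longrightarrow>
      (\<And>d'. d' \<in> elts D \<Longrightarrow> \<Theta> d' x \<le> ehom D d' d) \<Longrightarrow> ty X x \<le> ehom E (k x) (h d)"
    using realise_distributor[OF exponents D.idem_category_axioms sm ps X.hom_ty X.ty_hom pX] by blast
  show ?thesis
  proof (rule that[of E "restrict h (elts D)" "restrict k (elts X)"])
    show "E \<in> ob K" using E by (simp add: Ord_ob_iff)
    show "restrict h (elts D) \<in> arr K D E" using h by (intro restrict_arr) auto
    show "restrict k (elts X) \<in> arr K X E" using k by (intro restrict_arr) auto
  qed (use h hk in auto)
qed

lemma retraction_full_faithful:
  assumes X: "X \<in> ob K" and Y: "Y \<in> ob K" and r: "K.retraction X Y r s"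
    and x: "x \<in> elts X" and x': "x' \<in> elts X"
  shows "ehom Y (s x') (s x) = ehom X x' x"
proof -
  have s: "s \<in> arr K X Y" and r': "r \<in> arr K Y X" and rs: "K.eqv X X (cmp K X Y X r s) (idt K X)"
    using r by (auto simp: K.retraction_def)
  have "ehom X (r (s x')) (r (s x)) = ehom X x' x"
    using hom_cong_eqv[OF X X X _ _ rs _ _ rs x x'] K.cmp_arr[OF X Y X s r'] K.idt_arr[OF X] x x'
    by (simp add: cmp_app Ord_idt)
  then have "ehom Y (s x') (s x) \<le> ehom X x' x"
    using arrD[OF s] arrD(3)[OF r', of "s x" "s x'"] x x' by simp
  then show ?thesis using arrD(3)[OF s x x'] by (intro antisym)
qed

text \<open>
  Let \<open>\<Theta>(y',y) = \<Squnion>\<^sub>a Y(y',G a) \<cdot> Y(G a,y)\<close>; this presheaf on \<open>Y\<close> is the best approximation of \<open>y\<close> by the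
  image of \<open>G\<close>.  The functors \<open>y \<mapsto> Y(-,y)\<close> and \<open>y \<mapsto> \<Theta>(-,y)\<close> agree on the image of \<open>G\<close>, so the first
  lies below the second, which is the density of \<open>G\<close>.
\<close>

lemma lax_epi_dense:
  assumes Y: "Y \<in> ob K" and A: "A \<in> ob K" and epi: "K.lax_epi A Y G" and y: "y \<in> elts Y"
  shows "ty Y y \<le> (SUP a\<in>elts A. ehom Y y (G a) * ehom Y (G a) y)"
proof -
  interpret Y: idem_category Y using Y by (rule Ord_ob_idem)
  have G: "G \<in> arr K A Y" using epi by (simp add: K.lax_epi_def)
  note G' = arrD[OF G]
  define \<Theta> where "\<Theta> y' y = (SUP a\<in>elts A. ehom Y y' (G a) * ehom Y (G a) y)" for y' y
  have "distributor (Idm TYPE('q)) Y Y \<Theta>"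
    unfolding distributor_Idm_iff
  proof (intro conjI ballI)
    fix a b c assume *: "a \<in> elts Y" "b \<in> elts Y"
    show "\<Theta> b a * ty Y a = \<Theta> b a" "ty Y b * \<Theta> b a = \<Theta> b a"
      using * G' by (simp_all add: \<Theta>_def SUP_mult mult_SUP mult.assoc Y.hom_ty cong: SUP_cong)
        (simp add: mult.assoc[symmetric] Y.ty_hom cong: SUP_cong)
    assume c: "c \<in> elts Y"
    show "ehom Y b c * \<Theta> c a \<le> \<Theta> b a"
      unfolding \<Theta>_def using * c G' by (intro mult_SUP_mult_mono Y.hom_hom) auto
    show "\<Theta> b c * ehom Y c a \<le> \<Theta> b a"
      unfolding \<Theta>_def using * c G' by (intro SUP_mult_mult_mono Y.hom_hom) auto
  qed
  then obtain E h k where E: "E \<in> ob K" and h: "h \<in> arr K Y E" and k: "k \<in> arr K Y E"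
    and hk: "\<And>d x. d \<in> elts Y \<Longrightarrow> x \<in> elts Y \<Longrightarrow> ehom E (h d) (k x) = \<Theta> d x"
    using realise_in_Ord[OF Y Y] by metis
  have "K.le2 A E (cmp K A Y E h G) (cmp K A Y E k G)"
    unfolding Ord_le_iff
  proof
    fix a assume a: "a \<in> elts A"
    have "ty A a = ty Y (G a) * ty Y (G a)" using Y.ty_idem[of "G a"] G' a by simp
    also have "\<dots> \<le> ehom Y (G a) (G a) * ehom Y (G a) (G a)"
      using G' a Y.ty_le_hom by (intro quantale_mult_mono) metis+
    also have "\<dots> \<le> \<Theta> (G a) (G a)" unfolding \<Theta>_def using a by (rule SUP_upper)
    finally show "ty A a \<le> ehom E (cmp K A Y E h G a) (cmp K A Y E k G a)"
      using a G' hk by (simp add: cmp_app)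
  qed
  then have "K.le2 Y E h k" using epi E h k unfolding K.lax_epi_def by blast
  then show ?thesis using y hk by (simp add: Ord_le_iff \<Theta>_def)
qed

text \<open>
  In a factorisation \<open>h = m \<circ> G\<close> also \<open>G\<close> is fully faithful.  If \<open>G\<close> is dense too, then \<open>Y(G-,y)\<close> is
  left adjoint to \<open>Y(y,G-)\<close>, and because \<open>A\<close> is Cauchy complete it is represented by some \<open>r y\<close>.
\<close>

lemma full_faithful_embedding:
  assumes A: "A \<in> ob K" and B: "B \<in> ob K" and h: "h \<in> arr K A B"
    and ff: "\<And>a b. a \<in> elts A \<Longrightarrow> b \<in> elts A \<Longrightarrow> ehom B (h b) (h a) \<le> ehom A b a"
  shows "K.embedding A B h"
  unfolding K.embedding_def
proof (intro conjI ballI impI h)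
  fix Y G m assume Y: "Y \<in> ob K" and G: "G \<in> arr K A Y" and m: "m \<in> arr K Y B"
    and "K.lax_epi A Y G \<and> K.eqv A B (cmp K A Y B m G) h"
  then have epi: "K.lax_epi A Y G" and mG: "K.eqv A B (cmp K A Y B m G) h" by auto
  interpret A: idem_category A using A by (rule Ord_ob_idem)
  interpret Y: idem_category Y using Y by (rule Ord_ob_idem)
  note G' = arrD[OF G]
  have G_ff: "ehom Y (G b) (G a) = ehom A b a" if a: "a \<in> elts A" and b: "b \<in> elts A" for a b
  proof (rule antisym)
    have "ehom Y (G b) (G a) \<le> ehom B (m (G b)) (m (G a))" using arrD[OF m] G' a b by blast
    also have "\<dots> = ehom B (h b) (h a)"
      using hom_cong_eqv[OF B A A K.cmp_arr[OF A Y B G m] h mG K.cmp_arr[OF A Y B G m] h mG a b] a b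
      by (simp add: cmp_app)
    also have "\<dots> \<le> ehom A b a" using ff a b .
    finally show "ehom Y (G b) (G a) \<le> ehom A b a" .
  qed (use G' a b in blast)
  have "adjoint_presheaf A (ty Y y) (\<lambda>a. ehom Y (G a) y) (\<lambda>a. ehom Y y (G a))" if y: "y \<in> elts Y" for y
    unfolding adjoint_presheaf_def presheaf_def copresheaf_def
  proof (intro conjI ballI)
    fix a b assume a: "a \<in> elts A"
    show "ty A a * ehom Y (G a) y = ehom Y (G a) y" "ehom Y y (G a) * ty A a = ehom Y y (G a)"
      using Y.ty_hom[OF y, of "G a"] Y.hom_ty[of "G a" y] G' a y by auto
    show "ehom Y (G a) y * ty Y y = ehom Y (G a) y" "ty Y y * ehom Y y (G a) = ehom Y y (G a)"
      using Y.hom_ty[OF y, of "G a"] Y.ty_hom[of "G a" y] G' a y by auto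
    assume b: "b \<in> elts A"
    show "ehom A b a * ehom Y (G a) y \<le> ehom Y (G b) y" "ehom Y y (G b) * ehom A b a \<le> ehom Y y (G a)"
      "ehom Y (G b) y * ehom Y y (G a) \<le> ehom A b a"
      using G' a b y by (auto simp: G_ff[symmetric] intro!: Y.hom_hom)
  next
    show "ty Y y \<le> (SUP a\<in>elts A. ehom Y y (G a) * ehom Y (G a) y)" by (rule lax_epi_dense[OF Y A epi y])
  qed (use Y.ty_idem y in auto)
  then have "\<forall>y\<in>elts Y. \<exists>a. a \<in> elts A \<and> ty A a = ty Y y \<and> (\<forall>x\<in>elts A. ehom Y (G x) y = ehom A x a)"
    using A unfolding Ord_ob_iff cauchy_def by blast
  then obtain r where r: "\<And>y. y \<in> elts Y \<Longrightarrow> r y \<in> elts A \<and> ty A (r y) = ty Y y"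
    "\<And>y x. y \<in> elts Y \<Longrightarrow> x \<in> elts A \<Longrightarrow> ehom Y (G x) y = ehom A x (r y)"
    by metis
  have r_arr: "restrict r (elts Y) \<in> arr K Y A"
  proof (rule restrict_arr)
    fix y z assume y: "y \<in> elts Y" and z: "z \<in> elts Y"
    have "ehom Y z y = ty A (r z) * ehom Y z y" using r y z Y.ty_hom by simp
    also have "\<dots> \<le> ehom Y (G (r z)) y"
      using r y z G' A.ty_le_hom[of "r z"] by (intro Y.le_hom_trans[where b = z]) auto
    finally show "ehom Y z y \<le> ehom A (r z) (r y)" using r y z by simp
  qed (use r in auto)
  have "ehom A x (r (G a)) = ehom A x a" if "a \<in> elts A" "x \<in> elts A" for a x
    using r(2)[of "G a" x] G' G_ff that by simp
  then have "K.eqv A A (cmp K A Y A (restrict r (elts Y)) G) (idt K A)"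
    unfolding K.eqv_def Ord_le_iff using G' r A.ty_le_hom
    by (auto simp: cmp_app Ord_idt) (metis)
  then show "\<exists>r. K.retraction A Y r G"
    unfolding K.retraction_def using r_arr G by blast
qed

text \<open>
  The functor \<open>h\<close> factors through the full subcategory of \<open>B\<close> on the closure of its image.  This category
  is Cauchy complete, and the first factor is a lax epimorphism as its image is dense.  A retraction
  of this factor shows that it is fully faithful, and the second factor is a full inclusion.
\<close>

lemma embedding_full_faithful:
  assumes A: "A \<in> ob K" and B: "B \<in> ob K" and emb: "K.embedding A B h"
    and a: "a \<in> elts A" and b: "b \<in> elts A"
  shows "ehom B (h b) (h a) = ehom A b a"
proof -
  interpret B: idem_category B using B by (rule Ord_ob_idem)
  have h: "h \<in> arr K A B" using emb by (simp add: K.embedding_def)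
  note h' = arrD[OF h]
  define S where "S = h ` elts A"
  have S: "S \<subseteq> elts B" using h' by (auto simp: S_def)
  define Y where "Y = B\<lparr>elts := closure B S\<rparr>"
  have Y_simps: "elts Y = closure B S" "ty Y = ty B" "ehom Y = ehom B" by (simp_all add: Y_def)
  have cl: "closure B S \<subseteq> elts B" "S \<subseteq> closure B S"
    using B.subset_closure[OF S] by (auto simp: closure_def)
  have Y: "Y \<in> ob K"
    using B B.full[OF cl(1)] cauchy_closure[OF B.idem_category_axioms _ S] small_subset[OF _ cl(1)]
    by (auto simp: Ord_ob_iff Y_def)
  have G: "h \<in> arr K A Y" using h cl(2) by (auto simp: Ord_arr_iff Y_simps S_def)
  have m: "(\<lambda>y\<in>elts Y. y) \<in> arr K Y B" using cl(1) by (intro restrict_arr) (auto simp: Y_simps)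
  have "K.lax_epi A Y h"
    unfolding K.lax_epi_def
  proof (intro conjI ballI impI G)
    fix Z u v assume Z: "Z \<in> ob K" and u: "u \<in> arr K Y Z" and v: "v \<in> arr K Y Z"
      and le: "K.le2 A Z (cmp K A Y Z u h) (cmp K A Y Z v h)"
    interpret Z: idem_category Z using Z by (rule Ord_ob_idem)
    note u' = arrD[OF u] and v' = arrD[OF v]
    show "K.le2 Y Z u v"
      unfolding Ord_le_iff
    proof
      fix y assume y: "y \<in> elts Y"
      have "ty Y y \<le> (SUP i\<in>S. ehom B y i * ehom B i y)" using y by (simp add: Y_simps closure_def)
      also have "\<dots> \<le> ehom Z (u y) (v y)"
      proof (rule SUP_least)
        fix i assume i: "i \<in> S"
        then obtain x where x: "x \<in> elts A" "i = h x" by (auto simp: S_def)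
        have iY: "i \<in> elts Y" using i cl by (auto simp: Y_simps)
        have "ty Y i \<le> ehom Z (u i) (v i)"
          using le x h' by (simp add: Ord_le_iff cmp_app Y_simps)
        then have "ehom Y y i * (ty Y i * ehom Y i y) \<le> ehom Z (u y) (v y)"
          using u' v' y iY by (intro Z.le_hom_trans[where b = "u i"] Z.le_hom_trans[where b = "v i"]) auto
        then show "ehom B y i * ehom B i y \<le> ehom Z (u y) (v y)"
          using B.ty_hom[OF subsetD[OF cl(1)] subsetD[OF cl(1)], of y i] y iY by (simp add: Y_simps)
      qed
      finally show "ty Y y \<le> ehom Z (u y) (v y)" .
    qed
  qed
  moreover have "cmp K A Y B (\<lambda>y\<in>elts Y. y) h = h"
    using arrD(1)[OF G] h by (auto simp: Ord_cmp compose_def fun_eq_iff Ord_arr_iff extensional_def)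
  ultimately obtain r where "K.retraction A Y r h"
    using emb Y G m K.eqv_refl[OF A B h] unfolding K.embedding_def by metis
  then show ?thesis using retraction_full_faithful[OF A Y _ a b] by (simp add: Y_simps)
qed

definition cospan_value ::
  "('u, 'q, 'q) ecat \<Rightarrow> ('u, 'q, 'q) ecat \<Rightarrow> ('u, 'q, 'q) ecat \<times> ('u \<Rightarrow> 'u) \<times> ('u \<Rightarrow> 'u) \<Rightarrow> 'u \<Rightarrow> 'u \<Rightarrow> 'q" where
  "cospan_value A B = (\<lambda>(X, f, g). \<lambda>b\<in>elts B. \<lambda>a\<in>elts A. ehom X (g b) (f a))"

lemma cospan_value_app:
  "a \<in> elts A \<Longrightarrow> b \<in> elts B \<Longrightarrow> cospan_value A B (X, f, g) b a = ehom X (g b) (f a)"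
  by (simp add: cospan_value_def)

lemma compose_distributors:
  assumes X: "X \<in> ob K" and Y: "Y \<in> ob K" and g: "g \<in> arr K B X" and u: "u \<in> arr K B Y"
  shows "distributor (Idm TYPE('q)) X Y (\<lambda>y x. SUP b\<in>elts B. ehom Y y (u b) * ehom X (g b) x)"
  unfolding distributor_Idm_iff
proof (intro conjI ballI)
  interpret X: idem_category X using X by (rule Ord_ob_idem)
  interpret Y: idem_category Y using Y by (rule Ord_ob_idem)
  note g' = arrD[OF g] and u' = arrD[OF u]
  fix x y assume x: "x \<in> elts X" and y: "y \<in> elts Y"
  show "(SUP b\<in>elts B. ehom Y y (u b) * ehom X (g b) x) * ty X x = (SUP b\<in>elts B. ehom Y y (u b) * ehom X (g b) x)"
    using x y g' by (simp add: SUP_mult mult.assoc X.hom_ty cong: SUP_cong)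
  show "ty Y y * (SUP b\<in>elts B. ehom Y y (u b) * ehom X (g b) x) = (SUP b\<in>elts B. ehom Y y (u b) * ehom X (g b) x)"
    using x y u' by (simp add: mult_SUP mult.assoc[symmetric] Y.ty_hom cong: SUP_cong)
  show "ehom Y y z * (SUP b\<in>elts B. ehom Y z (u b) * ehom X (g b) x)
      \<le> (SUP b\<in>elts B. ehom Y y (u b) * ehom X (g b) x)" if "z \<in> elts Y" for z
    using x y that u' by (intro mult_SUP_mult_mono Y.hom_hom) auto
  show "(SUP b\<in>elts B. ehom Y y (u b) * ehom X (g b) z) * ehom X z x
      \<le> (SUP b\<in>elts B. ehom Y y (u b) * ehom X (g b) x)" if "z \<in> elts X" for z
    using x y that g' by (intro SUP_mult_mult_mono X.hom_hom) auto
qed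

text \<open>
  Given the inequality, \<open>E\<close> is obtained from \<open>Y\<close> by adding for each \<open>x\<close> in \<open>X\<close> the presheaf
  \<open>\<Squnion>\<^sub>b Y(-,v b) \<cdot> X(g b,x)\<close>.  At \<open>x = f a\<close> the hypothesis bounds it by \<open>Y(-,u a)\<close>, whence \<open>k \<circ> f \<le> h \<circ> u\<close>.
\<close>

lemma cospan_le_iff:
  assumes A: "A \<in> ob K" and B: "B \<in> ob K" and X: "X \<in> ob K" "f \<in> arr K A X" "g \<in> arr K B X"
    and Y: "Y \<in> ob K" "u \<in> arr K A Y" "v \<in> arr K B Y"
  shows "K.cospan_le A B (X, f, g) (Y, u, v) \<longleftrightarrow>
    (\<forall>a\<in>elts A. \<forall>b\<in>elts B. ehom X (g b) (f a) \<le> ehom Y (v b) (u a))"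
proof
  note f' = arrD[OF X(2)] and g' = arrD[OF X(3)] and u' = arrD[OF Y(2)] and v' = arrD[OF Y(3)]
  interpret X: idem_category X using X(1) by (rule Ord_ob_idem)
  interpret Y: idem_category Y using Y(1) by (rule Ord_ob_idem)
  {
    assume "K.cospan_le A B (X, f, g) (Y, u, v)"
    then obtain E k h where E: "E \<in> ob K" and k: "k \<in> arr K X E" and emb: "K.embedding Y E h"
      and le: "K.le2 A E (cmp K A X E k f) (cmp K A Y E h u)" "K.le2 B E (cmp K B Y E h v) (cmp K B X E k g)"
      unfolding K.cospan_le_def by auto
    interpret E: idem_category E using E by (rule Ord_ob_idem)
    have h: "h \<in> arr K Y E" using emb by (simp add: K.embedding_def)
    note k' = arrD[OF k] and h' = arrD[OF h]
    show "\<forall>a\<in>elts A. \<forall>b\<in>elts B. ehom X (g b) (f a) \<le> ehom Y (v b) (u a)"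
    proof (intro ballI)
      fix a b assume a: "a \<in> elts A" and b: "b \<in> elts B"
      have "ehom X (g b) (f a) = ty B b * (ehom X (g b) (f a) * ty A a)"
        using X.hom_ty[of "f a" "g b"] X.ty_hom[of "f a" "g b"] f' g' a b by simp
      also have "\<dots> \<le> ehom E (h (v b)) (h (u a))"
        using le a b f' g' u' v' k' h'
        by (intro E.le_hom_trans[where b = "k (g b)"] E.le_hom_trans[where b = "k (f a)"])
          (auto simp: Ord_le_iff cmp_app)
      also have "\<dots> = ehom Y (v b) (u a)"
        using embedding_full_faithful[OF Y(1) E emb] a b u' v' by blast
      finally show "ehom X (g b) (f a) \<le> ehom Y (v b) (u a)" .
    qed
  next
    assume le: "\<forall>a\<in>elts A. \<forall>b\<in>elts B. ehom X (g b) (f a) \<le> ehom Y (v b) (u a)"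
    define \<Theta> where "\<Theta> y x = (SUP b\<in>elts B. ehom Y y (v b) * ehom X (g b) x)" for y x
    obtain E h k where E: "E \<in> ob K" and h: "h \<in> arr K Y E" and k: "k \<in> arr K X E"
      and ff: "\<And>d d'. d \<in> elts Y \<Longrightarrow> d' \<in> elts Y \<Longrightarrow> ehom E (h d) (h d') = ehom Y d d'"
      and hk: "\<And>d x. d \<in> elts Y \<Longrightarrow> x \<in> elts X \<Longrightarrow> ehom E (h d) (k x) = \<Theta> d x"
        "\<And>d x. d \<in> elts Y \<Longrightarrow> x \<in> elts X \<Longrightarrow> ty X x = ty Y d \<Longrightarrow>
        (\<And>d'. d' \<in> elts Y \<Longrightarrow> \<Theta> d' x \<le> ehom Y d' d) \<Longrightarrow> ty X x \<le> ehom E (k x) (h d)"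
      by (rule realise_in_Ord[OF Y(1) X(1) compose_distributors[OF X(1) Y(1) X(3) Y(3)]])
        (simp add: \<Theta>_def)
    have emb: "K.embedding Y E h"
      using ff by (intro full_faithful_embedding Y E h) auto
    have "K.le2 A E (cmp K A X E k f) (cmp K A Y E h u)"
      unfolding Ord_le_iff
    proof
      fix a assume a: "a \<in> elts A"
      have "\<Theta> y (f a) \<le> ehom Y y (u a)" if y: "y \<in> elts Y" for y
        unfolding \<Theta>_def
      proof (rule SUP_least)
        fix b assume b: "b \<in> elts B"
        show "ehom Y y (v b) * ehom X (g b) (f a) \<le> ehom Y y (u a)"
          using le a b y u' v' by (intro Y.le_hom_trans[where b = "v b"]) auto
      qed
      then have "ty X (f a) \<le> ehom E (k (f a)) (h (u a))" using a f' u' by (intro hk(2)) auto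
      then show "ty A a \<le> ehom E (cmp K A X E k f a) (cmp K A Y E h u a)"
        using a f' by (simp add: cmp_app)
    qed
    moreover have "K.le2 B E (cmp K B Y E h v) (cmp K B X E k g)"
      unfolding Ord_le_iff
    proof
      fix b assume b: "b \<in> elts B"
      have "ty B b = ty Y (v b) * ty X (g b)" using v' g' b X.ty_idem[of "g b"] by simp
      also have "\<dots> \<le> ehom Y (v b) (v b) * ehom X (g b) (g b)"
        using v' g' b X.ty_le_hom Y.ty_le_hom by (intro quantale_mult_mono) blast+
      also have "\<dots> \<le> \<Theta> (v b) (g b)" unfolding \<Theta>_def using b by (rule SUP_upper)
      also have "\<dots> = ehom E (cmp K B Y E h v b) (cmp K B X E k g b)"
        using b v' g' hk(1) by (simp add: cmp_app)
      finally show "ty B b \<le> ehom E (cmp K B Y E h v b) (cmp K B X E k g b)" .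
    qed
    ultimately show "K.cospan_le A B (X, f, g) (Y, u, v)"
      unfolding K.cospan_le_def using E k emb by blast
  }
qed

text \<open>
  The cospan is given by the Yoneda embedding of \<open>B\<close> and by \<open>a \<mapsto> \<Theta>(-,a)\<close>.
\<close>

lemma distributor_cospan:
  assumes A: "A \<in> ob K" and B: "B \<in> ob K" and \<Theta>: "distributor (Idm TYPE('q)) A B \<Theta>"
  obtains X f g where "X \<in> ob K" "f \<in> arr K A X" "g \<in> arr K B X"
    "\<And>a b. a \<in> elts A \<Longrightarrow> b \<in> elts B \<Longrightarrow> ehom X (g b) (f a) = \<Theta> b a"
  using realise_in_Ord[OF B A \<Theta>] by metis

text \<open>
  Here \<open>E\<close> is obtained from \<open>Y\<close> by adding the presheaves \<open>\<Squnion>\<^sub>b Y(-,u b) \<cdot> X(g b,x)\<close>, that is, by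
  composing \<open>X(g-,-)\<close> with \<open>Y(-,u-)\<close>.
\<close>

lemma cospan_composite_exists:
  assumes X: "X \<in> ob K" "f \<in> arr K A X" "g \<in> arr K B X"
    and Y: "Y \<in> ob K" "u \<in> arr K B Y" "v \<in> arr K C Y"
  obtains E h k where "E \<in> ob K" "h \<in> arr K Y E" "k \<in> arr K X E"
    "K.le2 B E (cmp K B Y E h u) (cmp K B X E k g)"
    "\<And>a c. a \<in> elts A \<Longrightarrow> c \<in> elts C \<Longrightarrow>
      ehom E (h (v c)) (k (f a)) = (SUP b\<in>elts B. ehom Y (v c) (u b) * ehom X (g b) (f a))"
proof -
  interpret X: idem_category X using X(1) by (rule Ord_ob_idem)
  interpret Y: idem_category Y using Y(1) by (rule Ord_ob_idem)
  note f' = arrD[OF X(2)] and g' = arrD[OF X(3)] and u' = arrD[OF Y(2)] and v' = arrD[OF Y(3)]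
  define \<Theta> where "\<Theta> y x = (SUP b\<in>elts B. ehom Y y (u b) * ehom X (g b) x)" for y x
  obtain E h k where E: "E \<in> ob K" and h: "h \<in> arr K Y E" and k: "k \<in> arr K X E"
    and hk: "\<And>d x. d \<in> elts Y \<Longrightarrow> x \<in> elts X \<Longrightarrow> ehom E (h d) (k x) = \<Theta> d x"
    by (rule realise_in_Ord[OF Y(1) X(1) compose_distributors[OF X(1) Y(1) X(3) Y(2)]])
      (simp add: \<Theta>_def)
  have "K.le2 B E (cmp K B Y E h u) (cmp K B X E k g)"
    unfolding Ord_le_iff
  proof
    fix b assume b: "b \<in> elts B"
    have "ty B b = ty Y (u b) * ty X (g b)" using u' g' b X.ty_idem[of "g b"] by simp
    also have "\<dots> \<le> ehom Y (u b) (u b) * ehom X (g b) (g b)"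
      using u' g' b X.ty_le_hom Y.ty_le_hom by (intro quantale_mult_mono) blast+
    also have "\<dots> \<le> \<Theta> (u b) (g b)" unfolding \<Theta>_def using b by (rule SUP_upper)
    also have "\<dots> = ehom E (cmp K B Y E h u b) (cmp K B X E k g b)"
      using b u' g' hk(1) by (simp add: cmp_app)
    finally show "ty B b \<le> ehom E (cmp K B Y E h u b) (cmp K B X E k g b)" .
  qed
  then show ?thesis using that[OF E h k] hk f' v' by (simp add: \<Theta>_def)
qed

lemma cospan_composite_least:
  assumes X: "X \<in> ob K" "f \<in> arr K A X" "g \<in> arr K B X"
    and Y: "Y \<in> ob K" "u \<in> arr K B Y" "v \<in> arr K C Y"
    and E: "E \<in> ob K" "h \<in> arr K Y E" "k \<in> arr K X E"
    and le: "K.le2 B E (cmp K B Y E h u) (cmp K B X E k g)"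
    and a: "a \<in> elts A" and c: "c \<in> elts C"
  shows "(SUP b\<in>elts B. ehom Y (v c) (u b) * ehom X (g b) (f a)) \<le> ehom E (h (v c)) (k (f a))"
proof (rule SUP_least)
  interpret X: idem_category X using X(1) by (rule Ord_ob_idem)
  interpret E: idem_category E using E(1) by (rule Ord_ob_idem)
  note f' = arrD[OF X(2)] and g' = arrD[OF X(3)] and u' = arrD[OF Y(2)] and v' = arrD[OF Y(3)]
    and h' = arrD[OF E(2)] and k' = arrD[OF E(3)]
  fix b assume b: "b \<in> elts B"
  have "ehom Y (v c) (u b) * (ty B b * ehom X (g b) (f a)) \<le> ehom E (h (v c)) (k (f a))"
    using le a b c f' g' u' v' h' k'
    by (intro E.le_hom_trans[where b = "h (u b)"] E.le_hom_trans[where b = "k (g b)"])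
      (auto simp: Ord_le_iff cmp_app)
  then show "ehom Y (v c) (u b) * ehom X (g b) (f a) \<le> ehom E (h (v c)) (k (f a))"
    using X.ty_hom[of "f a" "g b"] f' g' a b by simp
qed

end

section \<open>Distributors\<close>

definition Dist :: "('u set \<Rightarrow> bool) \<Rightarrow> 'q::quantale itself \<Rightarrow> (('u, 'q, 'q) ecat, 'u \<Rightarrow> 'u \<Rightarrow> 'q) ocat" where
  "Dist small Q =
     \<lparr>ob = ob (Ord small Q),
      hom = (\<lambda>A B.
        \<lparr>carrier = {\<Phi> \<in> extensional (elts B).
           (\<forall>b\<in>elts B. \<Phi> b \<in> extensional (elts A)) \<and> distributor (Idm Q) A B \<Phi>},
         eq = (=),
         le = (\<lambda>\<Phi> \<Psi>. \<forall>b\<in>elts B. \<forall>a\<in>elts A. \<Phi> b a \<le> \<Psi> b a)\<rparr>),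
      idt = (\<lambda>A. \<lambda>b\<in>elts A. \<lambda>a\<in>elts A. ehom A b a),
      cmp = (\<lambda>A B C \<Psi> \<Phi>. \<lambda>c\<in>elts C. \<lambda>a\<in>elts A. SUP b\<in>elts B. \<Psi> c b * \<Phi> b a)\<rparr>"

definition scalar :: "'q::quantale \<Rightarrow> ('u, 'q, 'q) ecat \<Rightarrow> 'u \<Rightarrow> 'u \<Rightarrow> 'q" where
  "scalar q A = (\<lambda>b\<in>elts A. \<lambda>a\<in>elts A. q * ehom A b a)"

context small_quantale
begin

abbreviation DK where "DK \<equiv> Dist small TYPE('q)"

lemma Dist_ob: "ob DK = ob K"
  by (simp add: Dist_def)

lemma Dist_arr_iff: "\<Phi> \<in> arr DK A B \<longleftrightarrow> \<Phi> \<in> extensional (elts B) \<and>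
   (\<forall>b\<in>elts B. \<Phi> b \<in> extensional (elts A)) \<and> distributor (Idm TYPE('q)) A B \<Phi>"
  by (simp add: Dist_def)

lemma Dist_le_iff: "\<Phi> \<sqsubseteq>\<^bsub>hom DK A B\<^esub> \<Psi> \<longleftrightarrow> (\<forall>b\<in>elts B. \<forall>a\<in>elts A. \<Phi> b a \<le> \<Psi> b a)"
  by (simp add: Dist_def)

lemma Dist_eq_iff: "\<Phi> .=\<^bsub>hom DK A B\<^esub> \<Psi> \<longleftrightarrow> \<Phi> = \<Psi>"
  by (simp add: Dist_def)

lemma Dist_idt: "idt DK A = (\<lambda>b\<in>elts A. \<lambda>a\<in>elts A. ehom A b a)"
  by (simp add: Dist_def)

lemma Dist_cmp: "cmp DK A B C \<Psi> \<Phi> = (\<lambda>c\<in>elts C. \<lambda>a\<in>elts A. SUP b\<in>elts B. \<Psi> c b * \<Phi> b a)"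
  by (simp add: Dist_def)

lemma Dist_ext:
  assumes "\<Phi> \<in> arr DK A B" "\<Psi> \<in> arr DK A B"
    and "\<And>a b. a \<in> elts A \<Longrightarrow> b \<in> elts B \<Longrightarrow> \<Phi> b a = \<Psi> b a"
  shows "\<Phi> = \<Psi>"
proof (rule extensionalityI)
  show "\<Phi> b = \<Psi> b" if b: "b \<in> elts B" for b
    by (rule extensionalityI[of _ "elts A"]) (use assms b in \<open>auto simp: Dist_arr_iff\<close>)
qed (use assms in \<open>auto simp: Dist_arr_iff\<close>)

lemma distD:
  assumes "\<Phi> \<in> arr DK A B"
  shows "\<And>a b. a \<in> elts A \<Longrightarrow> b \<in> elts B \<Longrightarrow> \<Phi> b a * ty A a = \<Phi> b a"
    "\<And>a b. a \<in> elts A \<Longrightarrow> b \<in> elts B \<Longrightarrow> ty B b * \<Phi> b a = \<Phi> b a"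
    "\<And>a b c. a \<in> elts A \<Longrightarrow> b \<in> elts B \<Longrightarrow> c \<in> elts B \<Longrightarrow> ehom B b c * \<Phi> c a \<le> \<Phi> b a"
    "\<And>a b c. a \<in> elts A \<Longrightarrow> c \<in> elts A \<Longrightarrow> b \<in> elts B \<Longrightarrow> \<Phi> b c * ehom A c a \<le> \<Phi> b a"
  using assms by (auto simp: Dist_arr_iff distributor_Idm_iff)

lemma Dist_arrI:
  assumes "distributor (Idm TYPE('q)) A B \<Phi>"
  shows "(\<lambda>b\<in>elts B. \<lambda>a\<in>elts A. \<Phi> b a) \<in> arr DK A B"
  using assms by (auto simp: Dist_arr_iff distributor_Idm_iff)

lemma Dist_unit_left:
  assumes A: "A \<in> ob K" and B: "B \<in> ob K" and \<Phi>: "\<Phi> \<in> arr DK A B" and a: "a \<in> elts A" and b: "b \<in> elts B"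
  shows "(SUP c\<in>elts B. ehom B b c * \<Phi> c a) = \<Phi> b a"
proof (rule antisym)
  interpret B: idem_category B using B by (rule Ord_ob_idem)
  show "(SUP c\<in>elts B. ehom B b c * \<Phi> c a) \<le> \<Phi> b a"
    using distD[OF \<Phi>] a b by (intro SUP_least) blast
  have "\<Phi> b a = ty B b * \<Phi> b a" using distD[OF \<Phi>] a b by simp
  also have "\<dots> \<le> ehom B b b * \<Phi> b a" using b by (intro quantale_mult_mono B.ty_le_hom) auto
  also have "\<dots> \<le> (SUP c\<in>elts B. ehom B b c * \<Phi> c a)" using b by (rule SUP_upper)
  finally show "\<Phi> b a \<le> (SUP c\<in>elts B. ehom B b c * \<Phi> c a)" .
qed

lemma Dist_unit_right:
  assumes A: "A \<in> ob K" and B: "B \<in> ob K" and \<Phi>: "\<Phi> \<in> arr DK A B" and a: "a \<in> elts A" and b: "b \<in> elts B"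
  shows "(SUP c\<in>elts A. \<Phi> b c * ehom A c a) = \<Phi> b a"
proof (rule antisym)
  interpret A: idem_category A using A by (rule Ord_ob_idem)
  show "(SUP c\<in>elts A. \<Phi> b c * ehom A c a) \<le> \<Phi> b a"
    using distD[OF \<Phi>] a b by (intro SUP_least) blast
  have "\<Phi> b a = \<Phi> b a * ty A a" using distD[OF \<Phi>] a b by simp
  also have "\<dots> \<le> \<Phi> b a * ehom A a a" using a by (intro quantale_mult_mono A.ty_le_hom) auto
  also have "\<dots> \<le> (SUP c\<in>elts A. \<Phi> b c * ehom A c a)" using a by (rule SUP_upper)
  finally show "\<Phi> b a \<le> (SUP c\<in>elts A. \<Phi> b c * ehom A c a)" .
qed

lemma locally_ordered_Dist: "locally_ordered_category DK"
proof (rule locally_ordered_category.intro, unfold Dist_ob)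
  fix A B :: "('u, 'q, 'q) ecat"
  have antisym: "\<Phi> = \<Psi>" if "\<Phi> \<in> arr DK A B" "\<Psi> \<in> arr DK A B"
    "\<forall>b\<in>elts B. \<forall>a\<in>elts A. \<Phi> b a \<le> \<Psi> b a" "\<forall>b\<in>elts B. \<forall>a\<in>elts A. \<Psi> b a \<le> \<Phi> b a" for \<Phi> \<Psi>
    using that by (intro Dist_ext[of _ A B]) (auto intro: order_antisym)
  show "weak_partial_order (hom DK A B)"
    by unfold_locales (auto simp: Dist_eq_iff Dist_le_iff intro: antisym, meson order_trans)
next
  fix A assume "A \<in> ob K"
  then interpret A: idem_category A by (rule Ord_ob_idem)
  show "idt DK A \<in> arr DK A A"
    unfolding Dist_idt
    by (rule Dist_arrI) (auto simp: distributor_Idm_iff A.hom_ty A.ty_hom A.hom_hom)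
next
  fix A B C \<Phi> \<Psi> assume A: "A \<in> ob K" and B: "B \<in> ob K" and C: "C \<in> ob K"
    and \<Phi>: "\<Phi> \<in> arr DK A B" and \<Psi>: "\<Psi> \<in> arr DK B C"
  show "cmp DK A B C \<Psi> \<Phi> \<in> arr DK A C"
    unfolding Dist_cmp
  proof (rule Dist_arrI)
    show "distributor (Idm TYPE('q)) A C (\<lambda>c a. SUP b\<in>elts B. \<Psi> c b * \<Phi> b a)"
      unfolding distributor_Idm_iff
    proof (intro conjI ballI)
      fix a c d assume *: "a \<in> elts A" "c \<in> elts C"
      show "(SUP b\<in>elts B. \<Psi> c b * \<Phi> b a) * ty A a = (SUP b\<in>elts B. \<Psi> c b * \<Phi> b a)"
        using * distD(1)[OF \<Phi>] by (simp add: SUP_mult mult.assoc cong: SUP_cong)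
      show "ty C c * (SUP b\<in>elts B. \<Psi> c b * \<Phi> b a) = (SUP b\<in>elts B. \<Psi> c b * \<Phi> b a)"
        using * distD(2)[OF \<Psi>] by (simp add: mult_SUP mult.assoc[symmetric] cong: SUP_cong)
      show "ehom C c d * (SUP b\<in>elts B. \<Psi> d b * \<Phi> b a) \<le> (SUP b\<in>elts B. \<Psi> c b * \<Phi> b a)"
        if "d \<in> elts C" using * that by (intro mult_SUP_mult_mono distD[OF \<Psi>]) auto
      show "(SUP b\<in>elts B. \<Psi> c b * \<Phi> b d) * ehom A d a \<le> (SUP b\<in>elts B. \<Psi> c b * \<Phi> b a)"
        if "d \<in> elts A" using * that by (intro SUP_mult_mult_mono distD[OF \<Phi>]) auto
    qed
  qed
  fix \<Phi>' \<Psi>' assume "\<Phi>' \<in> arr DK A B" "\<Psi>' \<in> arr DK B C"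
    and "\<Phi> \<sqsubseteq>\<^bsub>hom DK A B\<^esub> \<Phi>'" "\<Psi> \<sqsubseteq>\<^bsub>hom DK B C\<^esub> \<Psi>'"
  then show "cmp DK A B C \<Psi> \<Phi> \<sqsubseteq>\<^bsub>hom DK A C\<^esub> cmp DK A B C \<Psi>' \<Phi>'"
    by (auto simp: Dist_le_iff Dist_cmp intro!: SUP_subset_mono quantale_mult_mono)
next
  fix A B \<Phi> assume A: "A \<in> ob K" and B: "B \<in> ob K" and \<Phi>: "\<Phi> \<in> arr DK A B"
  have "cmp DK A A B \<Phi> (idt DK A) = (\<lambda>b\<in>elts B. \<lambda>a\<in>elts A. \<Phi> b a)"
    unfolding Dist_cmp Dist_idt
    using Dist_unit_right[OF A B \<Phi>] by (simp cong: restrict_cong SUP_cong)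
  also have "\<dots> = \<Phi>"
    using \<Phi> Dist_arrI[of A B \<Phi>] by (intro Dist_ext[of _ A B]) (auto simp: Dist_arr_iff)
  finally show "cmp DK A A B \<Phi> (idt DK A) = \<Phi>" .
  have "cmp DK A B B (idt DK B) \<Phi> = (\<lambda>b\<in>elts B. \<lambda>a\<in>elts A. \<Phi> b a)"
    unfolding Dist_cmp Dist_idt
    using Dist_unit_left[OF A B \<Phi>] by (simp cong: restrict_cong SUP_cong)
  also have "\<dots> = \<Phi>"
    using \<Phi> Dist_arrI[of A B \<Phi>] by (intro Dist_ext[of _ A B]) (auto simp: Dist_arr_iff)
  finally show "cmp DK A B B (idt DK B) \<Phi> = \<Phi>" .
next
  fix A B C D :: "('u, 'q, 'q) ecat" and \<Phi> \<Psi> \<Omega>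
  have "(SUP c\<in>elts C. \<Omega> d c * (SUP b\<in>elts B. \<Psi> c b * \<Phi> b a)) =
      (SUP b\<in>elts B. (SUP c\<in>elts C. \<Omega> d c * \<Psi> c b) * \<Phi> b a)" for \<Omega> \<Psi> \<Phi> :: "'u \<Rightarrow> 'u \<Rightarrow> 'q" and d a
    by (simp add: mult_SUP SUP_mult mult.assoc) (rule SUP_commute)
  then show "cmp DK A C D \<Omega> (cmp DK A B C \<Psi> \<Phi>) = cmp DK A B D (cmp DK B C D \<Omega> \<Psi>) \<Phi>"
    unfolding Dist_cmp by (simp cong: restrict_cong SUP_cong)
qed

text \<open>
  Here commutativity enters: multiplication by \<open>q\<close> can be moved past the homs and past the
  elements of any distributor.
\<close>

sublocale D: scalar_category DK scalar
proof (rule scalar_category.intro[OF locally_ordered_Dist], rule scalar_category_axioms.intro, unfold Dist_ob)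
  interpret D: locally_ordered_category DK by (rule locally_ordered_Dist)
  show "\<Phi> = \<Psi>" if "\<Phi> \<in> arr DK A B" "\<Psi> \<in> arr DK A B" "D.eqv A B \<Phi> \<Psi>" for A B \<Phi> \<Psi>
    using that by (intro Dist_ext[of _ A B]) (auto simp: D.eqv_def Dist_le_iff intro: antisym)
  fix A assume A: "A \<in> ob K"
  interpret A: idem_category A using A by (rule Ord_ob_idem)
  show "scalar q A \<in> arr DK A A" for q
    unfolding scalar_def
  proof (rule Dist_arrI, unfold distributor_Idm_iff, intro conjI ballI)
    fix a b c assume *: "a \<in> elts A" "b \<in> elts A"
    show "q * ehom A b a * ty A a = q * ehom A b a" "ty A b * (q * ehom A b a) = q * ehom A b a"
      using A.hom_ty[OF *] A.ty_hom[OF *] by (simp_all add: mult.assoc mult.left_commute[of _ q])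
    assume c: "c \<in> elts A"
    show "ehom A b c * (q * ehom A c a) \<le> q * ehom A b a" "q * ehom A b c * ehom A c a \<le> q * ehom A b a"
      using A.hom_hom[OF *(1) c *(2)]
      by (auto simp: mult.assoc mult.left_commute[of _ q] intro: quantale_mult_mono)
  qed
  show "scalar p A \<sqsubseteq>\<^bsub>hom DK A A\<^esub> scalar q A" if "p \<le> q" for p q
    using that by (auto simp: Dist_le_iff scalar_def intro: quantale_mult_mono)
  show "scalar (p * q) A = cmp DK A A A (scalar p A) (scalar q A)" for p q
  proof -
    have "(SUP c\<in>elts A. (p * ehom A b c) * (q * ehom A c a)) = p * q * ehom A b a"
      if "a \<in> elts A" "b \<in> elts A" for a b
    proof -
      have "(SUP c\<in>elts A. ehom A b c * idt DK A c a) = ehom A b a"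
        using Dist_unit_left[OF A A D.idt_arr that] A that by (simp add: Dist_ob) (simp add: Dist_idt)
      then have "p * q * (SUP c\<in>elts A. ehom A b c * ehom A c a) = p * q * ehom A b a"
        using that by (simp add: Dist_idt cong: SUP_cong)
      then show ?thesis by (simp add: mult_SUP mult.assoc mult.left_commute[of q])
    qed
    then show ?thesis by (simp add: Dist_cmp scalar_def cong: restrict_cong SUP_cong)
  qed
  fix B \<Phi> q assume B: "B \<in> ob K" and \<Phi>: "\<Phi> \<in> arr DK A B"
  have "(SUP c\<in>elts B. (q * ehom B b c) * \<Phi> c a) = (SUP c\<in>elts A. \<Phi> b c * (q * ehom A c a))"
    if "a \<in> elts A" "b \<in> elts B" for a b
  proof -
    have "(SUP c\<in>elts B. (q * ehom B b c) * \<Phi> c a) = q * \<Phi> b a"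
      using Dist_unit_left[OF A B \<Phi> that] by (simp add: mult.assoc mult_SUP[symmetric])
    moreover have "(SUP c\<in>elts A. \<Phi> b c * (q * ehom A c a)) = q * \<Phi> b a"
      using Dist_unit_right[OF A B \<Phi> that] by (simp add: mult.left_commute[of _ q] mult_SUP[symmetric])
    ultimately show ?thesis by simp
  qed
  then show "cmp DK A B B (scalar q B) \<Phi> = cmp DK A A B \<Phi> (scalar q A)"
    by (simp add: Dist_cmp scalar_def cong: restrict_cong SUP_cong)
qed

text \<open>
  For an element \<open>a\<close> of \<open>A\<close> the family is tested on the distributor \<open>\<Phi>(y,x) = A(y,a) \<cdot> A0(s,x)\<close>.  At \<open>x = s\<close>
  the equation \<open>z' \<otimes> \<Phi> = \<Phi> \<otimes> z\<close> reads \<open>z'(y,a) = A(y,a) \<cdot> z(s,s)\<close>, so that \<open>z(s,s)\<close> is the scalar.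
\<close>

lemma unit_element_detects_scalars:
  assumes A0: "A0 \<in> ob K" and s: "s \<in> elts A0" "ty A0 s = 1" "ehom A0 s s = 1"
  shows "D.detects_scalars A0"
  unfolding D.detects_scalars_def Dist_ob
proof (intro conjI allI impI ballI A0)
  interpret A0: idem_category A0 using A0 by (rule Ord_ob_idem)
  show "p \<le> q" if "scalar p A0 \<sqsubseteq>\<^bsub>hom DK A0 A0\<^esub> scalar q A0" for p q
    using that s unfolding Dist_le_iff scalar_def by fastforce
  fix z assume z: "z \<in> arr DK A0 A0"
  show "\<exists>q. \<forall>A\<in>ob K. \<forall>z'\<in>arr DK A A.
    (\<forall>\<Phi>\<in>arr DK A0 A. cmp DK A0 A A z' \<Phi> = cmp DK A0 A0 A \<Phi> z) \<longrightarrow> z' = scalar q A"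
  proof (intro exI ballI impI)
    fix A z' assume A: "A \<in> ob K" and z': "z' \<in> arr DK A A"
      and *: "\<forall>\<Phi>\<in>arr DK A0 A. cmp DK A0 A A z' \<Phi> = cmp DK A0 A0 A \<Phi> z"
    interpret A: idem_category A using A by (rule Ord_ob_idem)
    show "z' = scalar (z s s) A"
    proof (rule Dist_ext[OF z' D.sc_arr])
      show "A \<in> ob DK" using A by (simp add: Dist_ob)
      fix a b assume a: "a \<in> elts A" and b: "b \<in> elts A"
      define \<Phi> where "\<Phi> = (\<lambda>y\<in>elts A. \<lambda>x\<in>elts A0. ehom A y a * ehom A0 s x)"
      have "distributor (Idm TYPE('q)) A0 A (\<lambda>y x. ehom A y a * ehom A0 s x)"
        unfolding distributor_Idm_iff
      proof (intro conjI ballI)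
        fix x y assume x: "x \<in> elts A0" and y: "y \<in> elts A"
        show "ehom A y a * ehom A0 s x * ty A0 x = ehom A y a * ehom A0 s x"
          using A0.hom_ty[OF x s(1)] by (simp add: mult.assoc)
        show "ty A y * (ehom A y a * ehom A0 s x) = ehom A y a * ehom A0 s x"
          using A.ty_hom[OF a y] by (simp add: mult.assoc[symmetric])
        show "ehom A y y' * (ehom A y' a * ehom A0 s x) \<le> ehom A y a * ehom A0 s x" if "y' \<in> elts A" for y'
          unfolding mult.assoc[symmetric] using a y that by (intro quantale_mult_mono A.hom_hom order_refl)
        show "ehom A y a * ehom A0 s x' * ehom A0 x' x \<le> ehom A y a * ehom A0 s x" if "x' \<in> elts A0" for x'
          unfolding mult.assoc using x s that by (intro quantale_mult_mono A0.hom_hom order_refl)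
      qed
      then have "\<Phi> \<in> arr DK A0 A" unfolding \<Phi>_def by (rule Dist_arrI)
      then have "cmp DK A0 A A z' \<Phi> b s = cmp DK A0 A0 A \<Phi> z b s" using * by simp
      then have "(SUP y\<in>elts A. z' b y * ehom A y a) = (SUP x\<in>elts A0. ehom A b a * ehom A0 s x * z x s)"
        using b s by (simp add: Dist_cmp \<Phi>_def cong: SUP_cong)
      also have "\<dots> = ehom A b a * z s s"
        using Dist_unit_left[OF A0 A0 z s(1) s(1)] by (simp add: mult.assoc mult_SUP[symmetric])
      finally show "z' b a = scalar (z s s) A b a"
        using Dist_unit_right[OF A A z' a b] a b by (simp add: scalar_def mult.commute)
    qed
  qed
qed

text \<open>
  The Cauchy completion of the one-element category on the idempotent \<open>1\<close>.
\<close>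

lemma unit_element_exists:
  obtains A0 s where "A0 \<in> ob K" "s \<in> elts A0" "ty A0 s = 1" "ehom A0 s s = 1"
proof -
  define D :: "(unit, 'q, 'q) ecat" where "D = \<lparr>elts = UNIV, ty = (\<lambda>_. 1), ehom = (\<lambda>_ _. 1)\<rparr>"
  define X :: "(unit, 'q, 'q) ecat" where "X = \<lparr>elts = {}, ty = (\<lambda>_. 1), ehom = (\<lambda>_ _. 1)\<rparr>"
  have D: "idem_category D" by unfold_locales (auto simp: D_def)
  have t: "tiny (elts D)" "tiny (elts X)"
    using tiny_singleton[of "()"] tiny_subset by (auto simp: D_def X_def UNIV_unit)
  show ?thesis
    by (rule realise_distributor[OF exponents D t(1), of X "\<lambda>_ _. 1"])
      (use t that in \<open>auto simp: X_def D_def Ord_ob_iff\<close>)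
qed

end

section \<open>Transport of distributors along an equivalence\<close>

context small_quantale
begin

lemma cospan_value_arr:
  assumes c: "K.cospan A B c"
  shows "cospan_value A B c \<in> arr DK A B"
proof -
  obtain X f g where c': "c = (X, f, g)" "X \<in> ob K" "f \<in> arr K A X" "g \<in> arr K B X"
    using c by (cases c) (auto simp: K.cospan_def)
  interpret X: idem_category X using c'(2) by (rule Ord_ob_idem)
  note f' = arrD[OF c'(3)] and g' = arrD[OF c'(4)]
  show ?thesis
    unfolding c'(1) cospan_value_def prod.case
  proof (rule Dist_arrI, unfold distributor_Idm_iff, intro conjI ballI)
    fix a b assume a: "a \<in> elts A" and b: "b \<in> elts B"
    show "ehom X (g b) (f a) * ty A a = ehom X (g b) (f a)" "ty B b * ehom X (g b) (f a) = ehom X (g b) (f a)"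
      using X.hom_ty[of "f a" "g b"] X.ty_hom[of "f a" "g b"] f' g' a b by simp_all
    show "ehom B b d * ehom X (g d) (f a) \<le> ehom X (g b) (f a)" if "d \<in> elts B" for d
      using f' g' a b that by (intro X.le_hom_trans[where b = "g d"]) auto
    show "ehom X (g b) (f d) * ehom A d a \<le> ehom X (g b) (f a)" if "d \<in> elts A" for d
      using f' g' a b that by (intro X.le_hom_trans[where b = "f d"]) auto
  qed
qed

lemma cospan_value_surj:
  assumes A: "A \<in> ob K" and B: "B \<in> ob K" and \<Phi>: "\<Phi> \<in> arr DK A B"
  obtains X f g where "X \<in> ob K" "f \<in> arr K A X" "g \<in> arr K B X" "cospan_value A B (X, f, g) = \<Phi>"
proof -
  obtain X f g where c: "X \<in> ob K" "f \<in> arr K A X" "g \<in> arr K B X"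
    "\<And>a b. a \<in> elts A \<Longrightarrow> b \<in> elts B \<Longrightarrow> ehom X (g b) (f a) = \<Phi> b a"
    using distributor_cospan[OF A B, of \<Phi>] \<Phi> unfolding Dist_arr_iff by blast
  then have "cospan_value A B (X, f, g) = \<Phi>"
    using \<Phi> cospan_value_arr[of A B "(X, f, g)"]
    by (intro Dist_ext[of _ A B]) (auto simp: K.cospan_def cospan_value_app)
  then show ?thesis using that c by blast
qed

lemma distributor_eq_cospan_value:
  assumes "A \<in> ob K" "B \<in> ob K" "\<Phi> \<in> arr DK A B"
  obtains c where "K.cospan A B c" "cospan_value A B c = \<Phi>"
proof -
  obtain X f g where "X \<in> ob K" "f \<in> arr K A X" "g \<in> arr K B X" "cospan_value A B (X, f, g) = \<Phi>"
    by (rule cospan_value_surj[OF assms])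
  then show ?thesis using that[of "(X, f, g)"] by (simp add: K.cospan_def)
qed

lemma cospan_value_eqv:
  assumes A: "A \<in> ob K" and B: "B \<in> ob K" and X: "X \<in> ob K"
    and f: "f \<in> arr K A X" "f' \<in> arr K A X" "K.eqv A X f f'"
    and g: "g \<in> arr K B X" "g' \<in> arr K B X" "K.eqv B X g g'"
  shows "cospan_value A B (X, f, g) = cospan_value A B (X, f', g')"
  unfolding cospan_value_def prod.case
  using hom_cong_eqv[OF X A B f g] by (simp cong: restrict_cong)

lemma cospan_value_retraction:
  assumes A: "A \<in> ob K" and B: "B \<in> ob K" and X: "X \<in> ob K" and Y: "Y \<in> ob K"
    and f: "f \<in> arr K A X" and g: "g \<in> arr K B X" and e: "K.retraction X Y e' e"
  shows "cospan_value A B (Y, cmp K A X Y e f, cmp K B X Y e g) = cospan_value A B (X, f, g)"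
  unfolding cospan_value_def prod.case
  using retraction_full_faithful[OF X Y e] arrD(1)[OF f] arrD(1)[OF g]
  by (simp add: cmp_app cong: restrict_cong)

end

locale Ord_weak_equivalence =
  C: small_quantale small Q + D: small_quantale small R +
  weak_equivalence "Ord small TYPE('q::comm_quantale)" "Ord small TYPE('r::comm_quantale)" F
  for small :: "'u set \<Rightarrow> bool" and Q :: "'q::comm_quantale itself" and R :: "'r::comm_quantale itself"
    and F :: "(('u, 'q, 'q) ecat, 'u \<Rightarrow> 'u, ('u, 'r, 'r) ecat, 'u \<Rightarrow> 'u) fctr"
begin

abbreviation cospan_image ::
  "('u, 'q, 'q) ecat \<Rightarrow> ('u, 'q, 'q) ecat \<Rightarrow> ('u, 'q, 'q) ecat \<times> ('u \<Rightarrow> 'u) \<times> ('u \<Rightarrow> 'u) \<Rightarrow> 'u \<Rightarrow> 'u \<Rightarrow> 'r" where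
  "cospan_image A B c \<equiv> case c of (X, f, g) \<Rightarrow>
     D.cospan_value (fob F A) (fob F B) (fob F X, farr F A X f, farr F B X g)"

text \<open>
  The action on distributors of an equivalence that is only given on functors.  By
  \<open>cospan_image_le_iff\<close> it does not depend on the choice of the cospan.
\<close>

definition transport :: "('u, 'q, 'q) ecat \<Rightarrow> ('u, 'q, 'q) ecat \<Rightarrow> ('u \<Rightarrow> 'u \<Rightarrow> 'q) \<Rightarrow> 'u \<Rightarrow> 'u \<Rightarrow> 'r" where
  "transport A B \<Phi> = cospan_image A B (SOME c. C.K.cospan A B c \<and> C.cospan_value A B c = \<Phi>)"

lemma cospan_image_arr:
  assumes "A \<in> ob C.K" "B \<in> ob C.K" "C.K.cospan A B c"
  shows "cospan_image A B c \<in> arr D.DK (fob F A) (fob F B)"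
  using assms F_ob F_arr
  by (cases c) (auto intro!: D.cospan_value_arr simp: C.K.cospan_def D.K.cospan_def)

lemma cospan_image_le_iff:
  assumes A: "A \<in> ob C.K" and B: "B \<in> ob C.K" and c: "C.K.cospan A B c" and d: "C.K.cospan A B d"
  shows "cospan_image A B c \<sqsubseteq>\<^bsub>hom D.DK (fob F A) (fob F B)\<^esub> cospan_image A B d \<longleftrightarrow>
    C.cospan_value A B c \<sqsubseteq>\<^bsub>hom C.DK A B\<^esub> C.cospan_value A B d"
proof -
  obtain X f g where c': "c = (X, f, g)" "X \<in> ob C.K" "f \<in> arr C.K A X" "g \<in> arr C.K B X"
    using c by (cases c) (auto simp: C.K.cospan_def)
  obtain Y u v where d': "d = (Y, u, v)" "Y \<in> ob C.K" "u \<in> arr C.K A Y" "v \<in> arr C.K B Y"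
    using d by (cases d) (auto simp: C.K.cospan_def)
  show ?thesis
    using F_cospan_le_iff[OF A B c'(2-4) d'(2-4)] C.cospan_le_iff[OF A B c'(2-4) d'(2-4)]
      D.cospan_le_iff[OF F_ob[OF A] F_ob[OF B] F_ob[OF c'(2)] F_arr[OF A c'(2,3)] F_arr[OF B c'(2,4)]
        F_ob[OF d'(2)] F_arr[OF A d'(2,3)] F_arr[OF B d'(2,4)]]
    by (auto simp: c' d' C.cospan_value_app D.cospan_value_app C.Dist_le_iff D.Dist_le_iff)
qed

lemma transport_cospan:
  assumes A: "A \<in> ob C.K" and B: "B \<in> ob C.K" and c: "C.K.cospan A B c"
  shows "transport A B (C.cospan_value A B c) = cospan_image A B c"
proof -
  define d where "d = (SOME d. C.K.cospan A B d \<and> C.cospan_value A B d = C.cospan_value A B c)"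
  have "C.K.cospan A B d \<and> C.cospan_value A B d = C.cospan_value A B c"
    unfolding d_def by (rule someI[of _ c]) (use c in simp)
  then have d: "C.K.cospan A B d" "C.cospan_value A B d = C.cospan_value A B c" by auto
  have le: "C.cospan_value A B c \<sqsubseteq>\<^bsub>hom C.DK A B\<^esub> C.cospan_value A B c"
    by (simp add: C.Dist_le_iff)
  have "cospan_image A B d = cospan_image A B c"
  proof (rule D.D.arr_antisym)
    show "D.D.eqv (fob F A) (fob F B) (cospan_image A B d) (cospan_image A B c)"
      unfolding D.D.eqv_def cospan_image_le_iff[OF A B d(1) c] cospan_image_le_iff[OF A B c d(1)] d(2) using le by simp
  qed (use A B c d cospan_image_arr F_ob in \<open>auto simp: D.Dist_ob\<close>)
  then show ?thesis by (simp add: transport_def d_def[symmetric])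
qed

lemma transport_cospan_value:
  assumes A: "A \<in> ob C.K" and B: "B \<in> ob C.K" and X: "X \<in> ob C.K" "f \<in> arr C.K A X" "g \<in> arr C.K B X"
  shows "transport A B (C.cospan_value A B (X, f, g)) =
    D.cospan_value (fob F A) (fob F B) (fob F X, farr F A X f, farr F B X g)"
  using transport_cospan[OF A B, of "(X, f, g)"] X by (simp add: C.K.cospan_def)

lemma cospan_value_lifts:
  assumes A: "A \<in> ob C.K" and B: "B \<in> ob C.K" and Z: "Z \<in> ob D.K" and W: "W \<in> ob C.K"
    and e: "D.K.retraction Z (fob F W) e' e" and p: "lifts Z W e A p f" and q: "lifts Z W e B q g"
  shows "D.cospan_value (fob F A) (fob F B) (Z, p, q) =
    D.cospan_value (fob F A) (fob F B) (fob F W, farr F A W f, farr F B W g)"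
proof -
  note ob = F_ob[OF A] F_ob[OF B] F_ob[OF W]
  have e': "e \<in> arr D.K Z (fob F W)" using e by (simp add: D.K.retraction_def)
  have arrs: "p \<in> arr D.K (fob F A) Z" "q \<in> arr D.K (fob F B) Z" "f \<in> arr C.K A W" "g \<in> arr C.K B W"
    using p q by (auto simp: lifts_def)
  have "D.cospan_value (fob F A) (fob F B) (Z, p, q) = D.cospan_value (fob F A) (fob F B)
      (fob F W, cmp D.K (fob F A) Z (fob F W) e p, cmp D.K (fob F B) Z (fob F W) e q)"
    using D.cospan_value_retraction[OF ob(1,2) Z ob(3) arrs(1,2) e] by simp
  also have "\<dots> = D.cospan_value (fob F A) (fob F B) (fob F W, farr F A W f, farr F B W g)"
    using p q D.K.cmp_arr[OF ob(1) Z ob(3) arrs(1) e'] D.K.cmp_arr[OF ob(2) Z ob(3) arrs(2) e']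
      F_arr[OF A W arrs(3)] F_arr[OF B W arrs(4)]
    by (intro D.cospan_value_eqv ob) (auto simp: lifts_def)
  finally show ?thesis .
qed

lemma transport_full:
  assumes A: "A \<in> ob C.K" and B: "B \<in> ob C.K" and \<Psi>: "\<Psi> \<in> arr D.DK (fob F A) (fob F B)"
  shows "\<exists>\<Phi>\<in>arr C.DK A B. \<Psi> = transport A B \<Phi>"
proof -
  obtain Z p q where Z: "Z \<in> ob D.K" "p \<in> arr D.K (fob F A) Z" "q \<in> arr D.K (fob F B) Z"
    "D.cospan_value (fob F A) (fob F B) (Z, p, q) = \<Psi>"
    using D.cospan_value_surj[OF F_ob[OF A] F_ob[OF B] \<Psi>] by blast
  obtain W e e' where W: "W \<in> ob C.K" and e: "D.K.retraction Z (fob F W) e' e"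
    and lift: "\<And>X u. X \<in> ob C.K \<Longrightarrow> u \<in> arr D.K (fob F X) Z \<Longrightarrow> \<exists>u0. lifts Z W e X u u0"
    using lifts_exist[OF Z(1)] by metis
  obtain f g where f: "lifts Z W e A p f" and g: "lifts Z W e B q g"
    using lift[OF A Z(2)] lift[OF B Z(3)] by blast
  then have fg: "f \<in> arr C.K A W" "g \<in> arr C.K B W" by (auto simp: lifts_def)
  have "\<Psi> = transport A B (C.cospan_value A B (W, f, g))"
    using cospan_value_lifts[OF A B Z(1) W e f g] Z(4) transport_cospan_value[OF A B W fg] by simp
  then show ?thesis
    using C.cospan_value_arr[of A B "(W, f, g)"] W fg by (auto simp: C.K.cospan_def)
qed

lemma transport_le_iff:
  assumes A: "A \<in> ob C.K" and B: "B \<in> ob C.K" and \<Phi>: "\<Phi> \<in> arr C.DK A B" "\<Psi> \<in> arr C.DK A B"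
  shows "transport A B \<Phi> \<sqsubseteq>\<^bsub>hom D.DK (fob F A) (fob F B)\<^esub> transport A B \<Psi> \<longleftrightarrow> \<Phi> \<sqsubseteq>\<^bsub>hom C.DK A B\<^esub> \<Psi>"
proof -
  obtain c where c: "C.K.cospan A B c" "C.cospan_value A B c = \<Phi>"
    by (rule C.distributor_eq_cospan_value[OF A B \<Phi>(1)])
  obtain d where d: "C.K.cospan A B d" "C.cospan_value A B d = \<Psi>"
    by (rule C.distributor_eq_cospan_value[OF A B \<Phi>(2)])
  show ?thesis
    using transport_cospan[OF A B c(1)] transport_cospan[OF A B d(1)] cospan_image_le_iff[OF A B c(1) d(1)]
    by (simp add: c(2) d(2))
qed

lemma transport_arr:
  assumes A: "A \<in> ob C.K" and B: "B \<in> ob C.K" and \<Phi>: "\<Phi> \<in> arr C.DK A B"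
  shows "transport A B \<Phi> \<in> arr D.DK (fob F A) (fob F B)"
proof -
  obtain c where c: "C.K.cospan A B c" "C.cospan_value A B c = \<Phi>"
    by (rule C.distributor_eq_cospan_value[OF A B \<Phi>])
  then show ?thesis using transport_cospan[OF A B c(1)] cospan_image_arr[OF A B c(1)] by simp
qed

text \<open>
  Both inequalities come from the description of the composite as a least cospan: the image of a
  composite in \<open>C\<close> is an upper bound in \<open>D\<close>, and the composite in \<open>D\<close> lifts to an upper bound in \<open>C\<close>.
\<close>

lemma transport_cmp:
  assumes A: "A \<in> ob C.K" and B: "B \<in> ob C.K" and Z: "Z \<in> ob C.K"
    and \<Phi>: "\<Phi> \<in> arr C.DK A B" and \<Psi>: "\<Psi> \<in> arr C.DK B Z"
  shows "transport A Z (cmp C.DK A B Z \<Psi> \<Phi>) =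
    cmp D.DK (fob F A) (fob F B) (fob F Z) (transport B Z \<Psi>) (transport A B \<Phi>)"
proof -
  obtain X f g where X: "X \<in> ob C.K" "f \<in> arr C.K A X" "g \<in> arr C.K B X"
    and \<Phi>_val: "C.cospan_value A B (X, f, g) = \<Phi>"
    using C.cospan_value_surj[OF A B \<Phi>] by blast
  obtain Y u v where Y: "Y \<in> ob C.K" "u \<in> arr C.K B Y" "v \<in> arr C.K Z Y"
    and \<Psi>_val: "C.cospan_value B Z (Y, u, v) = \<Psi>"
    using C.cospan_value_surj[OF B Z \<Psi>] by blast
  let ?A = "fob F A" and ?B = "fob F B" and ?Z = "fob F Z" and ?X = "fob F X" and ?Y = "fob F Y"
  note ob = F_ob[OF A] F_ob[OF B] F_ob[OF Z] F_ob[OF X(1)] F_ob[OF Y(1)]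
  note FX = ob(4) F_arr[OF A X(1,2)] F_arr[OF B X(1,3)] and FY = ob(5) F_arr[OF B Y(1,2)] F_arr[OF Z Y(1,3)]
  have \<Psi>\<Phi>: "cmp C.DK A B Z \<Psi> \<Phi> \<in> arr C.DK A Z"
    using C.D.cmp_arr \<Phi> \<Psi> A B Z by (simp add: C.Dist_ob)
  have T\<Phi>: "transport A B \<Phi> = D.cospan_value ?A ?B (?X, farr F A X f, farr F B X g)"
    using transport_cospan_value[OF A B X] by (simp add: \<Phi>_val)
  have T\<Psi>: "transport B Z \<Psi> = D.cospan_value ?B ?Z (?Y, farr F B Y u, farr F Z Y v)"
    using transport_cospan_value[OF B Z Y] by (simp add: \<Psi>_val)
  have C_cmp: "cmp C.DK A B Z \<Psi> \<Phi> c a = (SUP b\<in>elts B. ehom Y (v c) (u b) * ehom X (g b) (f a))"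
    if "a \<in> elts A" "c \<in> elts Z" for a c
    using that unfolding \<Phi>_val[symmetric] \<Psi>_val[symmetric]
    by (simp add: C.Dist_cmp C.cospan_value_app cong: SUP_cong)
  have D_cmp: "cmp D.DK ?A ?B ?Z (transport B Z \<Psi>) (transport A B \<Phi>) c a =
      (SUP b\<in>elts ?B. ehom ?Y (farr F Z Y v c) (farr F B Y u b) * ehom ?X (farr F B X g b) (farr F A X f a))"
    if "a \<in> elts ?A" "c \<in> elts ?Z" for a c
    using that unfolding T\<Phi> T\<Psi> by (simp add: D.Dist_cmp D.cospan_value_app cong: SUP_cong)
  have T_arr: "transport A Z (cmp C.DK A B Z \<Psi> \<Phi>) \<in> arr D.DK ?A ?Z"
    by (rule transport_arr[OF A Z \<Psi>\<Phi>])
  have cmp_T_arr: "cmp D.DK ?A ?B ?Z (transport B Z \<Psi>) (transport A B \<Phi>) \<in> arr D.DK ?A ?Z"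
    using D.D.cmp_arr transport_arr[OF A B \<Phi>] transport_arr[OF B Z \<Psi>] ob by (simp add: D.Dist_ob)
  have ge: "cmp D.DK ?A ?B ?Z (transport B Z \<Psi>) (transport A B \<Phi>) \<sqsubseteq>\<^bsub>hom D.DK ?A ?Z\<^esub>
      transport A Z (cmp C.DK A B Z \<Psi> \<Phi>)"
  proof -
    obtain E h k where E: "E \<in> ob C.K" "h \<in> arr C.K Y E" "k \<in> arr C.K X E"
      and le: "C.K.le2 B E (cmp C.K B Y E h u) (cmp C.K B X E k g)"
      and val: "\<And>a c. a \<in> elts A \<Longrightarrow> c \<in> elts Z \<Longrightarrow>
        ehom E (h (v c)) (k (f a)) = (SUP b\<in>elts B. ehom Y (v c) (u b) * ehom X (g b) (f a))"
      using C.cospan_composite_exists[OF X Y] by blast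
    have kf: "cmp C.K A X E k f \<in> arr C.K A E" and hv: "cmp C.K Z Y E h v \<in> arr C.K Z E"
      using C.K.cmp_arr A Z X Y E by auto
    have "cmp C.DK A B Z \<Psi> \<Phi> = C.cospan_value A Z (E, cmp C.K A X E k f, cmp C.K Z Y E h v)"
      using C.cospan_value_arr[of A Z "(E, cmp C.K A X E k f, cmp C.K Z Y E h v)"] E(1) kf hv
      by (intro C.Dist_ext[OF \<Psi>\<Phi>]) (auto simp: C_cmp val C.cospan_value_app C.cmp_app C.K.cospan_def)
    then have "transport A Z (cmp C.DK A B Z \<Psi> \<Phi>) =
        D.cospan_value ?A ?Z (fob F E, farr F A E (cmp C.K A X E k f), farr F Z E (cmp C.K Z Y E h v))"
      using transport_cospan_value[OF A Z E(1) kf hv] by simp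
    also have "\<dots> = D.cospan_value ?A ?Z (fob F E, cmp D.K ?A ?X (fob F E) (farr F X E k) (farr F A X f),
        cmp D.K ?Z ?Y (fob F E) (farr F Y E h) (farr F Z Y v))"
      using F_cmp[OF A X(1) E(1) X(2) E(3)] F_cmp[OF Z Y(1) E(1) Y(3) E(2)] F_arr[OF A E(1) kf] F_arr[OF Z E(1) hv]
        D.K.cmp_arr[OF ob(1,4) F_ob[OF E(1)] FX(2) F_arr[OF X(1) E(1,3)]]
        D.K.cmp_arr[OF ob(3,5) F_ob[OF E(1)] FY(3) F_arr[OF Y(1) E(1,2)]]
      by (intro D.cospan_value_eqv ob F_ob[OF E(1)])
    finally have T: "transport A Z (cmp C.DK A B Z \<Psi> \<Phi>) =
        D.cospan_value ?A ?Z (fob F E, cmp D.K ?A ?X (fob F E) (farr F X E k) (farr F A X f),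
          cmp D.K ?Z ?Y (fob F E) (farr F Y E h) (farr F Z Y v))" .
    have "D.K.le2 ?B (fob F E) (cmp D.K ?B ?Y (fob F E) (farr F Y E h) (farr F B Y u))
        (cmp D.K ?B ?X (fob F E) (farr F X E k) (farr F B X g))"
      using F_cmp_le2_iff[OF B Y(1) X(1) E(1) Y(2) E(2) X(3) E(3)] le by blast
    from D.cospan_composite_least[OF FX FY F_ob[OF E(1)] F_arr[OF Y(1) E(1,2)] F_arr[OF X(1) E(1,3)] this]
    show ?thesis
      by (auto simp: D.Dist_le_iff D_cmp T D.cospan_value_app D.cmp_app)
  qed
  have le: "transport A Z (cmp C.DK A B Z \<Psi> \<Phi>) \<sqsubseteq>\<^bsub>hom D.DK ?A ?Z\<^esub>
      cmp D.DK ?A ?B ?Z (transport B Z \<Psi>) (transport A B \<Phi>)"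
  proof -
    obtain E h k where E: "E \<in> ob D.K" "h \<in> arr D.K ?Y E" "k \<in> arr D.K ?X E"
      and le: "D.K.le2 ?B E (cmp D.K ?B ?Y E h (farr F B Y u)) (cmp D.K ?B ?X E k (farr F B X g))"
      and val: "\<And>a c. a \<in> elts ?A \<Longrightarrow> c \<in> elts ?Z \<Longrightarrow> ehom E (h (farr F Z Y v c)) (k (farr F A X f a)) =
        (SUP b\<in>elts ?B. ehom ?Y (farr F Z Y v c) (farr F B Y u b) * ehom ?X (farr F B X g b) (farr F A X f a))"
      using D.cospan_composite_exists[OF FX FY] by blast
    obtain W e e' where W: "W \<in> ob C.K" and e: "D.K.retraction E (fob F W) e' e"
      and lift: "\<And>X u. X \<in> ob C.K \<Longrightarrow> u \<in> arr D.K (fob F X) E \<Longrightarrow> \<exists>u0. lifts E W e X u u0"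
      using lifts_exist[OF E(1)] by metis
    have e': "e \<in> arr D.K E (fob F W)" using e by (simp add: D.K.retraction_def)
    obtain h0 k0 where h0: "lifts E W e Y h h0" and k0: "lifts E W e X k k0"
      using lift[OF Y(1) E(2)] lift[OF X(1) E(3)] by blast
    then have hk: "h0 \<in> arr C.K Y W" "k0 \<in> arr C.K X W" by (auto simp: lifts_def)
    have kf: "cmp C.K A X W k0 f \<in> arr C.K A W" and hv: "cmp C.K Z Y W h0 v \<in> arr C.K Z W"
      using C.K.cmp_arr A Z X Y W hk by auto
    have "C.K.le2 B W (cmp C.K B Y W h0 u) (cmp C.K B X W k0 g)"
      using lifts_le2_iff[OF E(1) W e B lifts_cmp[OF E(1) W e' Y(1) h0 B Y(2)] lifts_cmp[OF E(1) W e' X(1) k0 B X(3)]]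
        le by simp
    from C.cospan_composite_least[OF X Y W hk this]
    have "cmp C.DK A B Z \<Psi> \<Phi> \<sqsubseteq>\<^bsub>hom C.DK A Z\<^esub> C.cospan_value A Z (W, cmp C.K A X W k0 f, cmp C.K Z Y W h0 v)"
      by (auto simp: C.Dist_le_iff C_cmp C.cospan_value_app C.cmp_app)
    then have "transport A Z (cmp C.DK A B Z \<Psi> \<Phi>) \<sqsubseteq>\<^bsub>hom D.DK ?A ?Z\<^esub>
        transport A Z (C.cospan_value A Z (W, cmp C.K A X W k0 f, cmp C.K Z Y W h0 v))"
      using transport_le_iff[OF A Z \<Psi>\<Phi>] C.cospan_value_arr[of A Z "(W, cmp C.K A X W k0 f, cmp C.K Z Y W h0 v)"]
        W kf hv by (simp add: C.K.cospan_def)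
    also have "transport A Z (C.cospan_value A Z (W, cmp C.K A X W k0 f, cmp C.K Z Y W h0 v)) =
        D.cospan_value ?A ?Z (E, cmp D.K ?A ?X E k (farr F A X f), cmp D.K ?Z ?Y E h (farr F Z Y v))"
      using transport_cospan_value[OF A Z W kf hv] cospan_value_lifts[OF A Z E(1) W e
          lifts_cmp[OF E(1) W e' X(1) k0 A X(2)] lifts_cmp[OF E(1) W e' Y(1) h0 Z Y(3)]] by simp
    finally show ?thesis
      by (auto simp: D.Dist_le_iff D_cmp D.cospan_value_app D.cmp_app val)
  qed
  show ?thesis
    using le ge ob by (intro D.D.arr_antisym[OF _ _ T_arr cmp_T_arr]) (simp_all add: D.D.eqv_def D.Dist_ob)
qed

lemma scalar_equivalence: "scalar_equivalence C.DK scalar D.DK scalar (fob F) transport"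
proof (intro scalar_equivalence.intro scalar_equivalence_axioms.intro C.D.scalar_category_axioms
    D.D.scalar_category_axioms, unfold C.Dist_ob D.Dist_ob)
qed (use F_ob transport_arr transport_le_iff transport_cmp transport_full in auto)

text \<open>
  The object of \<open>D\<close> with a unit element need not lie in the image of \<open>F\<close>, but it is equivalent to some
  \<open>F A1\<close>, and the equivalence carries the unit element along.
\<close>

theorem quantale_iso_exists: "\<exists>\<phi> :: 'q \<Rightarrow> 'r. quantale_iso \<phi>"
proof -
  obtain A0 s where A0: "A0 \<in> ob C.K" "s \<in> elts A0" "ty A0 s = 1" "ehom A0 s s = 1"
    using C.unit_element_exists by blast
  obtain B0 s' where B0: "B0 \<in> ob D.K" "s' \<in> elts B0" "ty B0 s' = 1" "ehom B0 s' s' = 1"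
    using D.unit_element_exists by blast
  obtain A1 e e' where A1: "A1 \<in> ob C.K" "D.K.retraction B0 (fob F A1) e' e"
    using F_surj[OF B0(1)] by blast
  then have e: "e \<in> arr D.K B0 (fob F A1)" by (simp add: D.K.retraction_def)
  have "e s' \<in> elts (fob F A1)" "ty (fob F A1) (e s') = 1" "ehom (fob F A1) (e s') (e s') = 1"
    using D.arrD[OF e] D.retraction_full_faithful[OF B0(1) F_ob[OF A1(1)] A1(2) B0(2,2)] B0 by simp_all
  then have "D.D.detects_scalars (fob F A1)"
    using D.unit_element_detects_scalars[OF F_ob[OF A1(1)]] by blast
  moreover have "C.D.detects_scalars A0" using C.unit_element_detects_scalars A0 by blast
  ultimately show ?thesis
    using scalar_equivalence.scalars_iso[OF scalar_equivalence] A1(1) by (simp add: C.Dist_ob)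
qed

end

theorem Ord_biequivalent_imp_iso:
  fixes small :: "'u set \<Rightarrow> bool"
  assumes "universe small"
    and "closed_under_exponents small TYPE('q::comm_quantale)"
    and "closed_under_exponents small TYPE('r::comm_quantale)"
    and bi: "Ord small TYPE('q) \<simeq>\<^sub>b Ord small TYPE('r)"
  shows "\<exists>\<phi> :: 'q \<Rightarrow> 'r. quantale_iso \<phi>"
proof -
  have C: "small_quantale small TYPE('q)" and D: "small_quantale small TYPE('r)"
    using assms by (simp_all add: small_quantale_def small_quantale_axioms_def)
  obtain F where F: "weak_equivalence (Ord small TYPE('q)) (Ord small TYPE('r)) F"
    using biequivalent_weak_equivalence[OF small_quantale.locally_ordered_Ord[OF C]
        small_quantale.locally_ordered_Ord[OF D] bi] by blast
  show ?thesis
    using Ord_weak_equivalence.quantale_iso_exists[OF Ord_weak_equivalence.intro[OF C D F]] .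
qed

section \<open>The quantaloid \<open>Sup\<close>\<close>

lemma is_lub_iff:
  assumes "A \<subseteq> carrier L"
  shows "is_lub L s A \<longleftrightarrow> s \<in> carrier L \<and> (\<forall>a\<in>A. a \<sqsubseteq>\<^bsub>L\<^esub> s) \<and>
    (\<forall>y\<in>carrier L. (\<forall>a\<in>A. a \<sqsubseteq>\<^bsub>L\<^esub> y) \<longrightarrow> s \<sqsubseteq>\<^bsub>L\<^esub> y)"
  using assms unfolding least_def Upper_def by blast

context
  fixes L :: "('a, 'b) gorder_scheme"
  assumes L: "Complete_Lattice.complete_lattice L"
begin

interpretation L: Complete_Lattice.complete_lattice L by (rule L)

lemma complete_lattice_sup_lub:
  assumes "A \<subseteq> carrier L" shows "is_lub L (\<Squnion>\<^bsub>L\<^esub> A) A"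
  using L.sup_exists[OF assms] unfolding Lattice.sup_def by (rule someI_ex)

lemma complete_lattice_sup_closed: "A \<subseteq> carrier L \<Longrightarrow> \<Squnion>\<^bsub>L\<^esub> A \<in> carrier L"
  using complete_lattice_sup_lub by (simp add: is_lub_iff)

lemma complete_lattice_sup_upper: "A \<subseteq> carrier L \<Longrightarrow> a \<in> A \<Longrightarrow> a \<sqsubseteq>\<^bsub>L\<^esub> \<Squnion>\<^bsub>L\<^esub> A"
  using complete_lattice_sup_lub by (simp add: is_lub_iff)

lemma complete_lattice_sup_least:
  "A \<subseteq> carrier L \<Longrightarrow> y \<in> carrier L \<Longrightarrow> (\<And>a. a \<in> A \<Longrightarrow> a \<sqsubseteq>\<^bsub>L\<^esub> y) \<Longrightarrow> \<Squnion>\<^bsub>L\<^esub> A \<sqsubseteq>\<^bsub>L\<^esub> y"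
  using complete_lattice_sup_lub by (simp add: is_lub_iff)

lemma complete_lattice_antisym:
  "x \<in> carrier L \<Longrightarrow> y \<in> carrier L \<Longrightarrow> x \<sqsubseteq>\<^bsub>L\<^esub> y \<Longrightarrow> y \<sqsubseteq>\<^bsub>L\<^esub> x \<Longrightarrow> x = y"
  by (rule L.le_antisym)

lemma complete_lattice_refl: "x \<in> carrier L \<Longrightarrow> x \<sqsubseteq>\<^bsub>L\<^esub> x"
  by (rule L.le_refl)

lemma complete_lattice_trans:
  "x \<sqsubseteq>\<^bsub>L\<^esub> y \<Longrightarrow> y \<sqsubseteq>\<^bsub>L\<^esub> z \<Longrightarrow> x \<in> carrier L \<Longrightarrow> y \<in> carrier L \<Longrightarrow> z \<in> carrier L \<Longrightarrow> x \<sqsubseteq>\<^bsub>L\<^esub> z"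
  by (rule L.le_trans)

lemma complete_lattice_sup_eqI: "is_lub L s A \<Longrightarrow> \<Squnion>\<^bsub>L\<^esub> A = s"
  by (rule L.sup_eqI)

end

lemma sup_preserving_closed: "sup_preserving L M f \<Longrightarrow> x \<in> carrier L \<Longrightarrow> f x \<in> carrier M"
  by (auto simp: sup_preserving_def)

lemma sup_preserving_mono:
  assumes L: "Complete_Lattice.complete_lattice L" and M: "Complete_Lattice.complete_lattice M"
    and f: "sup_preserving L M f" and x: "x \<in> carrier L" "y \<in> carrier L" "x \<sqsubseteq>\<^bsub>L\<^esub> y"
  shows "f x \<sqsubseteq>\<^bsub>M\<^esub> f y"
proof -
  have "is_lub L y {x, y}"
    using x complete_lattice_refl[OF L] by (subst is_lub_iff) auto
  then have "f y = \<Squnion>\<^bsub>M\<^esub> (f ` {x, y})"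
    using f x complete_lattice_sup_eqI[OF L] unfolding sup_preserving_def
    by (metis empty_subsetI insert_subset)
  then show ?thesis
    using complete_lattice_sup_upper[OF M, of "f ` {x, y}" "f x"] sup_preserving_closed[OF f] x by auto
qed

lemma Sup_quantaloid_simps [simp]:
  "ob (Sup_quantaloid small) = {L. Complete_Lattice.complete_lattice L \<and> small (carrier L)}"
  "carrier (hom (Sup_quantaloid small) L M) = {f \<in> extensional (carrier L). sup_preserving L M f}"
  "le (hom (Sup_quantaloid small) L M) = (\<lambda>f g. \<forall>x\<in>carrier L. f x \<sqsubseteq>\<^bsub>M\<^esub> g x)"
  "eq (hom (Sup_quantaloid small) L M) = (=)"
  "idt (Sup_quantaloid small) L = (\<lambda>x\<in>carrier L. x)"
  "cmp (Sup_quantaloid small) L M N g f = compose (carrier L) g f"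
  by (simp_all add: Sup_quantaloid_def)

lemma partial_order_Sup_hom:
  assumes M: "Complete_Lattice.complete_lattice M"
  shows "partial_order (hom (Sup_quantaloid small) L M)"
proof unfold_locales
  fix f g assume le: "f \<sqsubseteq>\<^bsub>hom (Sup_quantaloid small) L M\<^esub> g" "g \<sqsubseteq>\<^bsub>hom (Sup_quantaloid small) L M\<^esub> f"
    and arr: "f \<in> arr (Sup_quantaloid small) L M" "g \<in> arr (Sup_quantaloid small) L M"
  have "f x = g x" if "x \<in> carrier L" for x
    using le arr that by (intro complete_lattice_antisym[OF M]) (auto intro: sup_preserving_closed)
  then show "f .=\<^bsub>hom (Sup_quantaloid small) L M\<^esub> g"
    using arr by (auto intro: extensionalityI)
next
  fix f g h
  assume le: "f \<sqsubseteq>\<^bsub>hom (Sup_quantaloid small) L M\<^esub> g" "g \<sqsubseteq>\<^bsub>hom (Sup_quantaloid small) L M\<^esub> h"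
    and arr: "f \<in> arr (Sup_quantaloid small) L M" "g \<in> arr (Sup_quantaloid small) L M"
      "h \<in> arr (Sup_quantaloid small) L M"
  have "f x \<sqsubseteq>\<^bsub>M\<^esub> h x" if x: "x \<in> carrier L" for x
    by (rule complete_lattice_trans[OF M, of _ "g x"])
      (use le arr x in \<open>auto intro: sup_preserving_closed\<close>)
  then show "f \<sqsubseteq>\<^bsub>hom (Sup_quantaloid small) L M\<^esub> h" by simp
qed (auto intro: complete_lattice_refl[OF M] sup_preserving_closed)

text \<open>
  Suprema of sup-preserving maps are computed pointwise, because suprema commute with suprema.
\<close>

lemma Sup_hom_lub:
  assumes L: "Complete_Lattice.complete_lattice L" and M: "Complete_Lattice.complete_lattice M"
    and A: "A \<subseteq> arr (Sup_quantaloid small) L M"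
  shows "is_lub (hom (Sup_quantaloid small) L M) (\<lambda>x\<in>carrier L. \<Squnion>\<^bsub>M\<^esub> ((\<lambda>f. f x) ` A)) A"
proof -
  define s where "s = (\<lambda>x\<in>carrier L. \<Squnion>\<^bsub>M\<^esub> ((\<lambda>f. f x) ` A))"
  have closed: "(\<lambda>f. f x) ` A \<subseteq> carrier M" if "x \<in> carrier L" for x
    using A that sup_preserving_closed by fastforce
  have s_closed: "s x \<in> carrier M" if "x \<in> carrier L" for x
    using complete_lattice_sup_closed[OF M closed[OF that]] that by (simp add: s_def)
  have upper: "f x \<sqsubseteq>\<^bsub>M\<^esub> s x" if "f \<in> A" "x \<in> carrier L" for f x
    using complete_lattice_sup_upper[OF M closed[OF that(2)]] that by (simp add: s_def)
  have least: "s x \<sqsubseteq>\<^bsub>M\<^esub> y" if "x \<in> carrier L" "y \<in> carrier M" "\<And>f. f \<in> A \<Longrightarrow> f x \<sqsubseteq>\<^bsub>M\<^esub> y" for x y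
    using complete_lattice_sup_least[OF M closed[OF that(1)] that(2)] that by (auto simp: s_def)
  have "sup_preserving L M s"
    unfolding sup_preserving_def
  proof (intro conjI allI impI)
    show "s \<in> carrier L \<rightarrow> carrier M" using s_closed by auto
    fix X assume X: "X \<subseteq> carrier L"
    then have sX: "s ` X \<subseteq> carrier M" "\<Squnion>\<^bsub>L\<^esub> X \<in> carrier L"
      using s_closed complete_lattice_sup_closed[OF L] by auto
    have f: "f (\<Squnion>\<^bsub>L\<^esub> X) = \<Squnion>\<^bsub>M\<^esub> (f ` X)" "f ` X \<subseteq> carrier M" if "f \<in> A" for f
    proof -
      have sp: "sup_preserving L M f" using A that by auto
      then show "f (\<Squnion>\<^bsub>L\<^esub> X) = \<Squnion>\<^bsub>M\<^esub> (f ` X)" using X by (simp add: sup_preserving_def)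
      show "f ` X \<subseteq> carrier M" using sup_preserving_closed[OF sp] X by auto
    qed
    show "s (\<Squnion>\<^bsub>L\<^esub> X) = \<Squnion>\<^bsub>M\<^esub> (s ` X)"
    proof (rule complete_lattice_antisym[OF M s_closed[OF sX(2)] complete_lattice_sup_closed[OF M sX(1)]])
      show "s (\<Squnion>\<^bsub>L\<^esub> X) \<sqsubseteq>\<^bsub>M\<^esub> \<Squnion>\<^bsub>M\<^esub> (s ` X)"
      proof (rule least[OF sX(2) complete_lattice_sup_closed[OF M sX(1)]])
        fix f assume fA: "f \<in> A"
        show "f (\<Squnion>\<^bsub>L\<^esub> X) \<sqsubseteq>\<^bsub>M\<^esub> \<Squnion>\<^bsub>M\<^esub> (s ` X)"
          unfolding f(1)[OF fA]
        proof (rule complete_lattice_sup_least[OF M f(2)[OF fA] complete_lattice_sup_closed[OF M sX(1)]])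
          fix y assume "y \<in> f ` X"
          then obtain x where x: "x \<in> X" "y = f x" by auto
          show "y \<sqsubseteq>\<^bsub>M\<^esub> \<Squnion>\<^bsub>M\<^esub> (s ` X)"
            unfolding x(2)
          proof (rule complete_lattice_trans[OF M upper[OF fA]])
            show "s x \<sqsubseteq>\<^bsub>M\<^esub> \<Squnion>\<^bsub>M\<^esub> (s ` X)" using x by (intro complete_lattice_sup_upper[OF M sX(1)]) auto
          qed (use x X f(2)[OF fA] sX s_closed complete_lattice_sup_closed[OF M sX(1)] in auto)
        qed
      qed
      show "\<Squnion>\<^bsub>M\<^esub> (s ` X) \<sqsubseteq>\<^bsub>M\<^esub> s (\<Squnion>\<^bsub>L\<^esub> X)"
      proof (rule complete_lattice_sup_least[OF M sX(1) s_closed[OF sX(2)]])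
        fix y assume "y \<in> s ` X"
        then obtain x where x: "x \<in> X" "y = s x" by auto
        show "y \<sqsubseteq>\<^bsub>M\<^esub> s (\<Squnion>\<^bsub>L\<^esub> X)"
          unfolding x(2)
        proof (rule least[OF _ s_closed[OF sX(2)]])
          show "x \<in> carrier L" using x X by auto
          fix g assume g: "g \<in> A"
          have "g x \<sqsubseteq>\<^bsub>M\<^esub> g (\<Squnion>\<^bsub>L\<^esub> X)"
            unfolding f(1)[OF g] using x by (intro complete_lattice_sup_upper[OF M f(2)[OF g]]) auto
          then show "g x \<sqsubseteq>\<^bsub>M\<^esub> s (\<Squnion>\<^bsub>L\<^esub> X)"
            by (rule complete_lattice_trans[OF M _ upper[OF g sX(2)]])
              (use f[OF g] x s_closed[OF sX(2)] complete_lattice_sup_closed[OF M f(2)[OF g]] in auto)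
        qed
      qed
    qed
  qed
  then have "s \<in> arr (Sup_quantaloid small) L M" by (simp add: s_def)
  then have "is_lub (hom (Sup_quantaloid small) L M) s A"
    unfolding is_lub_iff[OF A]
  proof (intro conjI ballI impI)
    fix g assume g: "g \<in> arr (Sup_quantaloid small) L M"
      and "\<forall>f\<in>A. f \<sqsubseteq>\<^bsub>hom (Sup_quantaloid small) L M\<^esub> g"
    then have "s x \<sqsubseteq>\<^bsub>M\<^esub> g x" if "x \<in> carrier L" for x
      using that sup_preserving_closed[of L M g x] by (intro least) auto
    then show "s \<sqsubseteq>\<^bsub>hom (Sup_quantaloid small) L M\<^esub> g" by simp
  qed (use upper in auto)
  then show ?thesis unfolding s_def .
qed

lemma complete_lattice_Sup_hom:
  assumes "Complete_Lattice.complete_lattice L" "Complete_Lattice.complete_lattice M"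
  shows "Complete_Lattice.complete_lattice (hom (Sup_quantaloid small) L M)"
  using partial_order.complete_lattice_if_lubs[OF partial_order_Sup_hom[OF assms(2)]]
    Sup_hom_lub[OF assms] by blast

lemma Sup_hom_sup:
  assumes "Complete_Lattice.complete_lattice L" "Complete_Lattice.complete_lattice M"
    "A \<subseteq> arr (Sup_quantaloid small) L M"
  shows "\<Squnion>\<^bsub>hom (Sup_quantaloid small) L M\<^esub> A = (\<lambda>x\<in>carrier L. \<Squnion>\<^bsub>M\<^esub> ((\<lambda>f. f x) ` A))"
  by (rule complete_lattice_sup_eqI[OF complete_lattice_Sup_hom[OF assms(1,2)] Sup_hom_lub[OF assms]])

lemma sup_preserving_compose:
  assumes L: "Complete_Lattice.complete_lattice L" and f: "sup_preserving L M f" and g: "sup_preserving M N g"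
  shows "sup_preserving L N (compose (carrier L) g f)"
  unfolding sup_preserving_def
proof (intro conjI allI impI)
  show "compose (carrier L) g f \<in> carrier L \<rightarrow> carrier N"
    using sup_preserving_closed[OF f] sup_preserving_closed[OF g] by (auto simp: compose_eq)
  fix A assume A: "A \<subseteq> carrier L"
  have "compose (carrier L) g f (\<Squnion>\<^bsub>L\<^esub> A) = g (\<Squnion>\<^bsub>M\<^esub> (f ` A))"
    using f A complete_lattice_sup_closed[OF L A] by (simp add: compose_eq sup_preserving_def)
  also have "\<dots> = \<Squnion>\<^bsub>N\<^esub> (g ` f ` A)"
    using g A sup_preserving_closed[OF f] by (subst g[unfolded sup_preserving_def, THEN conjunct2, rule_format]) auto
  also have "g ` f ` A = compose (carrier L) g f ` A"
    using A by (auto simp: compose_def image_image subset_iff intro!: image_cong)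
  finally show "compose (carrier L) g f (\<Squnion>\<^bsub>L\<^esub> A) = \<Squnion>\<^bsub>N\<^esub> (compose (carrier L) g f ` A)" .
qed

lemma quantaloid_Sup: "quantaloid (Sup_quantaloid small)"
proof (rule quantaloid.intro[OF locally_ordered_category.intro quantaloid_axioms.intro])
  fix L M N :: "'a gorder" assume L: "L \<in> ob (Sup_quantaloid small)" and M: "M \<in> ob (Sup_quantaloid small)"
  then have cl: "Complete_Lattice.complete_lattice L" "Complete_Lattice.complete_lattice M" by auto
  show "Complete_Lattice.complete_lattice (hom (Sup_quantaloid small) L M)"
    by (rule complete_lattice_Sup_hom[OF cl])
  then show "weak_partial_order (hom (Sup_quantaloid small) L M)"
    by (meson complete_lattice.axioms(1) partial_order.axioms(1))
  show "cmp (Sup_quantaloid small) L L M f (idt (Sup_quantaloid small) L) = f"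
    "cmp (Sup_quantaloid small) L M M (idt (Sup_quantaloid small) M) f = f"
    if "f \<in> arr (Sup_quantaloid small) L M" for f
    using that by (auto simp: compose_def restrict_def extensional_def fun_eq_iff sup_preserving_def Pi_iff)
next
  fix L :: "'a gorder" assume L: "L \<in> ob (Sup_quantaloid small)"
  then have "(\<lambda>x\<in>carrier L. x) ` A = A" if "A \<subseteq> carrier L" for A
    using that by (auto simp: image_iff subset_iff)
  then show "idt (Sup_quantaloid small) L \<in> arr (Sup_quantaloid small) L L"
    using L by (auto simp: sup_preserving_def complete_lattice_sup_closed)
next
  fix L M N :: "'a gorder" and f g assume L: "L \<in> ob (Sup_quantaloid small)"
    and f: "f \<in> arr (Sup_quantaloid small) L M" and g: "g \<in> arr (Sup_quantaloid small) M N"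
  then show "cmp (Sup_quantaloid small) L M N g f \<in> arr (Sup_quantaloid small) L N"
    by (auto intro: sup_preserving_compose)
next
  fix L M N P :: "'a gorder" and f g h assume "f \<in> arr (Sup_quantaloid small) L M"
  then show "cmp (Sup_quantaloid small) L N P h (cmp (Sup_quantaloid small) L M N g f) =
      cmp (Sup_quantaloid small) L M P (cmp (Sup_quantaloid small) M N P h g) f"
    by (auto simp: compose_def fun_eq_iff sup_preserving_def)
next
  fix L M N :: "'a gorder" and f f' g g'
  assume ob: "L \<in> ob (Sup_quantaloid small)" "M \<in> ob (Sup_quantaloid small)" "N \<in> ob (Sup_quantaloid small)"
    and f: "f \<in> arr (Sup_quantaloid small) L M" "f' \<in> arr (Sup_quantaloid small) L M"
    and g: "g \<in> arr (Sup_quantaloid small) M N" "g' \<in> arr (Sup_quantaloid small) M N"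
    and le: "f \<sqsubseteq>\<^bsub>hom (Sup_quantaloid small) L M\<^esub> f'" "g \<sqsubseteq>\<^bsub>hom (Sup_quantaloid small) M N\<^esub> g'"
  have cl: "Complete_Lattice.complete_lattice M" "Complete_Lattice.complete_lattice N" using ob by auto
  have "g (f x) \<sqsubseteq>\<^bsub>N\<^esub> g' (f' x)" if x: "x \<in> carrier L" for x
  proof -
    have fx: "f x \<in> carrier M" "f' x \<in> carrier M" using f x sup_preserving_closed by auto
    have "g (f x) \<sqsubseteq>\<^bsub>N\<^esub> g (f' x)" using sup_preserving_mono[OF cl _ fx] g le x by auto
    then show ?thesis
      by (rule complete_lattice_trans[OF cl(2)]) (use le fx g sup_preserving_closed in auto)
  qed
  then show "cmp (Sup_quantaloid small) L M N g f \<sqsubseteq>\<^bsub>hom (Sup_quantaloid small) L N\<^esub>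
      cmp (Sup_quantaloid small) L M N g' f'"
    by (simp add: compose_eq)
next
  fix L M N :: "'a gorder" and g
  assume ob: "L \<in> ob (Sup_quantaloid small)" "M \<in> ob (Sup_quantaloid small)" "N \<in> ob (Sup_quantaloid small)"
    and g: "g \<in> arr (Sup_quantaloid small) M N"
  have cl: "Complete_Lattice.complete_lattice L" "Complete_Lattice.complete_lattice M"
    "Complete_Lattice.complete_lattice N" using ob by auto
  show "sup_preserving (hom (Sup_quantaloid small) L M) (hom (Sup_quantaloid small) L N)
      (\<lambda>f. cmp (Sup_quantaloid small) L M N g f)"
    unfolding sup_preserving_def
  proof (intro conjI allI impI)
    show "cmp (Sup_quantaloid small) L M N g \<in> arr (Sup_quantaloid small) L M \<rightarrow> arr (Sup_quantaloid small) L N"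
      using g by (auto intro: sup_preserving_compose[OF cl(1)])
    fix A assume A: "A \<subseteq> arr (Sup_quantaloid small) L M"
    have gA: "cmp (Sup_quantaloid small) L M N g ` A \<subseteq> arr (Sup_quantaloid small) L N"
      using A g by (auto intro!: sup_preserving_compose[OF cl(1)])
    have "g (\<Squnion>\<^bsub>M\<^esub> ((\<lambda>f. f x) ` A)) = \<Squnion>\<^bsub>N\<^esub> ((\<lambda>f. g (f x)) ` A)" if x: "x \<in> carrier L" for x
    proof -
      have "(\<lambda>f. f x) ` A \<subseteq> carrier M" using A x by (auto intro: sup_preserving_closed)
      then have "g (\<Squnion>\<^bsub>M\<^esub> ((\<lambda>f. f x) ` A)) = \<Squnion>\<^bsub>N\<^esub> (g ` (\<lambda>f. f x) ` A)"
        using g by (simp add: sup_preserving_def)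
      then show ?thesis by (simp only: image_image)
    qed
    then show "cmp (Sup_quantaloid small) L M N g (\<Squnion>\<^bsub>hom (Sup_quantaloid small) L M\<^esub> A) =
        \<Squnion>\<^bsub>hom (Sup_quantaloid small) L N\<^esub> (cmp (Sup_quantaloid small) L M N g ` A)"
      unfolding Sup_hom_sup[OF cl(1,2) A] Sup_hom_sup[OF cl(1,3) gA]
      by (auto simp: compose_def image_image fun_eq_iff)
  qed
next
  fix L M N :: "'a gorder" and f
  assume ob: "L \<in> ob (Sup_quantaloid small)" "M \<in> ob (Sup_quantaloid small)" "N \<in> ob (Sup_quantaloid small)"
    and f: "f \<in> arr (Sup_quantaloid small) L M"
  have cl: "Complete_Lattice.complete_lattice L" "Complete_Lattice.complete_lattice M"
    "Complete_Lattice.complete_lattice N" using ob by auto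
  show "sup_preserving (hom (Sup_quantaloid small) M N) (hom (Sup_quantaloid small) L N)
      (\<lambda>g. cmp (Sup_quantaloid small) L M N g f)"
    unfolding sup_preserving_def
  proof (intro conjI allI impI)
    show "(\<lambda>g. cmp (Sup_quantaloid small) L M N g f) \<in> arr (Sup_quantaloid small) M N \<rightarrow> arr (Sup_quantaloid small) L N"
      using f by (auto intro: sup_preserving_compose[OF cl(1)])
    fix A assume A: "A \<subseteq> arr (Sup_quantaloid small) M N"
    have Af: "(\<lambda>g. cmp (Sup_quantaloid small) L M N g f) ` A \<subseteq> arr (Sup_quantaloid small) L N"
      using A f by (auto intro!: sup_preserving_compose[OF cl(1)])
    show "cmp (Sup_quantaloid small) L M N (\<Squnion>\<^bsub>hom (Sup_quantaloid small) M N\<^esub> A) f =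
        \<Squnion>\<^bsub>hom (Sup_quantaloid small) L N\<^esub> ((\<lambda>g. cmp (Sup_quantaloid small) L M N g f) ` A)"
      unfolding Sup_hom_sup[OF cl(2,3) A] Sup_hom_sup[OF cl(1,3) Af]
      using f sup_preserving_closed by (fastforce simp: compose_def image_image fun_eq_iff)
  qed
qed

section \<open>Quantaloids of homomorphisms\<close>

lemma quantaloid_homD:
  assumes "quantaloid_hom Q R F"
  shows "\<And>X. X \<in> ob Q \<Longrightarrow> fob F X \<in> ob R" "\<And>X. X \<in> ob Q \<Longrightarrow> farr F X X (idt Q X) = idt R (fob F X)"
    "\<And>X Y. X \<in> ob Q \<Longrightarrow> Y \<in> ob Q \<Longrightarrow> sup_preserving (hom Q X Y) (hom R (fob F X) (fob F Y)) (farr F X Y)"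
    "\<And>X Y f. X \<in> ob Q \<Longrightarrow> Y \<in> ob Q \<Longrightarrow> f \<in> arr Q X Y \<Longrightarrow> farr F X Y f \<in> arr R (fob F X) (fob F Y)"
    "\<And>X Y Z f g. X \<in> ob Q \<Longrightarrow> Y \<in> ob Q \<Longrightarrow> Z \<in> ob Q \<Longrightarrow> f \<in> arr Q X Y \<Longrightarrow> g \<in> arr Q Y Z \<Longrightarrow>
        farr F X Z (cmp Q X Y Z g f) =
        cmp R (fob F X) (fob F Y) (fob F Z) (farr F Y Z g) (farr F X Y f)"
  using assms unfolding quantaloid_hom_def by (auto intro: sup_preserving_closed)

lemma hom_quantaloid_simps:
  "ob (hom_quantaloid Q R) = {F. quantaloid_hom Q R F}"
  "\<alpha> \<in> arr (hom_quantaloid Q R) F G \<longleftrightarrow> \<alpha> \<in> extensional (ob Q) \<and>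
     (\<forall>X\<in>ob Q. \<alpha> X \<in> arr R (fob F X) (fob G X)) \<and>
     (\<forall>X\<in>ob Q. \<forall>Y\<in>ob Q. \<forall>f\<in>arr Q X Y.
        cmp R (fob F X) (fob F Y) (fob G Y) (\<alpha> Y) (farr F X Y f) =
        cmp R (fob F X) (fob G X) (fob G Y) (farr G X Y f) (\<alpha> X))"
  "\<alpha> \<sqsubseteq>\<^bsub>hom (hom_quantaloid Q R) F G\<^esub> \<beta> \<longleftrightarrow> (\<forall>X\<in>ob Q. \<alpha> X \<sqsubseteq>\<^bsub>hom R (fob F X) (fob G X)\<^esub> \<beta> X)"
  "\<alpha> .=\<^bsub>hom (hom_quantaloid Q R) F G\<^esub> \<beta> \<longleftrightarrow> \<alpha> = \<beta>"
  "idt (hom_quantaloid Q R) F = (\<lambda>X\<in>ob Q. idt R (fob F X))"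
  "cmp (hom_quantaloid Q R) F G H \<beta> \<alpha> = (\<lambda>X\<in>ob Q. cmp R (fob F X) (fob G X) (fob H X) (\<beta> X) (\<alpha> X))"
  by (auto simp: hom_quantaloid_def PiE_def)

context
  fixes Q :: "('o, 'm) ocat" and R :: "('p, 'n) ocat"
  assumes R: "quantaloid R"
begin

interpretation R: quantaloid R by (rule R)

lemma partial_order_hom_quantaloid:
  assumes F: "quantaloid_hom Q R F" and G: "quantaloid_hom Q R G"
  shows "partial_order (hom (hom_quantaloid Q R) F G)"
proof -
  have cl: "Complete_Lattice.complete_lattice (hom R (fob F X) (fob G X))" if "X \<in> ob Q" for X
    using R.hom_complete quantaloid_homD(1)[OF F that] quantaloid_homD(1)[OF G that] by blast
  show ?thesis
  proof unfold_locales
    fix \<alpha> \<beta> assume arr: "\<alpha> \<in> arr (hom_quantaloid Q R) F G" "\<beta> \<in> arr (hom_quantaloid Q R) F G"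
      and le: "\<alpha> \<sqsubseteq>\<^bsub>hom (hom_quantaloid Q R) F G\<^esub> \<beta>" "\<beta> \<sqsubseteq>\<^bsub>hom (hom_quantaloid Q R) F G\<^esub> \<alpha>"
    have "\<alpha> X = \<beta> X" if "X \<in> ob Q" for X
      using arr le that by (intro complete_lattice_antisym[OF cl]) (auto simp: hom_quantaloid_simps)
    then show "\<alpha> .=\<^bsub>hom (hom_quantaloid Q R) F G\<^esub> \<beta>"
      using arr by (auto simp: hom_quantaloid_simps intro: extensionalityI)
  next
    fix \<alpha> \<beta> \<gamma> assume arr: "\<alpha> \<in> arr (hom_quantaloid Q R) F G" "\<beta> \<in> arr (hom_quantaloid Q R) F G"
      "\<gamma> \<in> arr (hom_quantaloid Q R) F G"
      and le: "\<alpha> \<sqsubseteq>\<^bsub>hom (hom_quantaloid Q R) F G\<^esub> \<beta>" "\<beta> \<sqsubseteq>\<^bsub>hom (hom_quantaloid Q R) F G\<^esub> \<gamma>"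
    have "\<alpha> X \<sqsubseteq>\<^bsub>hom R (fob F X) (fob G X)\<^esub> \<gamma> X" if X: "X \<in> ob Q" for X
      by (rule complete_lattice_trans[OF cl[OF X], of _ "\<beta> X"]) (use arr le X in \<open>auto simp: hom_quantaloid_simps\<close>)
    then show "\<alpha> \<sqsubseteq>\<^bsub>hom (hom_quantaloid Q R) F G\<^esub> \<gamma>" by (simp add: hom_quantaloid_simps)
  qed (auto simp: hom_quantaloid_simps fun_eq_iff intro: complete_lattice_refl[OF cl])
qed

text \<open>
  Suprema of natural transformations are computed componentwise; naturality of the result holds
  because composition in \<open>R\<close> preserves suprema on both sides.
\<close>

lemma complete_lattice_hom_quantaloid:
  assumes F: "quantaloid_hom Q R F" and G: "quantaloid_hom Q R G"
  shows "Complete_Lattice.complete_lattice (hom (hom_quantaloid Q R) F G)"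
proof (rule partial_order.complete_lattice_if_lubs[OF partial_order_hom_quantaloid[OF F G]])
  fix A assume A: "A \<subseteq> arr (hom_quantaloid Q R) F G"
  note F' = quantaloid_homD[OF F] and G' = quantaloid_homD[OF G]
  let ?H = "\<lambda>X. hom R (fob F X) (fob G X)"
  have cl: "Complete_Lattice.complete_lattice (?H X)" if "X \<in> ob Q" for X
    using R.hom_complete F'(1)[OF that] G'(1)[OF that] by blast
  have A': "(\<lambda>\<alpha>. \<alpha> X) ` A \<subseteq> carrier (?H X)" if "X \<in> ob Q" for X
    using A that by (auto simp: hom_quantaloid_simps subset_iff)
  define s where "s = (\<lambda>X\<in>ob Q. \<Squnion>\<^bsub>?H X\<^esub> ((\<lambda>\<alpha>. \<alpha> X) ` A))"
  have "s \<in> arr (hom_quantaloid Q R) F G"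
    unfolding hom_quantaloid_simps
  proof (intro conjI ballI)
    show "s \<in> extensional (ob Q)" by (simp add: s_def)
    show "s X \<in> carrier (?H X)" if "X \<in> ob Q" for X
      using complete_lattice_sup_closed[OF cl A'] that by (simp add: s_def)
    fix X Y f assume X: "X \<in> ob Q" and Y: "Y \<in> ob Q" and f: "f \<in> arr Q X Y"
    have "cmp R (fob F X) (fob F Y) (fob G Y) (s Y) (farr F X Y f) =
        \<Squnion>\<^bsub>hom R (fob F X) (fob G Y)\<^esub> ((\<lambda>\<alpha>. cmp R (fob F X) (fob F Y) (fob G Y) (\<alpha> Y) (farr F X Y f)) ` A)"
      using R.cmp_sup_left[OF F'(1)[OF X] F'(1)[OF Y] G'(1)[OF Y] F'(4)[OF X Y f]] A'[OF Y] Y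
      by (simp add: sup_preserving_def s_def image_image)
    also have "(\<lambda>\<alpha>. cmp R (fob F X) (fob F Y) (fob G Y) (\<alpha> Y) (farr F X Y f)) ` A =
        (\<lambda>\<alpha>. cmp R (fob F X) (fob G X) (fob G Y) (farr G X Y f) (\<alpha> X)) ` A"
      using A X Y f by (intro image_cong) (auto simp: hom_quantaloid_simps subset_iff)
    also have "\<Squnion>\<^bsub>hom R (fob F X) (fob G Y)\<^esub> \<dots> = cmp R (fob F X) (fob G X) (fob G Y) (farr G X Y f) (s X)"
      using R.cmp_sup_right[OF F'(1)[OF X] G'(1)[OF X] G'(1)[OF Y] G'(4)[OF X Y f]] A'[OF X] X
      by (simp add: sup_preserving_def s_def image_image)
    finally show "cmp R (fob F X) (fob F Y) (fob G Y) (s Y) (farr F X Y f) =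
        cmp R (fob F X) (fob G X) (fob G Y) (farr G X Y f) (s X)" .
  qed
  moreover have "\<alpha> \<sqsubseteq>\<^bsub>hom (hom_quantaloid Q R) F G\<^esub> s" if "\<alpha> \<in> A" for \<alpha>
    using that complete_lattice_sup_upper[OF cl A'] by (auto simp: hom_quantaloid_simps s_def)
  moreover have "s \<sqsubseteq>\<^bsub>hom (hom_quantaloid Q R) F G\<^esub> \<beta>"
    if "\<beta> \<in> arr (hom_quantaloid Q R) F G" "\<forall>\<alpha>\<in>A. \<alpha> \<sqsubseteq>\<^bsub>hom (hom_quantaloid Q R) F G\<^esub> \<beta>" for \<beta>
    unfolding hom_quantaloid_simps(3)
  proof
    fix X assume X: "X \<in> ob Q"
    show "s X \<sqsubseteq>\<^bsub>?H X\<^esub> \<beta> X"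
      unfolding s_def restrict_apply'[OF X]
      by (rule complete_lattice_sup_least[OF cl[OF X] A'[OF X]]) (use that X in \<open>auto simp: hom_quantaloid_simps\<close>)
  qed
  ultimately show "\<exists>s. is_lub (hom (hom_quantaloid Q R) F G) s A"
    unfolding is_lub_iff[OF A] by blast
qed

lemma locally_ordered_hom_quantaloid: "locally_ordered_category (hom_quantaloid Q R)"
proof (rule locally_ordered_category.intro, unfold hom_quantaloid_simps(1) mem_Collect_eq)
  fix F G assume F: "quantaloid_hom Q R F" and G: "quantaloid_hom Q R G"
  note F' = quantaloid_homD[OF F] and G' = quantaloid_homD[OF G]
  show "weak_partial_order (hom (hom_quantaloid Q R) F G)"
    using partial_order_hom_quantaloid[OF F G] by (rule partial_order.axioms)
  fix \<alpha> assume \<alpha>: "\<alpha> \<in> arr (hom_quantaloid Q R) F G"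
  show "cmp (hom_quantaloid Q R) F F G \<alpha> (idt (hom_quantaloid Q R) F) = \<alpha>"
    using \<alpha> F'(1) G'(1) R.cmp_idt_right
    by (intro extensionalityI[of _ "ob Q"]) (auto simp: hom_quantaloid_simps)
  show "cmp (hom_quantaloid Q R) F G G (idt (hom_quantaloid Q R) G) \<alpha> = \<alpha>"
    using \<alpha> F'(1) G'(1) R.cmp_idt_left
    by (intro extensionalityI[of _ "ob Q"]) (auto simp: hom_quantaloid_simps)
next
  fix F assume F: "quantaloid_hom Q R F"
  note F' = quantaloid_homD[OF F]
  show "idt (hom_quantaloid Q R) F \<in> arr (hom_quantaloid Q R) F F"
    using F'(1,4) R.idt_arr R.cmp_idt_right R.cmp_idt_left by (auto simp: hom_quantaloid_simps)
next
  fix F G H \<alpha> \<beta> assume F: "quantaloid_hom Q R F" and G: "quantaloid_hom Q R G" and H: "quantaloid_hom Q R H"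
    and \<alpha>: "\<alpha> \<in> arr (hom_quantaloid Q R) F G" and \<beta>: "\<beta> \<in> arr (hom_quantaloid Q R) G H"
  note F' = quantaloid_homD[OF F] and G' = quantaloid_homD[OF G] and H' = quantaloid_homD[OF H]
  show "cmp (hom_quantaloid Q R) F G H \<beta> \<alpha> \<in> arr (hom_quantaloid Q R) F H"
    unfolding hom_quantaloid_simps
  proof (intro conjI ballI)
    fix X Y f assume X: "X \<in> ob Q" and Y: "Y \<in> ob Q" and f: "f \<in> arr Q X Y"
    note obX = F'(1)[OF X] G'(1)[OF X] H'(1)[OF X] and obY = F'(1)[OF Y] G'(1)[OF Y] H'(1)[OF Y]
    have \<alpha>X: "\<alpha> X \<in> arr R (fob F X) (fob G X)" "\<alpha> Y \<in> arr R (fob F Y) (fob G Y)"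
      and \<beta>X: "\<beta> X \<in> arr R (fob G X) (fob H X)" "\<beta> Y \<in> arr R (fob G Y) (fob H Y)"
      using \<alpha> \<beta> X Y by (auto simp: hom_quantaloid_simps)
    have nat: "cmp R (fob F X) (fob F Y) (fob G Y) (\<alpha> Y) (farr F X Y f) =
        cmp R (fob F X) (fob G X) (fob G Y) (farr G X Y f) (\<alpha> X)"
      "cmp R (fob G X) (fob G Y) (fob H Y) (\<beta> Y) (farr G X Y f) =
        cmp R (fob G X) (fob H X) (fob H Y) (farr H X Y f) (\<beta> X)"
      using \<alpha> \<beta> X Y f by (auto simp: hom_quantaloid_simps)
    note arrs = F'(4)[OF X Y f] G'(4)[OF X Y f] H'(4)[OF X Y f]
    have "cmp R (fob F X) (fob F Y) (fob H Y) (cmp R (fob F Y) (fob G Y) (fob H Y) (\<beta> Y) (\<alpha> Y)) (farr F X Y f) =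
      cmp R (fob F X) (fob G Y) (fob H Y) (\<beta> Y) (cmp R (fob F X) (fob F Y) (fob G Y) (\<alpha> Y) (farr F X Y f))"
      by (rule R.cmp_assoc[OF obX(1) obY arrs(1) \<alpha>X(2) \<beta>X(2), symmetric])
    also have "\<dots> = cmp R (fob F X) (fob G X) (fob H Y) (cmp R (fob G X) (fob G Y) (fob H Y) (\<beta> Y) (farr G X Y f)) (\<alpha> X)"
      unfolding nat(1) by (rule R.cmp_assoc[OF obX(1,2) obY(2,3) \<alpha>X(1) arrs(2) \<beta>X(2)])
    also have "\<dots> = cmp R (fob F X) (fob H X) (fob H Y) (farr H X Y f) (cmp R (fob F X) (fob G X) (fob H X) (\<beta> X) (\<alpha> X))"
      unfolding nat(2) by (rule R.cmp_assoc[OF obX obY(3) \<alpha>X(1) \<beta>X(1) arrs(3), symmetric])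
    finally show "cmp R (fob F X) (fob F Y) (fob H Y) ((\<lambda>X\<in>ob Q. cmp R (fob F X) (fob G X) (fob H X) (\<beta> X) (\<alpha> X)) Y) (farr F X Y f) =
        cmp R (fob F X) (fob H X) (fob H Y) (farr H X Y f) ((\<lambda>X\<in>ob Q. cmp R (fob F X) (fob G X) (fob H X) (\<beta> X) (\<alpha> X)) X)"
      using X Y by simp
  qed (use \<alpha> \<beta> F'(1) G'(1) H'(1) R.cmp_arr in \<open>auto simp: hom_quantaloid_simps\<close>)
  fix \<alpha>' \<beta>' assume "\<alpha>' \<in> arr (hom_quantaloid Q R) F G" "\<beta>' \<in> arr (hom_quantaloid Q R) G H"
    "\<alpha> \<sqsubseteq>\<^bsub>hom (hom_quantaloid Q R) F G\<^esub> \<alpha>'" "\<beta> \<sqsubseteq>\<^bsub>hom (hom_quantaloid Q R) G H\<^esub> \<beta>'"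
  then show "cmp (hom_quantaloid Q R) F G H \<beta> \<alpha> \<sqsubseteq>\<^bsub>hom (hom_quantaloid Q R) F H\<^esub> cmp (hom_quantaloid Q R) F G H \<beta>' \<alpha>'"
    using \<alpha> \<beta> F'(1) G'(1) H'(1) R.cmp_mono by (auto simp: hom_quantaloid_simps)
next
  fix F G H K \<alpha> \<beta> \<gamma> assume F: "quantaloid_hom Q R F" and G: "quantaloid_hom Q R G" and H: "quantaloid_hom Q R H"
    and K: "quantaloid_hom Q R K"
    and "\<alpha> \<in> arr (hom_quantaloid Q R) F G" "\<beta> \<in> arr (hom_quantaloid Q R) G H" "\<gamma> \<in> arr (hom_quantaloid Q R) H K"
  then show "cmp (hom_quantaloid Q R) F H K \<gamma> (cmp (hom_quantaloid Q R) F G H \<beta> \<alpha>) =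
      cmp (hom_quantaloid Q R) F G K (cmp (hom_quantaloid Q R) G H K \<gamma> \<beta>) \<alpha>"
    using quantaloid_homD(1)[OF F] quantaloid_homD(1)[OF G] quantaloid_homD(1)[OF H] quantaloid_homD(1)[OF K]
      R.cmp_assoc by (auto simp: hom_quantaloid_simps fun_eq_iff restrict_def)
qed

end

text \<open>
  The completeness of the homs is what makes a homomorphism monotone: \<open>f \<le> g\<close> means that \<open>g\<close> is the
  supremum of \<open>f\<close> and \<open>g\<close>.
\<close>

lemma quantaloid_equivalent_imp_biequivalent:
  fixes C :: "('o, 'm) ocat" and D :: "('p, 'n) ocat"
  assumes C: "locally_ordered_category C" "\<And>X Y. X \<in> ob C \<Longrightarrow> Y \<in> ob C \<Longrightarrow> Complete_Lattice.complete_lattice (hom C X Y)"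
    and D: "locally_ordered_category D" "\<And>X Y. X \<in> ob D \<Longrightarrow> Y \<in> ob D \<Longrightarrow> Complete_Lattice.complete_lattice (hom D X Y)"
    and eq: "C \<simeq>\<^sub>q D"
  shows "C \<simeq>\<^sub>b D"
proof -
  have pf: "pseudofunctor C D F"
    if C: "locally_ordered_category C" "\<And>X Y. X \<in> ob C \<Longrightarrow> Y \<in> ob C \<Longrightarrow> Complete_Lattice.complete_lattice (hom C X Y)"
    and D: "locally_ordered_category D" "\<And>X Y. X \<in> ob D \<Longrightarrow> Y \<in> ob D \<Longrightarrow> Complete_Lattice.complete_lattice (hom D X Y)"
    and F: "quantaloid_hom C D F"
    for C :: "('a, 'b) ocat" and D :: "('c, 'd) ocat" and F
  proof -
    interpret C: locally_ordered_category C by (rule C)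
    interpret D: locally_ordered_category D by (rule D)
    note F' = quantaloid_homD[OF F]
    have refl: "f .=\<^bsub>hom D X Y\<^esub> f" if "X \<in> ob D" "Y \<in> ob D" "f \<in> arr D X Y" for X Y f
      using D.eq_iff_eqv D.eqv_refl that by blast
    show ?thesis
      unfolding pseudofunctor_def
    proof (intro conjI ballI impI)
      fix X Y f g assume X: "X \<in> ob C" "Y \<in> ob C" and f: "f \<in> arr C X Y" "g \<in> arr C X Y" "f \<sqsubseteq>\<^bsub>hom C X Y\<^esub> g"
      show "farr F X Y f \<sqsubseteq>\<^bsub>hom D (fob F X) (fob F Y)\<^esub> farr F X Y g"
        using sup_preserving_mono[OF C(2)[OF X] D(2)[OF F'(1)[OF X(1)] F'(1)[OF X(2)]] F'(3)[OF X] f] .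
    qed (use F' in \<open>auto intro!: refl D.cmp_arr D.idt_arr\<close>)
  qed
  have iso: "pseudonat_equivalent C C F G"
    if C: "locally_ordered_category C" and F: "quantaloid_hom C C F" and G: "quantaloid_hom C C G"
      and iso: "isomorphic (hom_quantaloid C C) F G" for C :: "('a, 'b) ocat" and F G
  proof -
    interpret C: locally_ordered_category C by (rule C)
    have refl: "f .=\<^bsub>hom C X Y\<^esub> f" if "X \<in> ob C" "Y \<in> ob C" "f \<in> arr C X Y" for X Y f
      using C.eq_iff_eqv C.eqv_refl that by blast
    note F' = quantaloid_homD[OF F] and G' = quantaloid_homD[OF G]
    obtain \<alpha> \<beta> where \<alpha>: "\<alpha> \<in> arr (hom_quantaloid C C) F G" and \<beta>: "\<beta> \<in> arr (hom_quantaloid C C) G F"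
      and inv: "cmp (hom_quantaloid C C) F G F \<beta> \<alpha> = idt (hom_quantaloid C C) F"
        "cmp (hom_quantaloid C C) G F G \<alpha> \<beta> = idt (hom_quantaloid C C) G"
      using iso unfolding isomorphic_def by blast
    have inv': "cmp C (fob F X) (fob G X) (fob F X) (\<beta> X) (\<alpha> X) = idt C (fob F X)"
      "cmp C (fob G X) (fob F X) (fob G X) (\<alpha> X) (\<beta> X) = idt C (fob G X)" if "X \<in> ob C" for X
      using inv[THEN fun_cong, of X] that by (simp_all add: hom_quantaloid_simps)
    show ?thesis
      unfolding pseudonat_equivalent_def equivalence_arr_def
    proof (intro exI[of _ \<alpha>] conjI ballI)
      fix X assume X: "X \<in> ob C"
      then show "\<alpha> X \<in> arr C (fob F X) (fob G X)" using \<alpha> by (simp add: hom_quantaloid_simps)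
      have "\<beta> X \<in> arr C (fob G X) (fob F X)" using \<beta> X by (simp add: hom_quantaloid_simps)
      then show "\<exists>g\<in>arr C (fob G X) (fob F X).
          cmp C (fob F X) (fob G X) (fob F X) g (\<alpha> X) .=\<^bsub>hom C (fob F X) (fob F X)\<^esub> idt C (fob F X) \<and>
          cmp C (fob G X) (fob F X) (fob G X) (\<alpha> X) g .=\<^bsub>hom C (fob G X) (fob G X)\<^esub> idt C (fob G X)"
        using inv'[OF X] refl F'(1)[OF X] G'(1)[OF X] C.idt_arr by (intro bexI[of _ "\<beta> X"]) auto
    next
      fix X Y f assume X: "X \<in> ob C" and Y: "Y \<in> ob C" and f: "f \<in> arr C X Y"
      have "\<alpha> X \<in> arr C (fob F X) (fob G X)" "cmp C (fob F X) (fob F Y) (fob G Y) (\<alpha> Y) (farr F X Y f) =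
          cmp C (fob F X) (fob G X) (fob G Y) (farr G X Y f) (\<alpha> X)"
        using \<alpha> X Y f by (simp_all add: hom_quantaloid_simps)
      then show "cmp C (fob F X) (fob F Y) (fob G Y) (\<alpha> Y) (farr F X Y f) .=\<^bsub>hom C (fob F X) (fob G Y)\<^esub>
          cmp C (fob F X) (fob G X) (fob G Y) (farr G X Y f) (\<alpha> X)"
        using C.cmp_arr[OF F'(1)[OF X] G'(1)[OF X] G'(1)[OF Y] _ G'(4)[OF X Y f]] refl F'(1)[OF X] G'(1)[OF Y]
        by simp
    qed
  qed
  obtain F G where F: "quantaloid_hom C D F" and G: "quantaloid_hom D C G"
    and isos: "isomorphic (hom_quantaloid C C) fctr_id (fctr_comp G F)"
      "isomorphic (hom_quantaloid D D) (fctr_comp F G) fctr_id"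
    using eq unfolding quantaloid_equivalent_def by blast
  have id: "quantaloid_hom K K fctr_id" for K :: "('a, 'b) ocat"
    by (auto simp: quantaloid_hom_def fctr_id_def sup_preserving_def)
  have comp: "quantaloid_hom K M (fctr_comp H' H)"
    if H: "quantaloid_hom K L H" and H': "quantaloid_hom L M H'"
    for K :: "('a, 'b) ocat" and L :: "('c, 'd) ocat" and M :: "('e, 'f) ocat" and H H'
  proof -
    note h = quantaloid_homD[OF H] and h' = quantaloid_homD[OF H']
    have "sup_preserving (hom K X Y) (hom M (fob H' (fob H X)) (fob H' (fob H Y)))
        (\<lambda>f. farr H' (fob H X) (fob H Y) (farr H X Y f))" if X: "X \<in> ob K" "Y \<in> ob K" for X Y
    proof -
      have "farr H X Y ` A \<subseteq> arr L (fob H X) (fob H Y)" if "A \<subseteq> arr K X Y" for A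
        using that h(4)[OF X] by auto
      then show ?thesis
        using h(3)[OF X] h'(3)[OF h(1)[OF X(1)] h(1)[OF X(2)]]
        by (auto simp: sup_preserving_def image_image Pi_iff)
    qed
    then show ?thesis using h h' by (auto simp: quantaloid_hom_def fctr_comp_def)
  qed
  show ?thesis
    unfolding biequivalent_def
    using pf[OF C D F] pf[OF D C G] iso[OF C(1) id comp[OF F G] isos(1)] iso[OF D(1) comp[OF G F] id isos(2)]
    by blast
qed

section \<open>Modules\<close>

text \<open>
  A family at \<open>B\<close> is conjugated to \<open>A\<close>, where it is a scalar, and scalars are invariant under
  conjugation since they are natural.
\<close>

lemma (in scalar_category) detects_scalars_iso:
  assumes A: "detects_scalars A" and B: "B \<in> ob C" and r: "retraction A B r s" "retraction B A s r"
  shows "detects_scalars B"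
proof -
  have A': "A \<in> ob C" using A by (simp add: detects_scalars_def)
  have s: "s \<in> arr C A B" and r': "r \<in> arr C B A"
    and inv: "cmp C A B A r s = idt C A" "cmp C B A B s r = idt C B"
    using r A' B by (auto simp: retraction_def intro: arr_antisym cmp_arr idt_arr)
  have conj: "cmp C A B A r (cmp C A B B (sc q B) s) = sc q A" for q
    using sc_natural[OF A' B s, of q] A' B r' s by (simp add: cmp_assoc sc_arr inv cmp_idt_left)
  show ?thesis
    unfolding detects_scalars_def
  proof (intro conjI allI impI ballI B)
    fix p q assume "le2 B B (sc p B) (sc q B)"
    then have "le2 A A (cmp C A B A r (cmp C A B B (sc p B) s)) (cmp C A B A r (cmp C A B B (sc q B) s))"
      using A' B r' s sc_arr by (intro cmp_mono le2_refl cmp_arr)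
    then show "p \<le> q" using A by (simp add: conj detects_scalars_def)
  next
    fix z assume z: "z \<in> arr C B B"
    have z0: "cmp C A B A r (cmp C A B B z s) \<in> arr C A A" using A' B r' s z by (intro cmp_arr)
    obtain q where q: "\<And>X z'. X \<in> ob C \<Longrightarrow> z' \<in> arr C X X \<Longrightarrow>
        (\<forall>f\<in>arr C A X. cmp C A X X z' f = cmp C A A X f (cmp C A B A r (cmp C A B B z s))) \<Longrightarrow> z' = sc q X"
      using A z0 unfolding detects_scalars_def by meson
    have "z' = sc q X" if X: "X \<in> ob C" and z': "z' \<in> arr C X X"
        and comm: "\<forall>f\<in>arr C B X. cmp C B X X z' f = cmp C B B X f z" for X z'
    proof (rule q[OF X z'], intro ballI)
      fix f assume f: "f \<in> arr C A X"
      have fr: "cmp C B A X f r \<in> arr C B X" using A' B X f r' by (intro cmp_arr)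
      have "cmp C A X X z' f = cmp C A B X (cmp C B X X z' (cmp C B A X f r)) s"
      proof -
        have "f = cmp C A B X (cmp C B A X f r) s"
          using cmp_assoc[OF A' B A' X s r' f] A' X f by (simp add: inv cmp_idt_right)
        then show ?thesis using cmp_assoc[OF A' B X X s fr z'] by simp
      qed
      also have "\<dots> = cmp C A B X (cmp C B B X (cmp C B A X f r) z) s" using comm fr by simp
      also have "\<dots> = cmp C A A X f (cmp C A B A r (cmp C A B B z s))"
        using cmp_assoc[OF A' B B X s z fr] cmp_assoc[OF A' B A' X cmp_arr[OF A' B B s z] r' f] by simp
      finally show "cmp C A X X z' f = cmp C A A X f (cmp C A B A r (cmp C A B B z s))" .
    qed
    then show "\<exists>q. \<forall>X\<in>ob C. \<forall>z'\<in>arr C X X. (\<forall>f\<in>arr C B X. cmp C B X X z' f = cmp C B B X f z) \<longrightarrow> z' = sc q X"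
      by blast
  qed
qed

lemma op_one_object_simps [simp]:
  "ob (op_ocat (one_object_quantaloid T)) = UNIV"
  "hom (op_ocat (one_object_quantaloid T)) X Y = \<lparr>carrier = UNIV, eq = (=), le = (\<le>)\<rparr>"
  "idt (op_ocat (one_object_quantaloid T)) X = 1"
  "cmp (op_ocat (one_object_quantaloid T)) X Y Z g f = f * g"
  by (simp_all add: op_ocat_def)

abbreviation lat :: "(unit, 'q, 'u gorder, 'u \<Rightarrow> 'u) fctr \<Rightarrow> 'u gorder" where
  "lat M \<equiv> fob M ()"

abbreviation act :: "(unit, 'q, 'u gorder, 'u \<Rightarrow> 'u) fctr \<Rightarrow> 'q \<Rightarrow> 'u \<Rightarrow> 'u" where
  "act M \<equiv> farr M () ()"

context small_quantale
begin

abbreviation MK where "MK \<equiv> Mod small TYPE('q)"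

lemma Mod_unfold: "MK = hom_quantaloid (op_ocat (one_object_quantaloid TYPE('q))) (Sup_quantaloid small)"
  by (simp add: Mod_def Modules_def)

lemma Mod_ob_iff: "M \<in> ob MK \<longleftrightarrow> Complete_Lattice.complete_lattice (lat M) \<and> small (carrier (lat M)) \<and>
    act M 1 = (\<lambda>x\<in>carrier (lat M). x) \<and>
    (\<forall>q. act M q \<in> arr (Sup_quantaloid small) (lat M) (lat M)) \<and>
    (\<forall>A. act M (Sup A) = \<Squnion>\<^bsub>hom (Sup_quantaloid small) (lat M) (lat M)\<^esub> (act M ` A)) \<and>
    (\<forall>p q. act M (p * q) = compose (carrier (lat M)) (act M q) (act M p))"
  unfolding Mod_unfold hom_quantaloid_simps quantaloid_hom_def
  by (auto simp: sup_preserving_def[of "\<lparr>carrier = UNIV, eq = (=), le = (\<le>)\<rparr>"] sup_UNIV_order)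

lemma Mod_arr_iff: "\<alpha> \<in> arr MK M N \<longleftrightarrow> \<alpha> () \<in> arr (Sup_quantaloid small) (lat M) (lat N) \<and>
    (\<forall>q. compose (carrier (lat M)) (\<alpha> ()) (act M q) = compose (carrier (lat M)) (act N q) (\<alpha> ()))"
  unfolding Mod_unfold hom_quantaloid_simps by (auto simp: extensional_def)

lemma Mod_le_iff: "\<alpha> \<sqsubseteq>\<^bsub>hom MK M N\<^esub> \<beta> \<longleftrightarrow> (\<forall>x\<in>carrier (lat M). \<alpha> () x \<sqsubseteq>\<^bsub>lat N\<^esub> \<beta> () x)"
  unfolding Mod_unfold hom_quantaloid_simps by simp

lemma Mod_idt: "idt MK M = (\<lambda>_. \<lambda>x\<in>carrier (lat M). x)"
  unfolding Mod_unfold hom_quantaloid_simps by (simp add: restrict_UNIV)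

lemma Mod_cmp: "cmp MK M N P \<beta> \<alpha> = (\<lambda>_. compose (carrier (lat M)) (\<beta> ()) (\<alpha> ()))"
  unfolding Mod_unfold hom_quantaloid_simps by (simp add: restrict_UNIV)

lemma locally_ordered_Mod: "locally_ordered_category MK"
  unfolding Mod_unfold by (rule locally_ordered_hom_quantaloid[OF quantaloid_Sup])

lemma complete_lattice_Mod_hom:
  "M \<in> ob MK \<Longrightarrow> N \<in> ob MK \<Longrightarrow> Complete_Lattice.complete_lattice (hom MK M N)"
  unfolding Mod_unfold hom_quantaloid_simps mem_Collect_eq
  by (rule complete_lattice_hom_quantaloid[OF quantaloid_Sup])

lemma act_closed: "M \<in> ob MK \<Longrightarrow> x \<in> carrier (lat M) \<Longrightarrow> act M q x \<in> carrier (lat M)"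
  by (auto simp: Mod_ob_iff intro: sup_preserving_closed)

lemma act_mult: "M \<in> ob MK \<Longrightarrow> x \<in> carrier (lat M) \<Longrightarrow> act M (p * q) x = act M q (act M p x)"
  by (simp add: Mod_ob_iff compose_eq)

lemma act_Sup:
  assumes M: "M \<in> ob MK" and x: "x \<in> carrier (lat M)"
  shows "act M (Sup A) x = \<Squnion>\<^bsub>lat M\<^esub> ((\<lambda>q. act M q x) ` A)"
proof -
  have cl: "Complete_Lattice.complete_lattice (lat M)"
    and A: "act M ` A \<subseteq> arr (Sup_quantaloid small) (lat M) (lat M)"
    and eq: "act M (Sup A) = \<Squnion>\<^bsub>hom (Sup_quantaloid small) (lat M) (lat M)\<^esub> (act M ` A)"
    using M unfolding Mod_ob_iff by blast+
  show ?thesis unfolding eq Sup_hom_sup[OF cl cl A] using x by (simp add: image_image)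
qed

text \<open>
  By commutativity the action of a scalar is a module morphism; that module morphisms commute with it
  is their definition.
\<close>

sublocale S: scalar_category MK "\<lambda>q M _. act M q"
proof (rule scalar_category.intro[OF locally_ordered_Mod], rule scalar_category_axioms.intro)
  interpret M: locally_ordered_category MK by (rule locally_ordered_Mod)
  show "\<alpha> = \<beta>" if "M \<in> ob MK" "N \<in> ob MK" "\<alpha> \<in> arr MK M N" "\<beta> \<in> arr MK M N" "M.eqv M N \<alpha> \<beta>" for M N \<alpha> \<beta>
    using that complete_lattice_antisym[OF complete_lattice_Mod_hom] by (auto simp: M.eqv_def)
  fix M :: "(unit, 'q, 'u gorder, 'u \<Rightarrow> 'u) fctr" assume M: "M \<in> ob MK"
  have cl: "Complete_Lattice.complete_lattice (lat M)" using M by (simp add: Mod_ob_iff)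
  have comm: "compose (carrier (lat M)) (act M p) (act M q) = act M (p * q)" for p q
  proof -
    have "act M (q * p) = compose (carrier (lat M)) (act M p) (act M q)"
      using M unfolding Mod_ob_iff by blast
    then show ?thesis by (simp add: mult.commute)
  qed
  show "(\<lambda>_. act M q) \<in> arr MK M M" for q
    using M by (auto simp: Mod_arr_iff comm mult.commute) (auto simp: Mod_ob_iff)
  show "(\<lambda>_. act M p) \<sqsubseteq>\<^bsub>hom MK M M\<^esub> (\<lambda>_. act M q)" if "p \<le> q" for p q
    unfolding Mod_le_iff
  proof
    fix x assume x: "x \<in> carrier (lat M)"
    have "act M q x = \<Squnion>\<^bsub>lat M\<^esub> ((\<lambda>q. act M q x) ` {p, q})"
      using act_Sup[OF M x, of "{p, q}"] that by (simp add: Lattices.sup_absorb2)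
    then show "act M p x \<sqsubseteq>\<^bsub>lat M\<^esub> act M q x"
      using complete_lattice_sup_upper[OF cl, of "(\<lambda>q. act M q x) ` {p, q}" "act M p x"] act_closed[OF M x] by auto
  qed
  show "(\<lambda>_. act M (p * q)) = cmp MK M M M (\<lambda>_. act M p) (\<lambda>_. act M q)" for p q
    by (simp add: Mod_cmp comm)
  show "cmp MK M N N (\<lambda>_. act N q) \<alpha> = cmp MK M M N \<alpha> (\<lambda>_. act M q)" if "\<alpha> \<in> arr MK M N" for N \<alpha> q
    using that by (simp add: Mod_arr_iff Mod_cmp)
qed

text \<open>
  The regular module is realised on a small subset of \<open>'u\<close> by means of an injection \<open>i\<close> of \<open>Q\<close>.  For an
  element \<open>n\<close> of a module \<open>N\<close>, the family is tested on the morphism \<open>q \<mapsto> q \<cdot> n\<close>, at the element \<open>1\<close>.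
\<close>

lemma regular_module_detects_scalars:
  obtains M where "S.detects_scalars M"
proof -
  have "tiny (UNIV :: 'q set)"
    using exponents by (rule tiny_exponent)
  then obtain J dec where J: "small J" "UNIV \<subseteq> (dec :: 'u \<Rightarrow> 'q) ` J" unfolding tiny_def by blast
  define i where "i = inv_into J dec"
  have dec: "dec (i q) = q" "i q \<in> J" for q
    using J(2) f_inv_into_f[of q dec J] inv_into_into[of q dec J] unfolding i_def by auto
  define L :: "'u gorder" where "L = \<lparr>carrier = range i, eq = (=), le = (\<lambda>x y. dec x \<le> dec y)\<rparr>"
  have po: "partial_order L" by unfold_locales (auto simp: L_def dec)
  have carrier: "carrier L = range i" by (simp add: L_def)
  have lub: "is_lub L (i (Sup (dec ` A))) A" if "A \<subseteq> carrier L" for A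
    unfolding is_lub_iff[OF that] by (auto simp: L_def dec intro: Sup_upper SUP_upper SUP_least)
  have cl: "Complete_Lattice.complete_lattice L"
    using partial_order.complete_lattice_if_lubs[OF po] lub by blast
  have sup: "\<Squnion>\<^bsub>L\<^esub> A = i (Sup (dec ` A))" if "A \<subseteq> carrier L" for A
    using complete_lattice_sup_eqI[OF cl lub[OF that]] .
  define a where "a q = (\<lambda>x\<in>range i. i (q * dec x))" for q
  have a_sup: "sup_preserving L L (a q)" for q
    unfolding sup_preserving_def
  proof (intro conjI allI impI)
    show "a q \<in> carrier L \<rightarrow> carrier L" by (auto simp: a_def L_def)
    fix A assume A: "A \<subseteq> carrier L"
    have aA: "a q ` A \<subseteq> carrier L" using A by (auto simp: a_def L_def)
    have "dec ` a q ` A = (\<lambda>x. q * x) ` dec ` A"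
      using A unfolding image_image by (intro image_cong) (auto simp: a_def L_def dec)
    then show "a q (\<Squnion>\<^bsub>L\<^esub> A) = \<Squnion>\<^bsub>L\<^esub> (a q ` A)"
      unfolding sup[OF A] sup[OF aA] by (simp add: a_def dec mult_Sup_distrib)
  qed
  define M :: "(unit, 'q, 'u gorder, 'u \<Rightarrow> 'u) fctr" where "M = \<lparr>fob = (\<lambda>_. L), farr = (\<lambda>_ _. a)\<rparr>"
  have M_simps: "lat M = L" "act M = a" by (simp_all add: M_def)
  have "a (Sup A) = \<Squnion>\<^bsub>hom (Sup_quantaloid small) L L\<^esub> (a ` A)" for A
  proof -
    have "a ` A \<subseteq> arr (Sup_quantaloid small) L L" using a_sup by (auto simp: a_def carrier)
    moreover have "i (Sup A * q) = \<Squnion>\<^bsub>L\<^esub> ((\<lambda>f. f (i q)) ` a ` A)" for q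
      by (subst sup) (auto simp: a_def carrier dec image_image Sup_mult_distrib)
    ultimately show ?thesis
      by (subst Sup_hom_sup[OF cl cl]) (auto simp: a_def carrier dec fun_eq_iff restrict_def)
  qed
  moreover have "range i \<subseteq> J" using dec(2) by auto
  then have "small (carrier L)" unfolding carrier by (rule small_subset[OF J(1)])
  moreover have "a 1 = (\<lambda>x\<in>carrier L. x)"
    by (auto simp: a_def carrier dec restrict_def fun_eq_iff)
  moreover have "a (p * q) = compose (carrier L) (a q) (a p)" for p q
    by (auto simp: a_def carrier dec compose_def restrict_def fun_eq_iff mult.assoc mult.left_commute)
  moreover have "a q \<in> extensional (carrier L)" for q by (simp add: a_def carrier)
  ultimately have M: "M \<in> ob MK"
    using a_sup cl unfolding Mod_ob_iff M_simps by simp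
  have "S.detects_scalars M"
    unfolding S.detects_scalars_def
  proof (intro conjI allI impI ballI M)
    fix p q assume "(\<lambda>_. act M p) \<sqsubseteq>\<^bsub>hom MK M M\<^esub> (\<lambda>_. act M q)"
    then have "a p (i 1) \<sqsubseteq>\<^bsub>L\<^esub> a q (i 1)" by (simp add: Mod_le_iff M_simps carrier)
    then show "p \<le> q" by (simp add: a_def L_def dec)
  next
    fix \<zeta> assume \<zeta>: "\<zeta> \<in> arr MK M M"
    have \<zeta>1: "\<zeta> () (i 1) \<in> range i"
      using \<zeta> sup_preserving_closed[of L L "\<zeta> ()" "i 1"] by (auto simp: Mod_arr_iff M_simps carrier)
    show "\<exists>q. \<forall>N\<in>ob MK. \<forall>\<zeta>'\<in>arr MK N N. (\<forall>\<alpha>\<in>arr MK M N. cmp MK M N N \<zeta>' \<alpha> = cmp MK M M N \<alpha> \<zeta>) \<longrightarrow> \<zeta>' = (\<lambda>_. act N q)"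
    proof (intro exI ballI impI)
      fix N \<zeta>' assume N: "N \<in> ob MK" and \<zeta>': "\<zeta>' \<in> arr MK N N"
        and comm: "\<forall>\<alpha>\<in>arr MK M N. cmp MK M N N \<zeta>' \<alpha> = cmp MK M M N \<alpha> \<zeta>"
      have clN: "Complete_Lattice.complete_lattice (lat N)" using N by (simp add: Mod_ob_iff)
      have "\<zeta>' () n = act N (dec (\<zeta> () (i 1))) n" if n: "n \<in> carrier (lat N)" for n
      proof -
        define \<phi> where "\<phi> = (\<lambda>x\<in>range i. act N (dec x) n)"
        have "sup_preserving L (lat N) \<phi>"
          unfolding sup_preserving_def
        proof (intro conjI allI impI)
          show "\<phi> \<in> carrier L \<rightarrow> carrier (lat N)" using act_closed[OF N n] by (auto simp: \<phi>_def carrier)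
          fix A assume A: "A \<subseteq> carrier L"
          have "\<phi> (\<Squnion>\<^bsub>L\<^esub> A) = \<Squnion>\<^bsub>lat N\<^esub> ((\<lambda>q. act N q n) ` dec ` A)"
            unfolding sup[OF A] using act_Sup[OF N n] by (simp add: \<phi>_def dec)
          also have "(\<lambda>q. act N q n) ` dec ` A = \<phi> ` A"
            using A unfolding image_image by (intro image_cong) (auto simp: \<phi>_def carrier)
          finally show "\<phi> (\<Squnion>\<^bsub>L\<^esub> A) = \<Squnion>\<^bsub>lat N\<^esub> (\<phi> ` A)" .
        qed
        moreover have "compose (carrier L) \<phi> (a q) = compose (carrier L) (act N q) \<phi>" for q
          using act_mult[OF N n] by (auto simp: compose_def carrier \<phi>_def a_def dec fun_eq_iff restrict_def mult.commute[of q])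
        ultimately have "(\<lambda>_. \<phi>) \<in> arr MK M N"
          by (auto simp: Mod_arr_iff M_simps \<phi>_def carrier)
        then have "compose (carrier L) (\<zeta>' ()) \<phi> (i 1) = compose (carrier L) \<phi> (\<zeta> ()) (i 1)"
          using comm by (auto simp: Mod_cmp M_simps dest!: bspec[of _ _ "\<lambda>_. \<phi>"] fun_cong)
        moreover have "\<phi> (i 1) = n" using N n by (simp add: \<phi>_def dec Mod_ob_iff)
        ultimately show ?thesis using \<zeta>1 by (auto simp: compose_eq carrier \<phi>_def)
      qed
      then have "\<zeta>' () = act N (dec (\<zeta> () (i 1)))"
        using \<zeta>' N by (intro extensionalityI[of _ "carrier (lat N)"]) (auto simp: Mod_arr_iff Mod_ob_iff)
      then show "\<zeta>' = (\<lambda>_. act N (dec (\<zeta> () (i 1))))" by (auto simp: fun_eq_iff)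
    qed
  qed
  then show ?thesis by (rule that)
qed

end

theorem Mod_equivalent_imp_iso:
  fixes small :: "'u set \<Rightarrow> bool"
  assumes "universe small"
    and "closed_under_exponents small TYPE('q::comm_quantale)"
    and "closed_under_exponents small TYPE('r::comm_quantale)"
    and eq: "Mod small TYPE('q) \<simeq>\<^sub>q Mod small TYPE('r)"
  shows "\<exists>\<phi> :: 'q \<Rightarrow> 'r. quantale_iso \<phi>"
proof -
  interpret C: small_quantale small "TYPE('q)"
    using assms by (simp add: small_quantale_def small_quantale_axioms_def)
  interpret D: small_quantale small "TYPE('r)"
    using assms by (simp add: small_quantale_def small_quantale_axioms_def)
  have "C.MK \<simeq>\<^sub>b D.MK"
    by (rule quantaloid_equivalent_imp_biequivalent[OF C.locally_ordered_Mod C.complete_lattice_Mod_hom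
          D.locally_ordered_Mod D.complete_lattice_Mod_hom eq])
  then obtain F where F: "weak_equivalence C.MK D.MK F"
    using biequivalent_weak_equivalence[OF C.locally_ordered_Mod D.locally_ordered_Mod] by blast
  interpret F: weak_equivalence C.MK D.MK F by (rule F)
  interpret F: scalar_equivalence C.MK "\<lambda>q M _. act M q" D.MK "\<lambda>q M _. act M q" "fob F" "farr F"
  proof unfold_locales
    show "farr F X Z (cmp C.MK X Y Z g f) = cmp D.MK (fob F X) (fob F Y) (fob F Z) (farr F Y Z g) (farr F X Y f)"
      if "X \<in> ob C.MK" "Y \<in> ob C.MK" "Z \<in> ob C.MK" "f \<in> arr C.MK X Y" "g \<in> arr C.MK Y Z" for X Y Z f g
      using that by (intro D.S.arr_antisym[OF _ _ _ _ F.F_cmp] F.F_ob F.F_arr C.S.cmp_arr D.S.cmp_arr)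
    show "\<exists>f\<in>arr C.MK X Y. h = farr F X Y f"
      if "X \<in> ob C.MK" "Y \<in> ob C.MK" "h \<in> arr D.MK (fob F X) (fob F Y)" for X Y h
      using F.F_full[OF that] D.S.arr_antisym F.F_ob F.F_arr that by metis
  qed (use F.F_ob F.F_arr F.F_le2_iff in auto)
  obtain A0 where A0: "C.S.detects_scalars A0" by (rule C.regular_module_detects_scalars)
  obtain B0 where B0: "D.S.detects_scalars B0" by (rule D.regular_module_detects_scalars)
  then obtain A1 e e' where A1: "A1 \<in> ob C.MK" "D.S.retraction B0 (fob F A1) e' e" "D.S.retraction (fob F A1) B0 e e'"
    using F.F_surj D.S.detects_scalars_def by blast
  have "D.S.detects_scalars (fob F A1)"
    by (rule D.S.detects_scalars_iso[OF B0 F.F_ob[OF A1(1)] A1(2,3)])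
  then show ?thesis using F.scalars_iso[OF A0 A1(1)] by blast
qed

section \<open>Transport along an isomorphism of quantales\<close>

text \<open>
  A strict isomorphism that is the identity on arrows.  An isomorphism of quantales changes the types
  and homs of an enriched category, and the action on a module, but neither functors nor module
  morphisms.
\<close>

locale relabelling =
  C: locally_ordered_category C + D: locally_ordered_category D
  for C :: "('o, 'm) ocat" and D :: "('p, 'm) ocat" +
  fixes Fo :: "'o \<Rightarrow> 'p" and Go :: "'p \<Rightarrow> 'o"
  assumes Fo_ob: "X \<in> ob C \<Longrightarrow> Fo X \<in> ob D" and Go_ob: "Y \<in> ob D \<Longrightarrow> Go Y \<in> ob C"
    and Go_Fo: "Go (Fo X) = X" and Fo_Go: "Fo (Go Y) = Y"
    and hom_Fo: "hom D (Fo X) (Fo X') = hom C X X'"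
    and idt_Fo: "idt D (Fo X) = idt C X"
    and cmp_Fo: "cmp D (Fo X) (Fo X') (Fo X'') g f = cmp C X X' X'' g f"
begin

lemma hom_Go: "hom C (Go Y) (Go Y') = hom D Y Y'"
  using hom_Fo[of "Go Y" "Go Y'"] by (simp add: Fo_Go)

lemma idt_Go: "idt C (Go Y) = idt D Y"
  using idt_Fo[of "Go Y"] by (simp add: Fo_Go)

lemma cmp_Go: "cmp C (Go Y) (Go Y') (Go Y'') g f = cmp D Y Y' Y'' g f"
  using cmp_Fo[of "Go Y" "Go Y'" "Go Y''"] by (simp add: Fo_Go)

lemma fctr_comps:
  "fctr_comp \<lparr>fob = Go, farr = \<lambda>_ _ f. f\<rparr> \<lparr>fob = Fo, farr = \<lambda>_ _ f. f\<rparr> = fctr_id"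
  "fctr_comp \<lparr>fob = Fo, farr = \<lambda>_ _ f. f\<rparr> \<lparr>fob = Go, farr = \<lambda>_ _ f. f\<rparr> = fctr_id"
  by (simp_all add: fctr_comp_def fctr_id_def Go_Fo Fo_Go)

lemma quantaloid_equivalent: "C \<simeq>\<^sub>q D"
proof -
  have F: "quantaloid_hom C D \<lparr>fob = Fo, farr = \<lambda>_ _ f. f\<rparr>"
    by (auto simp: quantaloid_hom_def Fo_ob idt_Fo hom_Fo cmp_Fo sup_preserving_def)
  have G: "quantaloid_hom D C \<lparr>fob = Go, farr = \<lambda>_ _ f. f\<rparr>"
    by (auto simp: quantaloid_hom_def Go_ob idt_Go hom_Go cmp_Go sup_preserving_def)
  have iso: "isomorphic (hom_quantaloid K K) fctr_id fctr_id"
    if "locally_ordered_category K" for K :: "('a, 'b) ocat"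
  proof -
    interpret K: locally_ordered_category K by (rule that)
    have "(\<lambda>X\<in>ob K. idt K X) \<in> arr (hom_quantaloid K K) fctr_id fctr_id"
      by (auto simp: hom_quantaloid_simps fctr_id_def K.idt_arr K.cmp_idt_left K.cmp_idt_right)
    moreover have "cmp (hom_quantaloid K K) fctr_id fctr_id fctr_id (\<lambda>X\<in>ob K. idt K X) (\<lambda>X\<in>ob K. idt K X) =
        idt (hom_quantaloid K K) fctr_id"
      by (auto simp: hom_quantaloid_simps fctr_id_def K.idt_arr K.cmp_idt_left restrict_def fun_eq_iff)
    ultimately show ?thesis unfolding isomorphic_def by blast
  qed
  show ?thesis
    unfolding quantaloid_equivalent_def
    using F G fctr_comps iso[OF C.locally_ordered_category_axioms] iso[OF D.locally_ordered_category_axioms]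
    by metis
qed

lemma biequivalent: "C \<simeq>\<^sub>b D"
proof -
  have refl_C: "f .=\<^bsub>hom C X Y\<^esub> f" if "X \<in> ob C" "Y \<in> ob C" "f \<in> arr C X Y" for X Y f
    using C.eq_iff_eqv C.eqv_refl that by blast
  have refl_D: "f .=\<^bsub>hom D X Y\<^esub> f" if "X \<in> ob D" "Y \<in> ob D" "f \<in> arr D X Y" for X Y f
    using D.eq_iff_eqv D.eqv_refl that by blast
  have F: "pseudofunctor C D \<lparr>fob = Fo, farr = \<lambda>_ _ f. f\<rparr>"
    by (auto simp: pseudofunctor_def Fo_ob idt_Fo hom_Fo cmp_Fo intro!: refl_C C.idt_arr C.cmp_arr)
  have G: "pseudofunctor D C \<lparr>fob = Go, farr = \<lambda>_ _ f. f\<rparr>"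
    by (auto simp: pseudofunctor_def Go_ob idt_Go hom_Go cmp_Go intro!: refl_D D.idt_arr D.cmp_arr)
  have iso: "pseudonat_equivalent K K fctr_id fctr_id"
    if "locally_ordered_category K" for K :: "('a, 'b) ocat"
  proof -
    interpret K: locally_ordered_category K by (rule that)
    have refl: "f .=\<^bsub>hom K X Y\<^esub> f" if "X \<in> ob K" "Y \<in> ob K" "f \<in> arr K X Y" for X Y f
      using K.eq_iff_eqv K.eqv_refl that by blast
    then have "equivalence_arr K X X (idt K X)" if "X \<in> ob K" for X
      using that unfolding equivalence_arr_def
      by (intro conjI bexI[of _ "idt K X"]) (auto simp: K.idt_arr K.cmp_idt_left)
    with refl show ?thesis
      unfolding pseudonat_equivalent_def
      by (intro exI[of _ "idt K"]) (auto simp: fctr_id_def K.cmp_idt_left K.cmp_idt_right)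
  qed
  show ?thesis
    unfolding biequivalent_def
    using F G fctr_comps iso[OF C.locally_ordered_category_axioms] iso[OF D.locally_ordered_category_axioms]
    by metis
qed

end

definition relabel_ecat :: "('q \<Rightarrow> 'r) \<Rightarrow> ('u, 'q, 'q) ecat \<Rightarrow> ('u, 'r, 'r) ecat" where
  "relabel_ecat \<phi> A = \<lparr>elts = elts A, ty = (\<lambda>a. \<phi> (ty A a)), ehom = (\<lambda>b a. \<phi> (ehom A b a))\<rparr>"

lemma relabel_ecat_simps [simp]:
  "elts (relabel_ecat \<phi> A) = elts A" "ty (relabel_ecat \<phi> A) a = \<phi> (ty A a)"
  "ehom (relabel_ecat \<phi> A) b a = \<phi> (ehom A b a)"
  by (simp_all add: relabel_ecat_def)

lemma quantale_isoD:
  assumes "quantale_iso \<phi>"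
  shows "\<phi> (a * b) = \<phi> a * \<phi> b" "\<phi> a \<le> \<phi> b \<longleftrightarrow> a \<le> b" "\<phi> a = \<phi> b \<longleftrightarrow> a = b"
    "\<phi> (inv \<phi> c) = c" "inv \<phi> (\<phi> a) = a"
  using assms by (auto simp: quantale_iso_def bij_is_surj surj_f_inv_f bij_is_inj inj_eq)

lemma adjoint_presheaf_relabel:
  assumes \<phi>: "quantale_iso \<phi>" and adj: "adjoint_presheaf A e f g"
  shows "adjoint_presheaf (relabel_ecat \<phi> A) (\<phi> e) (\<lambda>a. \<phi> (f a)) (\<lambda>a. \<phi> (g a))"
proof -
  have "(SUP a\<in>elts A. \<phi> (g a) * \<phi> (f a)) = \<phi> (SUP a\<in>elts A. g a * f a)"
    by (simp add: quantale_iso_Sup[OF \<phi>] image_image quantale_isoD(1)[OF \<phi>])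
  then show ?thesis
    using adj unfolding adjoint_presheaf_def presheaf_def copresheaf_def
    by (simp add: quantale_isoD[OF \<phi>] flip: quantale_isoD(1)[OF \<phi>])
qed

lemma relabel_ecat_inv:
  assumes "quantale_iso \<phi>"
  shows "relabel_ecat (inv \<phi>) (relabel_ecat \<phi> A) = A" "relabel_ecat \<phi> (relabel_ecat (inv \<phi>) B) = B"
  by (simp_all add: relabel_ecat_def quantale_isoD[OF assms])

lemma idem_category_relabel:
  assumes "quantale_iso \<phi>" "idem_category A" shows "idem_category (relabel_ecat \<phi> A)"
  using assms(2) unfolding idem_category_def
  by (simp add: quantale_isoD[OF assms(1)] flip: quantale_isoD(1)[OF assms(1)])

lemma cauchy_relabel:
  assumes \<phi>: "quantale_iso \<phi>" and A: "cauchy A" shows "cauchy (relabel_ecat \<phi> A)"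
  unfolding cauchy_def
proof (intro allI impI)
  fix e f g assume "adjoint_presheaf (relabel_ecat \<phi> A) e f g"
  then have "adjoint_presheaf A (inv \<phi> e) (\<lambda>a. inv \<phi> (f a)) (\<lambda>a. inv \<phi> (g a))"
    using adjoint_presheaf_relabel[OF quantale_iso_inv[OF \<phi>]] by (metis relabel_ecat_inv(1)[OF \<phi>])
  then obtain c where "c \<in> elts A" "ty A c = inv \<phi> e" "\<forall>x\<in>elts A. inv \<phi> (f x) = ehom A x c"
    using A unfolding cauchy_def by blast
  moreover have "f x = \<phi> (ehom A x c)" if "x \<in> elts A" for x
    using calculation(3) that quantale_isoD(4)[OF \<phi>, of "f x"] by simp
  ultimately show "\<exists>c\<in>elts (relabel_ecat \<phi> A). ty (relabel_ecat \<phi> A) c = e \<and>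
      (\<forall>x\<in>elts (relabel_ecat \<phi> A). f x = ehom (relabel_ecat \<phi> A) x c)"
    by (intro bexI[of _ c]) (auto simp: quantale_isoD(4)[OF \<phi>])
qed

lemma iso_imp_Ord_biequivalent:
  fixes \<phi> :: "'q::comm_quantale \<Rightarrow> 'r::comm_quantale" and small :: "'u set \<Rightarrow> bool"
  assumes "universe small" "closed_under_exponents small TYPE('q)" "closed_under_exponents small TYPE('r)"
    and \<phi>: "quantale_iso \<phi>"
  shows "Ord small TYPE('q) \<simeq>\<^sub>b Ord small TYPE('r)"
proof -
  interpret C: small_quantale small "TYPE('q)"
    using assms by (simp add: small_quantale_def small_quantale_axioms_def)
  interpret D: small_quantale small "TYPE('r)"
    using assms by (simp add: small_quantale_def small_quantale_axioms_def)
  have le: "functor_le (Idm TYPE('r)) (relabel_ecat \<phi> A) (relabel_ecat \<phi> B) = functor_le (Idm TYPE('q)) A B" 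
    for A B :: "('u, 'q, 'q) ecat"
    by (auto simp: functor_le_Idm_iff quantale_isoD[OF \<phi>] fun_eq_iff)
  have arr: "enriched_functor (Idm TYPE('r)) (relabel_ecat \<phi> A) (relabel_ecat \<phi> B) = enriched_functor (Idm TYPE('q)) A B"
    for A B :: "('u, 'q, 'q) ecat"
    by (auto simp: functor_Idm_iff quantale_isoD[OF \<phi>] fun_eq_iff)
  interpret relabelling C.K D.K "relabel_ecat \<phi>" "relabel_ecat (inv \<phi>)"
  proof (intro relabelling.intro relabelling_axioms.intro C.locally_ordered_Ord D.locally_ordered_Ord)
    show "hom D.K (relabel_ecat \<phi> A) (relabel_ecat \<phi> B) = hom C.K A B" for A B
      by (simp add: Ord_def Cat_cc_def le arr)
  qed (auto simp: C.Ord_ob_iff D.Ord_ob_iff relabel_ecat_inv[OF \<phi>] C.Ord_idt D.Ord_idt C.Ord_cmp D.Ord_cmp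
      intro: idem_category_relabel cauchy_relabel \<phi> quantale_iso_inv)
  show ?thesis by (rule biequivalent)
qed

text \<open>
  Restriction of scalars, hence contravariant in \<open>\<phi>\<close>.
\<close>

definition relabel_module ::
  "('q \<Rightarrow> 'r) \<Rightarrow> (unit, 'r, 'u gorder, 'u \<Rightarrow> 'u) fctr \<Rightarrow> (unit, 'q, 'u gorder, 'u \<Rightarrow> 'u) fctr" where
  "relabel_module \<phi> M = \<lparr>fob = fob M, farr = (\<lambda>X Y q. farr M X Y (\<phi> q))\<rparr>"

lemma relabel_module_simps [simp]:
  "fob (relabel_module \<phi> M) = fob M" "farr (relabel_module \<phi> M) X Y q = farr M X Y (\<phi> q)"
  by (simp_all add: relabel_module_def)

lemma relabel_module_ob:
  fixes \<phi> :: "'q::comm_quantale \<Rightarrow> 'r::comm_quantale" and small :: "'u set \<Rightarrow> bool"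
  assumes "universe small" "closed_under_exponents small TYPE('q)" "closed_under_exponents small TYPE('r)"
    and \<phi>: "quantale_iso \<phi>" and M: "M \<in> ob (Mod small TYPE('r))"
  shows "relabel_module \<phi> M \<in> ob (Mod small TYPE('q))"
proof -
  interpret C: small_quantale small "TYPE('q)"
    using assms by (simp add: small_quantale_def small_quantale_axioms_def)
  interpret D: small_quantale small "TYPE('r)"
    using assms by (simp add: small_quantale_def small_quantale_axioms_def)
  have "act M (Sup (\<phi> ` A)) = \<Squnion>\<^bsub>hom (Sup_quantaloid small) (lat M) (lat M)\<^esub> (act M ` \<phi> ` A)" for A
    using M unfolding D.Mod_ob_iff by blast
  then show ?thesis
    using M unfolding C.Mod_ob_iff D.Mod_ob_iff
    by (simp add: quantale_iso_one[OF \<phi>] quantale_isoD(1)[OF \<phi>] quantale_iso_Sup[OF \<phi>] image_image)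
qed

lemma iso_imp_Mod_equivalent:
  fixes \<phi> :: "'q::comm_quantale \<Rightarrow> 'r::comm_quantale" and small :: "'u set \<Rightarrow> bool"
  assumes ce: "universe small" "closed_under_exponents small TYPE('q)" "closed_under_exponents small TYPE('r)"
    and \<phi>: "quantale_iso \<phi>"
  shows "Mod small TYPE('q) \<simeq>\<^sub>q Mod small TYPE('r)"
proof -
  interpret C: small_quantale small "TYPE('q)"
    using assms by (simp add: small_quantale_def small_quantale_axioms_def)
  interpret D: small_quantale small "TYPE('r)"
    using assms by (simp add: small_quantale_def small_quantale_axioms_def)
  interpret relabelling C.MK D.MK "relabel_module (inv \<phi>)" "relabel_module \<phi>"
  proof (intro relabelling.intro relabelling_axioms.intro C.locally_ordered_Mod D.locally_ordered_Mod)
    show "relabel_module (inv \<phi>) M \<in> ob D.MK" if "M \<in> ob C.MK" for M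
      using relabel_module_ob[OF ce(1,3,2) quantale_iso_inv[OF \<phi>] that] .
    show "relabel_module \<phi> M \<in> ob C.MK" if "M \<in> ob D.MK" for M
      using relabel_module_ob[OF ce \<phi> that] .
    show "hom D.MK (relabel_module (inv \<phi>) M) (relabel_module (inv \<phi>) N) = hom C.MK M N" for M N
    proof -
      have "(\<forall>r. compose L (\<alpha> ()) (act M (inv \<phi> r)) = compose L (act N (inv \<phi> r)) (\<alpha> ())) \<longleftrightarrow>
          (\<forall>q. compose L (\<alpha> ()) (act M q) = compose L (act N q) (\<alpha> ()))" for \<alpha> L
        using quantale_isoD(5)[OF \<phi>] by metis
      then show ?thesis by (simp add: Mod_def Modules_def hom_quantaloid_def)
    qed
  qed (simp_all add: relabel_module_def quantale_isoD[OF \<phi>] C.Mod_idt D.Mod_idt C.Mod_cmp D.Mod_cmp)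
  show ?thesis by (rule quantaloid_equivalent)
qed

section \<open>The equivalence of the three conditions\<close>

theorem corollary4p3:
  fixes small :: "'u set \<Rightarrow> bool"
  assumes "universe small"
    and "closed_under_exponents small TYPE('q::comm_quantale)"
    and "closed_under_exponents small TYPE('r::comm_quantale)"
  shows "(one_object_quantaloid TYPE('q) \<simeq>\<^sub>q one_object_quantaloid TYPE('r)
            \<longleftrightarrow> Ord small TYPE('q) \<simeq>\<^sub>b Ord small TYPE('r))
       \<and> (Ord small TYPE('q) \<simeq>\<^sub>b Ord small TYPE('r)
            \<longleftrightarrow> Mod small TYPE('q) \<simeq>\<^sub>q Mod small TYPE('r))"
proof -
  have "one_object_quantaloid TYPE('q) \<simeq>\<^sub>q one_object_quantaloid TYPE('r) \<longleftrightarrow> (\<exists>\<phi> :: 'q \<Rightarrow> 'r. quantale_iso \<phi>)"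
    by (rule one_object_equivalent_iff)
  moreover have "Ord small TYPE('q) \<simeq>\<^sub>b Ord small TYPE('r) \<longleftrightarrow> (\<exists>\<phi> :: 'q \<Rightarrow> 'r. quantale_iso \<phi>)"
    using Ord_biequivalent_imp_iso[OF assms] iso_imp_Ord_biequivalent[OF assms] by blast
  moreover have "Mod small TYPE('q) \<simeq>\<^sub>q Mod small TYPE('r) \<longleftrightarrow> (\<exists>\<phi> :: 'q \<Rightarrow> 'r. quantale_iso \<phi>)"
    using Mod_equivalent_imp_iso[OF assms] iso_imp_Mod_equivalent[OF assms] by blast
  ultimately show ?thesis by blast
qed

end
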